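(* Let $0<\alpha_0<\alpha_1<1$, let $\nu$ be a probability measure on $[\alpha_0,\alpha_1]$, let $\Omega=[\alpha_0,\alpha_1]^{\mathbb Z}$ with $P=\nu^{\mathbb Z}$ and left shift $\sigma$, and let $f_\omega$, $\omega\in\Omega$, be the random family of LSV maps defined in the context. Assume there are constants $q=q(\nu)\ge0$ and $c(\nu)>0$ such that $$\frac{(\log\ell)^q}{\ell}\sum_{k=1}^{\ell}E_\nu A_k\longrightarrow c(\nu)\qquad(\ell\to\infty),$$ where the random variables $A_k$ are defined in the context. Then there is a family of absolutely continuous (with respect to Lebesgue measure) probability measures $\mu_\omega$ on $[0,1]$, defined for almost every $\omega\in\Omega$, with $(f_\omega)_*\mu_\omega=\mu_{\sigma\omega}$. The system $\{f_\omega,\mu_\omega\}_{\omega\in\Omega}$ is mixing: setting $\mu=\int_\Omega\mu_\omega\,dP$, for all $\varphi,\psi\in L^2(\mu)$, $$\lim_{n\to\infty}\left|\int_\Omega\int_0^1\varphi_{\sigma^n\omega}\circ f_\omega^n\cdot\psi_\omega\,d\mu_\omega dP-\int_\Omega\int_0^1\varphi_\omega\,d\mu_\omega dP\int_\Omega\int_0^1\psi_\omega\,d\mu_\omega dP\right|=0.$$ Moreover, let $\eta\in(0,1]$. For every $\delta>0$ there is a full measure subset $\Omega_0\subset\Omega$ such that for every $\omega\in\Omega_0$ there is $C_\omega<\infty$ so that for any $\varphi\in L^\infty[0,1]$ and any $\eta$-Hölder function $\psi\in C^\eta[0,1]$ there is a constant $C_{\varphi,\psi}$ (independent of $\omega$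 and $n$) with, for all $n\in\mathbb N$: (i) ("future" correlations) $$\left|\int(\varphi\circ f_\omega^n)\psi\,d\mu_\omega-\int\varphi\,d\mu_{\sigma^n\omega}\int\psi\,d\mu_\omega\right|\le C_\omega C_{\varphi,\psi}\frac{1}{n^{\frac1{\alpha_0}-\delta-1}};$$ (ii) ("past" correlations) $$\left|\int(\varphi\circ f_{\sigma^{-n}\omega}^n)\psi\,d\mu_{\sigma^{-n}\omega}-\int\varphi\,d\mu_\omega\int\psi\,d\mu_{\sigma^{-n}\omega}\right|\le C_\omega C_{\varphi,\psi}\frac{1}{n^{\frac1{\alpha_0}-\delta-1}}.$$ Finally, there exist constants $C>0$, $u'>0$ and $0<v'<1$ such that $P\{C_\omega>n\}\le Ce^{-u'n^{v'}}$ for all $n\in\mathbb N$; in particular $C_\omega$ is integrable.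
   Context: For $0<\alpha<1$ the LSV map $f_\alpha:[0,1]\to[0,1]$ is $f_\alpha(x)=x(1+2^\alpha x^\alpha)$ for $x\in[0,\frac12]$ and $f_\alpha(x)=2x-1$ for $x\in(\frac12,1]$. For $\omega\in\Omega=[\alpha_0,\alpha_1]^{\mathbb Z}$ let $\alpha(\omega)$ be the zeroth coordinate of $\omega$, $f_\omega:=f_{\alpha(\omega)}$, and $f_\omega^n=f_{\sigma^{n-1}\omega}\circ\cdots\circ f_{\sigma\omega}\circ f_\omega$. Functions $\varphi\in L^2(\mu)$ are functions on $[0,1]\times\Omega$ and $\varphi_\omega=\varphi(\cdot,\omega)$. Define $x_1(\omega)=\frac12$ and $x_n(\omega)=\left(f_\omega|_{(0,1/2]}\right)^{-1}x_{n-1}(\sigma\omega)$ for $n\ge2$. For $i=0,1$ let $\underline\alpha_i\in\Omega$ be the constant sequence with all coordinates $\alpha_i$, and put $c_k(\alpha_i)=x_k(\underline\alpha_i)\,k^{1/\alpha_i}$. For fixed $\ell$, set $A_1\equiv0$ and for $2\le k\le\ell$ $$A_k(\omega)=\alpha_02^{\alpha_0}\left[\frac{2c_k(\alpha_0)}{k^{1/\alpha_0}}\right]^{\alpha(\sigma^{\ell-k}\omega)-\alpha_0}-\frac{1+\alpha_0}{2}\alpha_02^{\alpha_0}\left[\frac{2c_k(\alpha_1)}{k^{1/\alpha_1}}\right]^{2\alpha(\sigma^{\ell-k}\omega)-\alpha_0}.$$ $E_\nu$ denotes expectation with respect to $P=\nu^{\mathbb Z}$; since $P$ is $\sigma$-invariant,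 $E_\nu A_k$ does not depend on $\ell$. *)

theory Defs
  imports "HOL-Probability.Probability"
begin

definition lsv :: "real \<Rightarrow> real \<Rightarrow> real" where
  "lsv a x = (if x \<le> 1/2 then x * (1 + 2 powr a * x powr a) else 2 * x - 1)"

text \<open>\<open>shift m\<close> is the \<open>m\<close>-th power, for any integer \<open>m\<close>, of the left shift \<open>shift 1\<close>.\<close>

definition shift :: "int \<Rightarrow> (int \<Rightarrow> 'a) \<Rightarrow> (int \<Rightarrow> 'a)" where
  "shift m \<omega> = (\<lambda>i. \<omega> (i + m))"

definition rlsv :: "(int \<Rightarrow> real) \<Rightarrow> real \<Rightarrow> real" where
  "rlsv \<omega> = lsv (\<omega> 0)"

primrec rlsv_iter :: "nat \<Rightarrow> (int \<Rightarrow> real) \<Rightarrow> real \<Rightarrow> real" where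
  "rlsv_iter 0 \<omega> = id"
| "rlsv_iter (Suc n) \<omega> = rlsv (shift (int n) \<omega>) \<circ> rlsv_iter n \<omega>"

text \<open>The sequence of preimages starts at index 1. The value at 0 is never used; it is set to 1
  because \<open>rlsv \<omega> (1/2) = 1\<close>.\<close>

fun lsv_x :: "nat \<Rightarrow> (int \<Rightarrow> real) \<Rightarrow> real" where
  "lsv_x 0 \<omega> = 1"
| "lsv_x (Suc 0) \<omega> = 1/2"
| "lsv_x (Suc (Suc n)) \<omega> = the_inv_into {0<..1/2} (rlsv \<omega>) (lsv_x (Suc n) (shift 1 \<omega>))"

definition lsv_c :: "nat \<Rightarrow> real \<Rightarrow> real" where
  "lsv_c k a = lsv_x k (\<lambda>_. a) * real k powr (1 / a)"

text \<open>\<open>lsv_A \<alpha>\<^sub>0 \<alpha>\<^sub>1 l k\<close> is the random variable \<open>A\<^sub>k\<close> for a fixed \<open>l\<close>; it is meaningful for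
  \<open>1 \<le> k \<le> l\<close>.\<close>

definition lsv_A :: "real \<Rightarrow> real \<Rightarrow> nat \<Rightarrow> nat \<Rightarrow> (int \<Rightarrow> real) \<Rightarrow> real" where
  "lsv_A \<alpha>\<^sub>0 \<alpha>\<^sub>1 l k \<omega> =
     (if k \<le> 1 then 0
      else let a = shift (int l - int k) \<omega> 0 in
        \<alpha>\<^sub>0 * 2 powr \<alpha>\<^sub>0 * (2 * lsv_c k \<alpha>\<^sub>0 / real k powr (1 / \<alpha>\<^sub>0)) powr (a - \<alpha>\<^sub>0)
        - (1 + \<alpha>\<^sub>0) / 2 * \<alpha>\<^sub>0 * 2 powr \<alpha>\<^sub>0
            * (2 * lsv_c k \<alpha>\<^sub>1 / real k powr (1 / \<alpha>\<^sub>1)) powr (2 * a - \<alpha>\<^sub>0))"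

abbreviation unit_borel :: "real measure" where
  "unit_borel \<equiv> restrict_space borel {0..1}"

abbreviation unit_lebesgue :: "real measure" where
  "unit_lebesgue \<equiv> restrict_space lborel {0..1}"

text \<open>The measure \<open>\<integral> \<mu>\<^sub>\<omega> dP\<close> on \<open>[0,1] \<times> \<Omega>\<close>, i.e. \<open>B \<mapsto> \<integral> \<mu>\<^sub>\<omega> {x. (x, \<omega>) \<in> B} dP\<close>.\<close>

definition fibre_measure ::
  "'w measure \<Rightarrow> ('w \<Rightarrow> real measure) \<Rightarrow> (real \<times> 'w) measure" where
  "fibre_measure P \<mu> =
     P \<bind> (\<lambda>\<omega>. distr (\<mu> \<omega>) (unit_borel \<Otimes>\<^sub>M P) (\<lambda>x. (x, \<omega>)))"

text \<open>Elements of \<open>L\<^sup>2\<close> and \<open>L\<^sup>\<infinity>\<close> are given by (Borel) measurable representatives.\<close>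

definition L2_fun :: "'a measure \<Rightarrow> ('a \<Rightarrow> real) set" where
  "L2_fun M = {f \<in> borel_measurable M. integrable M (\<lambda>x. (f x)\<^sup>2)}"

definition Linf_fun :: "'a measure \<Rightarrow> ('a \<Rightarrow> real) set" where
  "Linf_fun M = {f \<in> borel_measurable M. \<exists>B. AE x in M. \<bar>f x\<bar> \<le> B}"

definition holder_on :: "real \<Rightarrow> real set \<Rightarrow> (real \<Rightarrow> real) \<Rightarrow> bool" where
  "holder_on \<eta> S f \<longleftrightarrow> (\<exists>H. \<forall>x\<in>S. \<forall>y\<in>S. \<bar>f x - f y\<bar> \<le> H * \<bar>x - y\<bar> powr \<eta>)"

end

theory Submission
  imports Defs "HOL-Real_Asymp.Real_Asymp"
begin

text \<open>
  The transfer operator of an LSV map is the sum of a left branch \<open>L0\<close> and a right branch \<open>L1\<close>, and both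
  preserve the cone of decreasing densities \<open>f\<close> for which \<open>x\<^sup>2 f x\<close> is increasing. After the right branch a
  constant proportional to the mass can be subtracted without leaving the cone. Two densities of equal mass can
  therefore be coupled: in a block of \<open>T + 1\<close> steps the uncoupled mass shrinks by a fixed factor, unless
  the mass that sits below \<open>x\<^sub>T\<close>, and so may avoid the right branch, dominates. The density \<open>hinv\<close> of
  \<open>\<mu>\<^sub>\<omega>\<close> is the pullback limit of the iterates of 1. Choosing \<open>T = n\<^sup>v\<close> with small \<open>1 - v\<close>, the decay rate is the
  mass of \<open>hinv\<close> below \<open>x\<^sub>T\<close>, up to the number of blocks.

  The points \<open>x\<^sub>T\<close> are governed by the number of parameters close to \<open>\<alpha>\<^sub>0\<close> along the orbit: if a positive
  proportion is at most \<open>s\<close>, then \<open>x\<^sub>T\<close> is of order \<open>T\<close> to the power \<open>- 1 / s\<close>. The assumption on the averages of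
  \<open>E A\<^sub>k\<close> forces \<open>\<alpha>\<^sub>0\<close> into the support of \<open>\<nu>\<close>, and Hoeffding's inequality then bounds the probability of
  a small proportion by a stretched exponential.

  Mixing is reduced to bounded \<open>\<phi>\<close> and to products \<open>\<psi>\<close> of an indicator in \<open>\<omega>\<close> and a Lipschitz function in \<open>x\<close>;
  there the loss of memory in the fibres leaves a correlation of the Bernoulli shift.
\<close>

section \<open>Branches and transfer operators\<close>

definition U :: "real measure" where "U = restrict_space lborel {0<..1}"

lemma space_U [simp]: "space U = {0<..1}" by (simp add: U_def space_restrict_space)

lemma prob_space_U: "prob_space U"
  by (rule prob_spaceI) (simp add: U_def emeasure_restrict_space space_restrict_space)

interpretation U: prob_space U by (rule prob_space_U)

lemma sets_U: "sets U = sets (restrict_space borel {0<..1})"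
  by (simp add: U_def sets_restrict_space)

lemma nn_integral_U: "(\<integral>\<^sup>+x. f x \<partial>U) = (\<integral>\<^sup>+x. f x * indicator {0<..1} x \<partial>lborel)"
  unfolding U_def by (subst nn_integral_restrict_space) auto

lemma borel_measurable_U_ennreal:
  "(f::real\<Rightarrow>ennreal) \<in> borel_measurable U \<longleftrightarrow> (\<lambda>x. f x * indicator {0<..1} x) \<in> borel_measurable borel"
  unfolding U_def by (subst borel_measurable_restrict_space_iff_ennreal) auto

definition gl :: "real \<Rightarrow> real \<Rightarrow> real" where
  "gl a = the_inv_into {0<..1/2} (lsv a)"

definition dlsv :: "real \<Rightarrow> real \<Rightarrow> real" where
  "dlsv a y = 1 + (1 + a) * (2 * y) powr a"

lemma lsv_left: "0 \<le> y \<Longrightarrow> y \<le> 1/2 \<Longrightarrow> lsv a y = y * (1 + (2 * y) powr a)"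
  by (simp add: lsv_def powr_mult)

lemma lsv_right: "y > 1/2 \<Longrightarrow> lsv a y = 2 * y - 1"
  by (simp add: lsv_def)

lemma dlsv_ge1: "0 < a \<Longrightarrow> dlsv a y \<ge> 1"
  by (simp add: dlsv_def)

lemma dlsv_mono: "0 < a \<Longrightarrow> 0 \<le> y \<Longrightarrow> y \<le> z \<Longrightarrow> dlsv a y \<le> dlsv a z"
  by (simp add: dlsv_def mult_left_mono powr_mono2)

lemma lsv_left_strict_mono:
  assumes "0 < a" "0 \<le> y" "y < z" "z \<le> 1/2"
  shows "lsv a y < lsv a z"
proof -
  have "(2 * y) powr a \<le> (2 * z) powr a" using assms by (intro powr_mono2) auto
  then have "y * (1 + (2 * y) powr a) < z * (1 + (2 * z) powr a)"
    using assms by (intro mult_less_le_imp_less) (auto simp: add_pos_nonneg)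
  then show ?thesis using assms by (simp add: lsv_left)
qed

lemma bij_lsv_left:
  assumes "0 < a"
  shows "bij_betw (lsv a) {0<..1/2} {0<..1}"
proof (rule bij_betw_imageI)
  show "inj_on (lsv a) {0<..1/2}"
  proof (rule inj_onI)
    fix x y assume "x \<in> {0<..1/2::real}" "y \<in> {0<..1/2::real}" "lsv a x = lsv a y"
    then show "x = y"
      using lsv_left_strict_mono[OF assms, of x y] lsv_left_strict_mono[OF assms, of y x]
      by (cases x y rule: linorder_cases) auto
  qed
  have cont: "continuous_on {0..1/2} (\<lambda>y::real. y * (1 + (2 * y) powr a))"
    using assms by (intro continuous_intros continuous_on_powr') auto
  show "lsv a ` {0<..1/2} = {0<..1}"
  proof (intro equalityI subsetI)
    fix x assume "x \<in> lsv a ` {0<..1/2}"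
    then obtain y where y: "0 < y" "y \<le> 1/2" "x = lsv a y" by auto
    have "lsv a y \<le> 1"
    proof -
      have "(2 * y) powr a \<le> 1" using y assms by (intro powr_le1) auto
      then have "y * (1 + (2 * y) powr a) \<le> (1/2) * 2" using y by (intro mult_mono) auto
      then show ?thesis using y by (simp add: lsv_left)
    qed
    then show "x \<in> {0<..1}" using y by (auto simp: lsv_left add_pos_nonneg)
  next
    fix x :: real assume x: "x \<in> {0<..1}"
    have "\<exists>y\<ge>0. y \<le> 1/2 \<and> y * (1 + (2 * y) powr a) = x"
      by (rule IVT') (use x cont in auto)
    then obtain y where y: "y \<ge> 0" "y \<le> 1/2" "y * (1 + (2 * y) powr a) = x" by auto
    with x have "y > 0" by (cases "y = 0") auto
    with y show "x \<in> lsv a ` {0<..1/2}" by (intro image_eqI[of _ _ y]) (auto simp: lsv_left)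
  qed
qed

lemma gl_props:
  assumes "0 < a" "0 < x" "x \<le> 1"
  shows gl_pos: "0 < gl a x" and "gl a x \<le> 1/2" and lsv_gl: "lsv a (gl a x) = x"
proof -
  have "x \<in> lsv a ` {0<..1/2}" using bij_lsv_left[OF assms(1)] assms by (simp add: bij_betw_def)
  then have "gl a x \<in> {0<..1/2}" unfolding gl_def
    using bij_lsv_left[OF assms(1)] by (intro the_inv_into_into[where A="{0<..1/2}"]) (auto simp: bij_betw_def)
  then show "0 < gl a x" "gl a x \<le> 1/2" by auto
  show "lsv a (gl a x) = x" unfolding gl_def
    using bij_lsv_left[OF assms(1)] assms by (intro f_the_inv_into_f_bij_betw) auto
qed

lemma gl_lsv: "0 < a \<Longrightarrow> 0 < y \<Longrightarrow> y \<le> 1/2 \<Longrightarrow> gl a (lsv a y) = y"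
  unfolding gl_def using bij_lsv_left[of a] by (intro the_inv_into_f_f) (auto simp: bij_betw_def)

lemma lsv_left_le_iff:
  assumes "0 < a" "0 \<le> y" "y \<le> 1/2" "0 \<le> z" "z \<le> 1/2"
  shows "lsv a y \<le> lsv a z \<longleftrightarrow> y \<le> z"
  using lsv_left_strict_mono[of a y z] lsv_left_strict_mono[of a z y] assms
  by (cases y z rule: linorder_cases) auto

lemma gl_mono:
  assumes "0 < a" "0 < x" "x \<le> y" "y \<le> 1"
  shows "gl a x \<le> gl a y"
  using lsv_left_le_iff[of a "gl a x" "gl a y"] gl_props[of a x] gl_props[of a y] assms by auto

lemma gl_le_iff:
  assumes "0 < a" "0 < x" "x \<le> 1"
  shows "gl a x \<le> t \<longleftrightarrow> t \<ge> 1/2 \<or> (0 < t \<and> x \<le> t * (1 + (2 * t) powr a))"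
  using lsv_left_le_iff[of a "gl a x" t] gl_props[of a x] assms
  by (cases "t \<ge> 1/2"; cases "0 < t") (auto simp: lsv_left[symmetric])

lemma gl_eq:
  assumes "0 < a" "0 < x" "x \<le> 1"
  shows "gl a x * (1 + (2 * gl a x) powr a) = x"
  using gl_props[OF assms] by (simp add: lsv_left)

lemma lsv_maps: "0 < a \<Longrightarrow> 0 < x \<Longrightarrow> x \<le> 1 \<Longrightarrow> 0 < lsv a x \<and> lsv a x \<le> 1"
  using bij_betwE[OF bij_lsv_left[of a], rule_format, of x] by (cases "x \<le> 1/2") (simp_all add: lsv_right)

definition L0 :: "real \<Rightarrow> (real \<Rightarrow> real) \<Rightarrow> real \<Rightarrow> real" where
  "L0 a f x = f (gl a x) / dlsv a (gl a x)"

definition L1 :: "(real \<Rightarrow> real) \<Rightarrow> real \<Rightarrow> real" where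
  "L1 f x = f ((x + 1) / 2) / 2"

definition Lop :: "real \<Rightarrow> (real \<Rightarrow> real) \<Rightarrow> real \<Rightarrow> real" where
  "Lop a f x = L0 a f x + L1 f x"

lemma gl_measurable_joint:
  assumes [measurable]: "f \<in> borel_measurable M" "g \<in> borel_measurable M"
    and "\<And>w. w \<in> space M \<Longrightarrow> 0 < f w \<and> 0 < g w \<and> g w \<le> 1"
  shows "(\<lambda>w. gl (f w) (g w)) \<in> borel_measurable M"
proof (rule borel_measurableI_le)
  fix t
  have "{w \<in> space M. gl (f w) (g w) \<le> t} =
    {w \<in> space M. t \<ge> 1/2 \<or> (0 < t \<and> g w \<le> t * (1 + (2 * t) powr (f w)))}"
    using assms(3) by (intro Collect_cong conj_cong refl gl_le_iff) auto
  also have "\<dots> \<in> sets M" by measurable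
  finally show "{w \<in> space M. gl (f w) (g w) \<le> t} \<in> sets M" .
qed

lemma measurable_to_U:
  assumes "g \<in> borel_measurable M" "\<And>w. w \<in> space M \<Longrightarrow> 0 < g w \<and> g w \<le> 1"
  shows "g \<in> M \<rightarrow>\<^sub>M U"
  using assms unfolding U_def by (intro measurable_restrict_space2) auto

lemma id_U: "(\<lambda>x. x) \<in> borel_measurable U"
  unfolding U_def by (intro measurable_restrict_space1) auto

lemma gl_U: "0 < a \<Longrightarrow> gl a \<in> U \<rightarrow>\<^sub>M U"
proof (rule measurable_to_U)
  assume a: "0 < a"
  show "gl a \<in> borel_measurable U"
    using gl_measurable_joint[of "\<lambda>_. a" U "\<lambda>x. x"] a id_U by auto
qed (use gl_props[of a] in force)

lemma measurable_U1: "f \<in> borel_measurable borel \<Longrightarrow> f \<in> borel_measurable U"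
  unfolding U_def by (intro measurable_restrict_space1) auto

lemma half_U [measurable]: "(\<lambda>x. (x + 1) / 2) \<in> U \<rightarrow>\<^sub>M U"
  by (rule measurable_to_U) (auto intro!: measurable_U1)

lemma lsv_U: "0 < a \<Longrightarrow> lsv a \<in> U \<rightarrow>\<^sub>M U"
  by (rule measurable_to_U) (use lsv_maps[of a] in \<open>auto simp: lsv_def[abs_def] intro!: measurable_U1\<close>)

lemma dlsv_measurable [measurable]: "dlsv a \<in> borel_measurable borel"
  unfolding dlsv_def[abs_def] by measurable

lemma L0_measurable:
  assumes "0 < a" and [measurable]: "f \<in> borel_measurable U"
  shows "L0 a f \<in> borel_measurable U"
proof -
  note [measurable] = gl_U[OF assms(1)]
  have [measurable]: "gl a \<in> borel_measurable U"
    using measurable_compose[OF gl_U[OF assms(1)] id_U] .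
  show ?thesis unfolding L0_def[abs_def] by measurable
qed

lemma L1_measurable [measurable]:
  assumes [measurable]: "f \<in> borel_measurable U" shows "L1 f \<in> borel_measurable U"
  unfolding L1_def[abs_def] by measurable

lemma Lop_measurable:
  assumes [measurable]: "0 < a" "f \<in> borel_measurable U" shows "Lop a f \<in> borel_measurable U"
  using L0_measurable[OF assms] unfolding Lop_def[abs_def] by measurable

lemma has_derivative_left:
  assumes a: "0 < a" and x: "0 \<le> x"
  shows "((\<lambda>y. y * (1 + (2 * \<bar>y\<bar>) powr a)) has_real_derivative dlsv a x) (at x)"
proof (cases "x = 0")
  case True
  have "((\<lambda>h::real. 1 + (2 * \<bar>h\<bar>) powr a) \<longlongrightarrow> 1 + (2 * \<bar>0\<bar>) powr a) (at 0)"
    using a by (intro tendsto_intros) (auto simp: eventually_at_filter)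
  moreover have "((\<lambda>h. (h * (1 + (2 * \<bar>h\<bar>) powr a) - 0) / h) \<longlongrightarrow> 1) (at 0) \<longleftrightarrow>
      ((\<lambda>h::real. 1 + (2 * \<bar>h\<bar>) powr a) \<longlongrightarrow> 1) (at 0)"
    by (rule tendsto_cong) (auto simp: eventually_at_filter)
  ultimately have "((\<lambda>h. (h * (1 + (2 * \<bar>h\<bar>) powr a) - 0) / h) \<longlongrightarrow> 1) (at 0)"
    by simp
  then show ?thesis using True a by (simp add: DERIV_def dlsv_def)
next
  case False
  with x have x: "x > 0" by simp
  have "((\<lambda>y. y * (1 + (2 * y) powr a)) has_real_derivative dlsv a x) (at x)"
    using x a by (auto intro!: derivative_eq_intros simp: dlsv_def powr_diff field_simps)
  then show ?thesis
    by (rule DERIV_cong_ev[THEN iffD1, rotated -1])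
       (use eventually_nhds_in_open[of "{0<..}" x] x in \<open>auto elim!: eventually_mono\<close>)
qed

lemma nn_integral_L0:
  fixes \<phi> :: "real \<Rightarrow> ennreal" and u :: "real \<Rightarrow> real"
  assumes a: "0 < a" and [measurable]: "\<phi> \<in> borel_measurable U" "u \<in> borel_measurable U"
  shows "(\<integral>\<^sup>+x. \<phi> x * ennreal (L0 a u x) \<partial>U) = (\<integral>\<^sup>+x. \<phi> (lsv a x) * ennreal (u x) * indicator {..1/2} x \<partial>U)"
proof -
  let ?F = "\<lambda>y. y * (1 + (2 * \<bar>y\<bar>) powr a)"
  define k where "k x = \<phi> x * ennreal (L0 a u x) * indicator {0<..1} x" for x
  note [measurable] = L0_measurable[OF a assms(3)]
  have k: "k \<in> borel_measurable borel"
    unfolding k_def[abs_def]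
    by (subst borel_measurable_U_ennreal[symmetric]) measurable
  have F: "?F 0 = 0" "?F (1/2) = 1" by simp_all
  have "(\<integral>\<^sup>+x. k x * indicator {?F 0..?F (1/2)} x \<partial>lborel) = (\<integral>\<^sup>+y. k (?F y) * ennreal (dlsv a y) * indicator {0..1/2} y \<partial>lborel)"
  proof (rule nn_integral_substitution_aux[OF k])
    show "continuous_on {0..1/2} (dlsv a)" unfolding dlsv_def[abs_def]
      using a by (intro continuous_intros continuous_on_powr') auto
    show "0 \<le> dlsv a x" for x using dlsv_ge1[OF a, of x] by simp
    show "(?F has_real_derivative dlsv a x) (at x)" if "x \<in> {0..1/2}" for x
      using has_derivative_left[OF a, of x] that by simp
  qed simp_all
  also have "(\<integral>\<^sup>+x. k x * indicator {?F 0..?F (1/2)} x \<partial>lborel) = (\<integral>\<^sup>+x. \<phi> x * ennreal (L0 a u x) \<partial>U)"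
    unfolding nn_integral_U k_def F by (intro nn_integral_cong) (auto simp: indicator_def)
  also have "(\<integral>\<^sup>+y. k (?F y) * ennreal (dlsv a y) * indicator {0..1/2} y \<partial>lborel) =
      (\<integral>\<^sup>+x. \<phi> (lsv a x) * ennreal (u x) * indicator {..1/2} x \<partial>U)"
    unfolding nn_integral_U
  proof (intro nn_integral_cong)
    fix y :: real
    show "k (?F y) * ennreal (dlsv a y) * indicator {0..1/2} y = \<phi> (lsv a y) * ennreal (u y) * indicator {..1/2} y * indicator {0<..1} y"
    proof (cases "0 < y \<and> y \<le> 1/2")
      case True
      then have F: "?F y = lsv a y" by (simp add: lsv_left)
      have d: "0 < dlsv a y" using dlsv_ge1[OF a, of y] by simp
      have "ennreal (L0 a u (lsv a y)) * ennreal (dlsv a y) = ennreal (u y)"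
        using True a d by (simp add: L0_def gl_lsv ennreal_mult''[symmetric])
      then show ?thesis unfolding F k_def using True lsv_maps[of a y] a
        by (auto simp: indicator_def mult.assoc)
    next
      case False
      then show ?thesis by (auto simp: indicator_def k_def)
    qed
  qed
  finally show ?thesis .
qed

lemma nn_integral_L1:
  fixes \<phi> :: "real \<Rightarrow> ennreal" and u :: "real \<Rightarrow> real"
  assumes a: "0 < a" and [measurable]: "\<phi> \<in> borel_measurable U" "u \<in> borel_measurable U"
  shows "(\<integral>\<^sup>+x. \<phi> x * ennreal (L1 u x) \<partial>U) = (\<integral>\<^sup>+x. \<phi> (lsv a x) * ennreal (u x) * indicator {1/2<..} x \<partial>U)"
proof -
  define k where "k x = \<phi> (lsv a x) * ennreal (u x) * indicator {1/2<..} x * indicator {0<..1} x" for x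
  note [measurable] = lsv_U[OF a]
  have [measurable]: "(\<lambda>x. indicator {1/2<..} x :: ennreal) \<in> borel_measurable U" by (rule measurable_U1) simp
  have k: "k \<in> borel_measurable borel"
    unfolding k_def[abs_def]
    by (subst borel_measurable_U_ennreal[symmetric]) measurable
  have "(\<integral>\<^sup>+x. k x \<partial>lborel) = ennreal \<bar>1/2\<bar> * (\<integral>\<^sup>+x. k (1/2 + 1/2 * x) \<partial>lborel)"
    by (rule nn_integral_real_affine) (use k in auto)
  also have "\<dots> = (\<integral>\<^sup>+x. ennreal (1/2) * k (1/2 + 1/2 * x) \<partial>lborel)"
    using k by (subst nn_integral_cmult) auto
  also have "\<dots> = (\<integral>\<^sup>+x. \<phi> x * ennreal (L1 u x) \<partial>U)"
    unfolding nn_integral_U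
  proof (intro nn_integral_cong)
    fix x :: real
    have e: "1/2 + 1/2 * x = (x + 1) / 2" by simp
    show "ennreal (1/2) * k (1/2 + 1/2 * x) = \<phi> x * ennreal (L1 u x) * indicator {0<..1} x"
    proof (cases "0 < x \<and> x \<le> 1")
      case True
      have "2 * ((x + 1) / 2) - 1 = x" by (simp add: field_simps)
      with True have "lsv a ((x+1)/2) = x" by (subst lsv_right) auto
      moreover have "ennreal (u ((x+1)/2) / 2) = ennreal (1/2) * ennreal (u ((x+1)/2))"
        by (subst ennreal_mult'[symmetric]) (simp_all del: ennreal_half)
      ultimately show ?thesis unfolding e k_def L1_def using True
        by (simp add: indicator_def mult_ac)
    next
      case False
      then show ?thesis by (auto simp: indicator_def k_def)
    qed
  qed
  finally show ?thesis unfolding nn_integral_U k_def by simp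
qed

lemma distr_Lop:
  assumes a: "0 < a" and u[measurable]: "u \<in> borel_measurable U" and nn: "\<And>x. 0 < x \<Longrightarrow> x \<le> 1 \<Longrightarrow> 0 \<le> u x"
  shows "distr (density U (\<lambda>x. ennreal (u x))) U (lsv a) = density U (\<lambda>x. ennreal (Lop a u x))"
proof (rule measure_eqI)
  note [measurable] = lsv_U[OF a] L0_measurable[OF a] Lop_measurable[OF a]
  fix A assume "A \<in> sets (distr (density U (\<lambda>x. ennreal (u x))) U (lsv a))"
  then have A[measurable]: "A \<in> sets U" by simp
  have ind: "(\<lambda>x. indicator A (lsv a x) :: ennreal) \<in> borel_measurable U"
    using measurable_compose[OF lsv_U[OF a] borel_measurable_indicator[OF A]] .
  have hU: "(\<lambda>x. indicator {..1/2} x :: ennreal) \<in> borel_measurable U" "(\<lambda>x. indicator {1/2<..} x :: ennreal) \<in> borel_measurable U"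
    unfolding U_def by (auto intro!: measurable_restrict_space1)
  have m0: "(\<lambda>x. ennreal (L0 a u x)) \<in> borel_measurable U" and m1: "(\<lambda>x. ennreal (L1 u x)) \<in> borel_measurable U"
    using L0_measurable[OF a u] L1_measurable[OF u] by auto
  have "emeasure (distr (density U (\<lambda>x. ennreal (u x))) U (lsv a)) A =
    emeasure (density U (\<lambda>x. ennreal (u x))) (lsv a -` A \<inter> space U)"
    by (subst emeasure_distr) auto
  also have "\<dots> = (\<integral>\<^sup>+x. ennreal (u x) * indicator (lsv a -` A \<inter> space U) x \<partial>U)"
    by (rule emeasure_density) (use measurable_sets[OF lsv_U[OF a] A] in auto)
  also have "\<dots> = (\<integral>\<^sup>+x. indicator A (lsv a x) * ennreal (u x) * indicator {..1/2} x + indicator A (lsv a x) * ennreal (u x) * indicator {1/2<..} x \<partial>U)"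
    by (intro nn_integral_cong) (auto simp: indicator_def)
  also have "\<dots> = (\<integral>\<^sup>+x. indicator A x * ennreal (L0 a u x) \<partial>U) + (\<integral>\<^sup>+x. indicator A x * ennreal (L1 u x) \<partial>U)"
    unfolding nn_integral_L0[OF a borel_measurable_indicator[OF A] u] nn_integral_L1[OF a borel_measurable_indicator[OF A] u]
    by (rule nn_integral_add) (intro borel_measurable_times_ennreal ind measurable_compose[OF u measurable_ennreal] hU)+
  also have "\<dots> = (\<integral>\<^sup>+x. ennreal (Lop a u x) * indicator A x \<partial>U)"
  proof (subst nn_integral_add[symmetric]; (intro nn_integral_cong borel_measurable_times_ennreal m0 m1 borel_measurable_indicator A)?)
    fix x assume "x \<in> space U"
    then have "0 < x" "x \<le> 1" by auto
    then have "0 \<le> L0 a u x" "0 \<le> L1 u x"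
      using a gl_props[of a x] dlsv_ge1[OF a, of "gl a x"] by (auto simp: L0_def L1_def intro!: divide_nonneg_nonneg nn)
    then show "indicator A x * ennreal (L0 a u x) + indicator A x * ennreal (L1 u x) = ennreal (Lop a u x) * indicator A x"
      by (auto simp: Lop_def indicator_def)
  qed
  also have "\<dots> = emeasure (density U (\<lambda>x. ennreal (Lop a u x))) A"
    by (rule emeasure_density[symmetric]) auto
  finally show "emeasure (distr (density U (\<lambda>x. ennreal (u x))) U (lsv a)) A = emeasure (density U (\<lambda>x. ennreal (Lop a u x))) A" .
qed simp

section \<open>The cone\<close>

definition mass :: "(real \<Rightarrow> real) \<Rightarrow> real" where "mass f = (\<integral>x. f x \<partial>U)"

definition lmass :: "real \<Rightarrow> (real \<Rightarrow> real) \<Rightarrow> real" where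
  "lmass y f = (\<integral>x. f x * indicator {..y} x \<partial>U)"

definition lcone :: "(real \<Rightarrow> real) \<Rightarrow> bool" where
  "lcone f \<longleftrightarrow> integrable U f \<and> (\<forall>x. 0 < x \<longrightarrow> x \<le> 1 \<longrightarrow> 0 \<le> f x) \<and>
     (\<forall>x y. 0 < x \<longrightarrow> x \<le> y \<longrightarrow> y \<le> 1 \<longrightarrow> f y \<le> f x \<and> x\<^sup>2 * f x \<le> y\<^sup>2 * f y)"

lemma lcone_integrable: "lcone f \<Longrightarrow> integrable U f"
  and lcone_measurable: "lcone f \<Longrightarrow> f \<in> borel_measurable U"
  and lcone_nonneg: "lcone f \<Longrightarrow> 0 < x \<Longrightarrow> x \<le> 1 \<Longrightarrow> 0 \<le> f x"
  and lcone_antimono: "lcone f \<Longrightarrow> 0 < x \<Longrightarrow> x \<le> y \<Longrightarrow> y \<le> 1 \<Longrightarrow> f y \<le> f x"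
  and lcone_sq_mono: "lcone f \<Longrightarrow> 0 < x \<Longrightarrow> x \<le> y \<Longrightarrow> y \<le> 1 \<Longrightarrow> x\<^sup>2 * f x \<le> y\<^sup>2 * f y"
  by (auto simp: lcone_def)

lemma lconeI:
  assumes "integrable U f" "\<And>x. 0 < x \<Longrightarrow> x \<le> 1 \<Longrightarrow> 0 \<le> f x"
    "\<And>x y. 0 < x \<Longrightarrow> x \<le> y \<Longrightarrow> y \<le> 1 \<Longrightarrow> f y \<le> f x"
    "\<And>x y. 0 < x \<Longrightarrow> x \<le> y \<Longrightarrow> y \<le> 1 \<Longrightarrow> x\<^sup>2 * f x \<le> y\<^sup>2 * f y"
  shows "lcone f"
  using assms by (simp add: lcone_def)

lemma lcone_add: "lcone f \<Longrightarrow> lcone g \<Longrightarrow> lcone (\<lambda>x. f x + g x)"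
  unfolding lcone_def by (auto simp: distrib_left intro: add_mono)

lemma lcone_scale:
  assumes "lcone f" "0 \<le> c" shows "lcone (\<lambda>x. c * f x)"
proof (rule lconeI)
  fix x y :: real assume xy: "0 < x" "x \<le> y" "y \<le> 1"
  have "c * (x\<^sup>2 * f x) \<le> c * (y\<^sup>2 * f y)" using lcone_sq_mono[OF assms(1) xy] assms(2) by (rule mult_left_mono)
  then show "x\<^sup>2 * (c * f x) \<le> y\<^sup>2 * (c * f y)" by (simp add: mult_ac)
  show "c * f y \<le> c * f x" using lcone_antimono[OF assms(1) xy] assms(2) by (rule mult_left_mono)
next
  show "0 \<le> c * f x" if "0 < x" "x \<le> 1" for x
    using lcone_nonneg[OF assms(1) that] assms(2) by simp
qed (use lcone_integrable[OF assms(1)] in simp)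

lemma lcone_const: "0 \<le> c \<Longrightarrow> lcone (\<lambda>_. c)"
  by (rule lconeI) (auto intro!: mult_right_mono power_mono)

lemma mass_add: "lcone f \<Longrightarrow> lcone g \<Longrightarrow> mass (\<lambda>x. f x + g x) = mass f + mass g"
  unfolding mass_def by (intro Bochner_Integration.integral_add lcone_integrable)

lemma mass_scale: "mass (\<lambda>x. c * f x) = c * mass f"
  unfolding mass_def by simp

lemma measure_U_space [simp]: "measure U {0<..1} = 1"
  using U.prob_space by simp

lemma mass_const: "mass (\<lambda>_. c) = c"
  unfolding mass_def by (simp add: U.prob_space)

lemma mass_diff_const: "lcone f \<Longrightarrow> mass (\<lambda>x. f x - c) = mass f - c"
  unfolding mass_def by (simp add: lcone_integrable U.prob_space)

lemma mass_mono:
  assumes "integrable U f" "integrable U g" "\<And>x. 0 < x \<Longrightarrow> x \<le> 1 \<Longrightarrow> f x \<le> g x"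
  shows "mass f \<le> mass g"
  unfolding mass_def by (intro integral_mono assms) auto

lemma mass_nonneg: "lcone f \<Longrightarrow> 0 \<le> mass f"
  unfolding mass_def by (rule Bochner_Integration.integral_nonneg) (auto simp: lcone_nonneg)

lemma indicator_U [measurable]: "A \<in> sets borel \<Longrightarrow> (indicator A :: real \<Rightarrow> 'a::{zero_neq_one,topological_space}) \<in> borel_measurable U"
  by (rule measurable_U1) simp

lemma sets_U_borel: "A \<in> sets borel \<Longrightarrow> A \<inter> {0<..1} \<in> sets U"
  unfolding sets_U by (auto simp: sets_restrict_space)

lemma integrable_lmass:
  fixes f :: "real \<Rightarrow> real"
  assumes "integrable U f" shows "integrable U (\<lambda>x. f x * indicator {..y} x)"
proof (rule Bochner_Integration.integrable_bound[OF assms])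
  have [measurable]: "f \<in> borel_measurable U" using assms by simp
  show "(\<lambda>x. f x * indicator {..y} x) \<in> borel_measurable U" by measurable
qed (auto simp: indicator_def)

lemma lmass_add: "lcone f \<Longrightarrow> lcone g \<Longrightarrow> lmass y (\<lambda>x. f x + g x) = lmass y f + lmass y g"
  unfolding lmass_def by (simp add: distrib_right integrable_lmass lcone_integrable)

lemma lmass_scale: "lmass y (\<lambda>x. c * f x) = c * lmass y f"
  unfolding lmass_def by (simp add: mult.assoc)

lemma lmass_mono:
  assumes "integrable U f" "integrable U g" "\<And>x. 0 < x \<Longrightarrow> x \<le> 1 \<Longrightarrow> f x \<le> g x"
  shows "lmass y f \<le> lmass y g"
  unfolding lmass_def using assms by (intro integral_mono integrable_lmass) (auto simp: indicator_def)

lemma lmass_mono2: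
  assumes "lcone f" "y \<le> z"
  shows "lmass y f \<le> lmass z f"
  unfolding lmass_def using assms by (intro integral_mono integrable_lmass lcone_integrable) (auto simp: indicator_def lcone_nonneg)

lemma lmass_1: "lmass 1 f = mass f"
  unfolding lmass_def mass_def by (intro Bochner_Integration.integral_cong) auto

lemma lmass_le_mass: "lcone f \<Longrightarrow> y \<le> 1 \<Longrightarrow> lmass y f \<le> mass f"
  using lmass_mono2[of f y 1] by (simp add: lmass_1)

lemma measure_U_Iic: "0 \<le> y \<Longrightarrow> y \<le> 1 \<Longrightarrow> (\<integral>x. indicator {..y} x \<partial>U) = y"
proof -
  assume y: "0 \<le> y" "y \<le> 1"
  have "(\<integral>x. indicator {..y} x \<partial>U) = (\<integral>x. indicator ({..y} \<inter> {0<..1}) x \<partial>U)"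
    by (intro Bochner_Integration.integral_cong) (auto simp: indicator_def)
  also have "\<dots> = measure U ({..y} \<inter> {0<..1})"
    using sets_U_borel[of "{..y}"] by simp
  also have "{..y} \<inter> {0<..1} = {0<..y}" using y by auto
  also have "measure U {0<..y} = y"
    unfolding U_def using y by (subst measure_restrict_space) auto
  finally show ?thesis .
qed

lemma lcone_le_mass:
  assumes f: "lcone f" and x: "0 < x" "x \<le> 1"
  shows "f x \<le> mass f / x"
proof -
  have "f x * x = (\<integral>z. f x * indicator {..x} z \<partial>U)"
    using measure_U_Iic[of x] x by simp
  also have "\<dots> \<le> lmass x f"
    unfolding lmass_def
  proof (rule integral_mono)
    show "integrable U (\<lambda>z. f x * indicator {..x} z)"
      by (rule integrable_lmass) simp
    show "integrable U (\<lambda>z. f z * indicator {..x} z)"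
      by (rule integrable_lmass[OF lcone_integrable[OF f]])
    show "f x * indicator {..x} z \<le> f z * indicator {..x} z" if "z \<in> space U" for z
      using lcone_antimono[OF f, of z x] that x by (auto simp: indicator_def)
  qed
  also have "\<dots> \<le> mass f" using lmass_le_mass[OF f x(2)] .
  finally show ?thesis using x by (simp add: field_simps)
qed

lemma L0_nonneg: "lcone f \<Longrightarrow> 0 < a \<Longrightarrow> 0 < x \<Longrightarrow> x \<le> 1 \<Longrightarrow> 0 \<le> L0 a f x"
  unfolding L0_def using gl_props[of a x] dlsv_ge1[of a "gl a x"] lcone_nonneg[of f "gl a x"]
  by (intro divide_nonneg_nonneg) auto

lemma L1_nonneg: "lcone f \<Longrightarrow> 0 < x \<Longrightarrow> x \<le> 1 \<Longrightarrow> 0 \<le> L1 f x"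
  using lcone_nonneg[of f "(x+1)/2"] by (simp add: L1_def)

lemma nn_integral_lcone_finite:
  assumes f: "lcone f" and le: "\<And>x. F x \<le> ennreal (f x)"
  shows "(\<integral>\<^sup>+x. F x \<partial>U) < \<infinity>"
proof -
  have "(\<integral>\<^sup>+x. F x \<partial>U) \<le> (\<integral>\<^sup>+x. ennreal (f x) \<partial>U)" by (intro nn_integral_mono le)
  also have "\<dots> < \<infinity>" using lcone_integrable[OF f] lcone_nonneg[OF f]
    by (subst nn_integral_eq_integral) auto
  finally show ?thesis .
qed

lemma integrable_L0:
  assumes f: "lcone f" and a: "0 < a"
  shows "integrable U (L0 a f)"
proof (rule integrableI_nonneg)
  note [measurable] = lcone_measurable[OF f]
  show "L0 a f \<in> borel_measurable U" using L0_measurable[OF a] by simp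
  show "AE x in U. 0 \<le> L0 a f x" using L0_nonneg[OF f a] by auto
  have "(\<integral>\<^sup>+x. 1 * ennreal (L0 a f x) \<partial>U) = (\<integral>\<^sup>+x. 1 * ennreal (f x) * indicator {..1/2} x \<partial>U)"
    by (rule nn_integral_L0) (use a in auto)
  also have "\<dots> < \<infinity>" by (rule nn_integral_lcone_finite[OF f]) (auto simp: indicator_def)
  finally show "(\<integral>\<^sup>+x. ennreal (L0 a f x) \<partial>U) < \<infinity>" by simp
qed

lemma integrable_L1:
  assumes f: "lcone f"
  shows "integrable U (L1 f)"
proof (rule integrableI_nonneg)
  note [measurable] = lcone_measurable[OF f]
  show "L1 f \<in> borel_measurable U" by simp
  show "AE x in U. 0 \<le> L1 f x" using L1_nonneg[OF f] by auto
  have "(\<integral>\<^sup>+x. 1 * ennreal (L1 f x) \<partial>U) = (\<integral>\<^sup>+x. 1 * ennreal (f x) * indicator {1/2<..} x \<partial>U)"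
    by (rule nn_integral_L1[of 1]) auto
  also have "\<dots> < \<infinity>" by (rule nn_integral_lcone_finite[OF f]) (auto simp: indicator_def)
  finally show "(\<integral>\<^sup>+x. ennreal (L1 f x) \<partial>U) < \<infinity>" by simp
qed

lemma lcone_L0:
  assumes f: "lcone f" and a: "0 < a" "a < 1"
  shows "lcone (L0 a f)"
proof (rule lconeI)
  show "integrable U (L0 a f)" by (rule integrable_L0[OF f a(1)])
  fix x y :: real assume xy: "0 < x" "x \<le> y" "y \<le> 1"
  define s where "s = gl a x"
  define t where "t = gl a y"
  have st: "0 < s" "s \<le> t" "t \<le> 1/2" using gl_props[of a x] gl_props[of a y] gl_mono[of a x y] xy a by (auto simp: s_def t_def)
  have d: "1 \<le> dlsv a s" "dlsv a s \<le> dlsv a t" using dlsv_ge1 dlsv_mono st a by auto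
  show "L0 a f y \<le> L0 a f x"
    unfolding L0_def s_def[symmetric] t_def[symmetric]
    using d st by (intro frac_le lcone_nonneg[OF f] lcone_antimono[OF f]) auto
  define p where "p = (2 * s) powr a"
  define q where "q = (2 * t) powr a"
  have pq: "0 \<le> p" "p \<le> q" using st a by (auto simp: p_def q_def intro!: powr_mono2)
  have x: "x = s * (1 + p)" and y: "y = t * (1 + q)"
    using gl_eq[of a x] gl_eq[of a y] xy a by (auto simp: s_def t_def p_def q_def)
  have dp: "dlsv a s = 1 + (1 + a) * p" "dlsv a t = 1 + (1 + a) * q" by (auto simp: dlsv_def p_def q_def)
  have key: "(1 + p)\<^sup>2 / (1 + (1 + a) * p) \<le> (1 + q)\<^sup>2 / (1 + (1 + a) * q)"
  proof -
    have "(1 + q)\<^sup>2 * (1 + (1 + a) * p) - (1 + p)\<^sup>2 * (1 + (1 + a) * q) = (q - p) * ((1 - a) + (p + q) + (1 + a) * p * q)"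
      by (simp add: power2_eq_square algebra_simps)
    also have "\<dots> \<ge> 0" using pq a by (intro mult_nonneg_nonneg add_nonneg_nonneg) auto
    finally have "(1 + p)\<^sup>2 * (1 + (1 + a) * q) \<le> (1 + q)\<^sup>2 * (1 + (1 + a) * p)" by simp
    moreover have "0 < 1 + (1 + a) * p" "0 < 1 + (1 + a) * q" using pq a by (auto intro!: add_pos_nonneg)
    ultimately show ?thesis by (simp only: pos_divide_le_eq pos_le_divide_eq times_divide_eq_left)
  qed
  have x2: "x\<^sup>2 = s\<^sup>2 * (1 + p)\<^sup>2" by (subst x) (rule power_mult_distrib)
  have y2: "y\<^sup>2 = t\<^sup>2 * (1 + q)\<^sup>2" by (subst y) (rule power_mult_distrib)
  have nn: "0 \<le> t\<^sup>2 * f t" "0 \<le> (1 + p)\<^sup>2 / (1 + (1 + a) * p)"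
    using lcone_nonneg[OF f, of t] st pq a by (auto intro!: divide_nonneg_nonneg add_nonneg_nonneg)
  have "x\<^sup>2 * L0 a f x = (s\<^sup>2 * f s) * ((1 + p)\<^sup>2 / (1 + (1 + a) * p))"
    unfolding L0_def s_def[symmetric] dp x2 by simp
  also have "\<dots> \<le> (t\<^sup>2 * f t) * ((1 + q)\<^sup>2 / (1 + (1 + a) * q))"
    by (rule mult_mono[OF lcone_sq_mono[OF f] key nn]) (use st in auto)
  also have "\<dots> = y\<^sup>2 * L0 a f y"
    unfolding L0_def t_def[symmetric] dp y2 by simp
  finally show "x\<^sup>2 * L0 a f x \<le> y\<^sup>2 * L0 a f y" .
qed (rule L0_nonneg[OF f a(1)])

text \<open>The weight \<open>(x + 1)\<^sup>2\<close> in place of \<open>x\<^sup>2\<close> is the slack that lets a constant be subtracted from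
  \<^term>\<open>L1 f\<close> without leaving the cone.\<close>

lemma L1_sq_mono:
  assumes f: "lcone f" and xy: "0 < x" "x \<le> y" "y \<le> 1"
  shows "(x + 1)\<^sup>2 * L1 f x \<le> (y + 1)\<^sup>2 * L1 f y"
proof -
  have "2 * (((x+1)/2)\<^sup>2 * f ((x+1)/2)) \<le> 2 * (((y+1)/2)\<^sup>2 * f ((y+1)/2))"
    using xy by (intro mult_left_mono lcone_sq_mono[OF f]) auto
  moreover have "2 * (((z+1)/2)\<^sup>2 * f ((z+1)/2)) = (z + 1)\<^sup>2 * L1 f z" for z
    by (simp only: L1_def power_divide) simp
  ultimately show ?thesis by (simp only:)
qed

lemma L1_antimono: "lcone f \<Longrightarrow> 0 < x \<Longrightarrow> x \<le> y \<Longrightarrow> y \<le> 1 \<Longrightarrow> L1 f y \<le> L1 f x"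
  using lcone_antimono[of f "(x+1)/2" "(y+1)/2"] by (simp add: L1_def)

lemma lcone_L1_diff:
  assumes f: "lcone f" and c: "0 \<le> c" "c \<le> f 1 / 4"
  shows "lcone (\<lambda>x. L1 f x - c)"
proof (rule lconeI)
  show "integrable U (\<lambda>x. L1 f x - c)" using integrable_L1[OF f] by simp
  have ge: "2 * c \<le> L1 f x" if "0 < x" "x \<le> 1" for x
    using L1_antimono[OF f, of x 1] that c by (simp add: L1_def)
  show "0 \<le> L1 f x - c" if "0 < x" "x \<le> 1" for x using ge[OF that] c by simp
  fix x y :: real assume xy: "0 < x" "x \<le> y" "y \<le> 1"
  show "L1 f y - c \<le> L1 f x - c" using L1_antimono[OF f xy] by simp
  have xx: "x * x \<le> 1" using xy by (intro mult_le_one) auto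
  have "0 \<le> (y - x) * (1 + 2 * x - x * x)" using xy xx by (intro mult_nonneg_nonneg) auto
  moreover have "0 \<le> x * (2 - 2 * (x * x))" using xy xx by (intro mult_nonneg_nonneg) auto
  ultimately have "0 \<le> (y - x) * ((y - x) * (1 + 2 * x - x * x) + x * (2 - 2 * (x * x)))"
    using xy by (intro mult_nonneg_nonneg) auto
  then have key: "2 * x\<^sup>2 * (y + 1)\<^sup>2 \<le> (y\<^sup>2 + x\<^sup>2) * (x + 1)\<^sup>2"
    by (simp add: power2_eq_square algebra_simps)
  define G where "G = L1 f y"
  define F where "F = L1 f x"
  have G: "2 * c \<le> G" using ge[of y] xy by (simp add: G_def)
  have F: "F * (x + 1)\<^sup>2 \<le> G * (y + 1)\<^sup>2" using L1_sq_mono[OF f xy] by (simp add: F_def G_def mult.commute)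
  have pos: "0 < (x + 1)\<^sup>2" using xy by simp
  have "x\<^sup>2 * (F - c) * (x + 1)\<^sup>2 \<le> y\<^sup>2 * (G - c) * (x + 1)\<^sup>2"
  proof -
    have "x\<^sup>2 * (F * (x + 1)\<^sup>2) \<le> x\<^sup>2 * (G * (y + 1)\<^sup>2)" by (rule mult_left_mono[OF F]) simp
    moreover have "G * (2 * x\<^sup>2 * (y + 1)\<^sup>2) \<le> G * ((y\<^sup>2 + x\<^sup>2) * (x + 1)\<^sup>2)"
      using key G c by (intro mult_left_mono) auto
    moreover have "0 \<le> (G - 2 * c) * ((y\<^sup>2 - x\<^sup>2) * (x + 1)\<^sup>2)"
      using G xy by (intro mult_nonneg_nonneg) (auto intro: power_mono)
    ultimately show ?thesis by (simp add: algebra_simps)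
  qed
  then show "x\<^sup>2 * (L1 f x - c) \<le> y\<^sup>2 * (L1 f y - c)"
    using pos unfolding F_def G_def by (simp only: mult_le_cancel_right)
qed

lemma lcone_L1: "lcone f \<Longrightarrow> lcone (L1 f)"
  using lcone_L1_diff[of f 0] lcone_nonneg[of f 1] by simp

lemma lcone_Lop: "lcone f \<Longrightarrow> 0 < a \<Longrightarrow> a < 1 \<Longrightarrow> lcone (Lop a f)"
  unfolding Lop_def[abs_def] by (intro lcone_add lcone_L0 lcone_L1)

lemma integral_indicator_eq_nn:
  fixes f :: "real \<Rightarrow> real"
  assumes [measurable]: "f \<in> borel_measurable U" "A \<in> sets borel" and "\<And>x. 0 < x \<Longrightarrow> x \<le> 1 \<Longrightarrow> 0 \<le> f x"
  shows "(\<integral>x. f x * indicator A x \<partial>U) = enn2real (\<integral>\<^sup>+x. ennreal (f x * indicator A x) \<partial>U)"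
proof (rule integral_eq_nn_integral)
  show "(\<lambda>x. f x * indicator A x) \<in> borel_measurable U" by measurable
qed (use assms(3) in \<open>auto simp: indicator_def\<close>)

lemma lmass_L0:
  assumes f: "lcone f" and a: "0 < a" "a < 1" and y: "0 < y" "y \<le> 1"
  shows "lmass y (L0 a f) = lmass (gl a y) f"
proof -
  note [measurable] = lcone_measurable[OF f] L0_measurable[OF a(1) lcone_measurable[OF f]]
  have "lmass y (L0 a f) = enn2real (\<integral>\<^sup>+x. ennreal (L0 a f x * indicator {..y} x) \<partial>U)"
    unfolding lmass_def by (rule integral_indicator_eq_nn) (use L0_nonneg[OF f a(1)] in auto)
  also have "(\<integral>\<^sup>+x. ennreal (L0 a f x * indicator {..y} x) \<partial>U) = (\<integral>\<^sup>+x. indicator {..y} x * ennreal (L0 a f x) \<partial>U)"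
    by (intro nn_integral_cong) (auto simp: indicator_def)
  also have "\<dots> = (\<integral>\<^sup>+x. indicator {..y} (lsv a x) * ennreal (f x) * indicator {..1/2} x \<partial>U)"
    by (rule nn_integral_L0) (use a in auto)
  also have "\<dots> = (\<integral>\<^sup>+x. ennreal (f x * indicator {..gl a y} x) \<partial>U)"
  proof (intro nn_integral_cong)
    fix x assume "x \<in> space U"
    then have x: "0 < x" "x \<le> 1" by auto
    have "lsv a x \<le> y \<longleftrightarrow> x \<le> gl a y" if "x \<le> 1/2"
      using lsv_left_le_iff[of a x "gl a y"] gl_props[of a y] that x y a by auto
    moreover have "gl a y \<le> 1/2" using gl_props[of a y] y a by auto
    ultimately show "indicator {..y} (lsv a x) * ennreal (f x) * indicator {..1/2} x = ennreal (f x * indicator {..gl a y} x)"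
      by (auto simp: indicator_def)
  qed
  also have "enn2real \<dots> = lmass (gl a y) f"
    unfolding lmass_def by (rule integral_indicator_eq_nn[symmetric]) (use lcone_nonneg[OF f] in auto)
  finally show ?thesis .
qed

lemma mass_L1:
  assumes f: "lcone f"
  shows "mass (L1 f) = mass f - lmass (1/2) f"
proof -
  note [measurable] = lcone_measurable[OF f]
  have int: "integrable U (\<lambda>x. f x * indicator {1/2<..} x)"
  proof (rule Bochner_Integration.integrable_bound[OF lcone_integrable[OF f]])
    show "(\<lambda>x. f x * indicator {1/2<..} x) \<in> borel_measurable U" by measurable
  qed (auto simp: indicator_def)
  have "mass (L1 f) = enn2real (\<integral>\<^sup>+x. 1 * ennreal (L1 f x) \<partial>U)"
    unfolding mass_def mult_1 by (intro integral_eq_nn_integral) (use L1_nonneg[OF f] in auto)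
  also have "(\<integral>\<^sup>+x. 1 * ennreal (L1 f x) \<partial>U) = (\<integral>\<^sup>+x. 1 * ennreal (f x) * indicator {1/2<..} x \<partial>U)"
    by (rule nn_integral_L1[of 1]) auto
  also have "\<dots> = (\<integral>\<^sup>+x. ennreal (f x * indicator {1/2<..} x) \<partial>U)"
    by (intro nn_integral_cong) (auto simp: indicator_def)
  also have "enn2real \<dots> = (\<integral>x. f x * indicator {1/2<..} x \<partial>U)"
    by (rule integral_indicator_eq_nn[symmetric]) (use lcone_nonneg[OF f] in auto)
  also have "\<dots> + lmass (1/2) f = (\<integral>x. f x * indicator {1/2<..} x + f x * indicator {..1/2} x \<partial>U)"
    unfolding lmass_def by (rule Bochner_Integration.integral_add[symmetric]) (use int integrable_lmass lcone_integrable[OF f] in auto)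
  also have "\<dots> = mass f" unfolding mass_def by (intro Bochner_Integration.integral_cong) (auto simp: indicator_def)
  finally show ?thesis by simp
qed

lemma gl_1: "0 < a \<Longrightarrow> gl a 1 = 1/2"
  using gl_lsv[of a "1/2"] by (simp add: lsv_left)

lemma mass_L0: "lcone f \<Longrightarrow> 0 < a \<Longrightarrow> a < 1 \<Longrightarrow> mass (L0 a f) = lmass (1/2) f"
  using lmass_L0[of f a 1] by (simp add: lmass_1 gl_1)

lemma mass_L0_L1: "lcone f \<Longrightarrow> 0 < a \<Longrightarrow> a < 1 \<Longrightarrow> mass (L0 a f) + mass (L1 f) = mass f"
  by (simp add: mass_L0 mass_L1)

lemma mass_Lop: "lcone f \<Longrightarrow> 0 < a \<Longrightarrow> a < 1 \<Longrightarrow> mass (Lop a f) = mass f"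
  unfolding Lop_def[abs_def] by (simp add: mass_add lcone_L0 lcone_L1 mass_L0_L1)

lemma L1_le_mass: "lcone f \<Longrightarrow> 0 < x \<Longrightarrow> x \<le> 1 \<Longrightarrow> L1 f x \<le> mass f"
proof -
  assume f: "lcone f" and x: "0 < x" "x \<le> 1"
  have "f ((x+1)/2) \<le> mass f / ((x+1)/2)" using x by (intro lcone_le_mass[OF f]) auto
  also have "\<dots> \<le> mass f / (1/2)" using x mass_nonneg[OF f] by (intro divide_left_mono) auto
  finally show ?thesis unfolding L1_def by simp
qed

lemma L1_ge_mass:
  assumes f: "lcone f" and x: "0 < x" "x \<le> 1"
  shows "mass (L1 f) / 4 \<le> L1 f x"
proof -
  have "mass (L1 f) \<le> mass (\<lambda>_. 4 * L1 f x)"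
  proof (rule mass_mono)
    fix z :: real assume z: "0 < z" "z \<le> 1"
    have "L1 f z * 1 \<le> L1 f z * (z + 1)\<^sup>2"
      using z by (intro mult_left_mono L1_nonneg[OF f]) (auto intro: one_le_power)
    also have "\<dots> \<le> 4 * L1 f 1"
      using L1_sq_mono[OF f, of z 1] z by (simp add: mult.commute)
    also have "\<dots> \<le> 4 * L1 f x" using L1_antimono[OF f, of x 1] x by simp
    finally show "L1 f z \<le> 4 * L1 f x" by simp
  qed (use integrable_L1[OF f] in auto)
  then show ?thesis by (simp add: mass_const)
qed

lemma lmass_Lop_le:
  assumes f: "lcone f" and a: "0 < a" "a < 1" and y: "0 < y" "y \<le> 1"
  shows "lmass y (Lop a f) \<le> lmass (gl a y) f + y * mass f"
proof -
  have "lmass y (Lop a f) = lmass (gl a y) f + lmass y (L1 f)"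
    unfolding Lop_def[abs_def] using f a y by (simp add: lmass_add lcone_L0 lcone_L1 lmass_L0)
  also have "lmass y (L1 f) \<le> lmass y (\<lambda>_. mass f)"
    by (intro lmass_mono) (use L1_le_mass[OF f] integrable_L1[OF f] in auto)
  also have "lmass y (\<lambda>_. mass f) = y * mass f"
    unfolding lmass_def using measure_U_Iic[of y] y by simp
  finally show ?thesis by simp
qed

section \<open>Coupling along an orbit\<close>

definition adm :: "real \<Rightarrow> (int \<Rightarrow> real) \<Rightarrow> bool" where
  "adm \<beta> \<omega> \<longleftrightarrow> 0 < \<beta> \<and> \<beta> < 1 \<and> (\<forall>i. 0 < \<omega> i \<and> \<omega> i \<le> \<beta>)"

lemma adm_shift [simp]: "adm \<beta> \<omega> \<Longrightarrow> adm \<beta> (shift m \<omega>)"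
  by (simp add: adm_def shift_def)

lemma admD: "adm \<beta> \<omega> \<Longrightarrow> 0 < \<omega> i" "adm \<beta> \<omega> \<Longrightarrow> \<omega> i < 1" "adm \<beta> \<omega> \<Longrightarrow> \<omega> i \<le> \<beta>"
  "adm \<beta> \<omega> \<Longrightarrow> 0 < \<beta>" "adm \<beta> \<omega> \<Longrightarrow> \<beta> < 1"
  by (auto simp: adm_def intro: le_less_trans)

lemma shift_shift [simp]: "shift m (shift n \<omega>) = shift (m + n) \<omega>"
  by (simp add: shift_def fun_eq_iff add.assoc)

lemma shift_0 [simp]: "shift 0 \<omega> = \<omega>" by (simp add: shift_def)

primrec Lit :: "nat \<Rightarrow> (int \<Rightarrow> real) \<Rightarrow> (real \<Rightarrow> real) \<Rightarrow> real \<Rightarrow> real" where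
  "Lit 0 \<omega> f = f"
| "Lit (Suc n) \<omega> f = Lop (\<omega> (int n)) (Lit n \<omega> f)"

lemma Lit_add: "Lit (m + n) \<omega> f = Lit n (shift (int m) \<omega>) (Lit m \<omega> f)"
  by (induction n) (simp_all add: shift_def add.commute)

lemma Lit_Suc_left: "Lit (Suc n) \<omega> f = Lit n (shift 1 \<omega>) (Lop (\<omega> 0) f)"
  using Lit_add[of 1 n \<omega> f] by simp

lemma lcone_Lit: "adm \<beta> \<omega> \<Longrightarrow> lcone f \<Longrightarrow> lcone (Lit n \<omega> f)"
  by (induction n) (auto intro: lcone_Lop admD)

lemma mass_Lit: "adm \<beta> \<omega> \<Longrightarrow> lcone f \<Longrightarrow> mass (Lit n \<omega> f) = mass f"
  by (induction n) (auto simp: mass_Lop lcone_Lit admD)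

lemma Lop_lin: "Lop a (\<lambda>x. c * f x + d * g x) = (\<lambda>x. c * Lop a f x + d * Lop a g x)"
  by (simp add: Lop_def L0_def L1_def fun_eq_iff add_divide_distrib algebra_simps)

lemma Lit_lin: "Lit n \<omega> (\<lambda>x. c * f x + d * g x) = (\<lambda>x. c * Lit n \<omega> f x + d * Lit n \<omega> g x)"
  by (induction n) (simp_all add: Lop_lin)

lemma Lit_plus: "Lit n \<omega> (\<lambda>x. f x + g x) = (\<lambda>x. Lit n \<omega> f x + Lit n \<omega> g x)"
  using Lit_lin[of n \<omega> 1 f 1 g] by simp

lemma Lit_scale: "Lit n \<omega> (\<lambda>x. c * f x) = (\<lambda>x. c * Lit n \<omega> f x)"
  using Lit_lin[of n \<omega> c f 0 f] by simp

lemma Lit_minus: "Lit n \<omega> (\<lambda>x. f x - g x) = (\<lambda>x. Lit n \<omega> f x - Lit n \<omega> g x)"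
  using Lit_lin[of n \<omega> 1 f "-1" g] by simp

lemma Lit_const: "Lit n \<omega> (\<lambda>_. c) x = c * Lit n \<omega> (\<lambda>_. 1) x"
  using Lit_scale[of n \<omega> c "\<lambda>_. 1"] by (simp add: fun_eq_iff)

lemma Lop_mono:
  assumes "0 < a" "\<And>x. 0 < x \<Longrightarrow> x \<le> 1 \<Longrightarrow> f x \<le> g x" "0 < x" "x \<le> 1"
  shows "Lop a f x \<le> Lop a g x"
  unfolding Lop_def L0_def L1_def
  using gl_props[of a x] dlsv_ge1[of a "gl a x"] assms
  by (intro add_mono divide_right_mono assms(2)) auto

lemma Lit_mono:
  assumes "adm \<beta> \<omega>" "\<And>x. 0 < x \<Longrightarrow> x \<le> 1 \<Longrightarrow> f x \<le> g x" "0 < x" "x \<le> 1"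
  shows "Lit n \<omega> f x \<le> Lit n \<omega> g x"
  using assms(3,4)
proof (induction n arbitrary: x)
  case (Suc n)
  then show ?case using Lop_mono[OF admD(1)[OF assms(1)]] by simp
qed (use assms in auto)

lemma Lit_cong:
  assumes "adm \<beta> \<omega>" "\<And>x. 0 < x \<Longrightarrow> x \<le> 1 \<Longrightarrow> f x = g x" "0 < x" "x \<le> 1"
  shows "Lit n \<omega> f x = Lit n \<omega> g x"
  using Lit_mono[OF assms(1) _ assms(3,4), of f g n] Lit_mono[OF assms(1) _ assms(3,4), of g f n] assms(2)
  by (intro antisym) auto

lemma Lit_abs_le:
  assumes "adm \<beta> \<omega>" "\<And>x. 0 < x \<Longrightarrow> x \<le> 1 \<Longrightarrow> \<bar>f x\<bar> \<le> g x" "0 < x" "x \<le> 1"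
  shows "\<bar>Lit n \<omega> f x\<bar> \<le> Lit n \<omega> g x"
proof -
  have "Lit n \<omega> f x \<le> Lit n \<omega> g x"
    by (rule Lit_mono[OF assms(1) _ assms(3,4)]) (use assms(2) in fastforce)
  moreover have "Lit n \<omega> (\<lambda>x. - 1 * f x) x \<le> Lit n \<omega> g x"
    by (rule Lit_mono[OF assms(1) _ assms(3,4)]) (use assms(2) in fastforce)
  ultimately show ?thesis unfolding Lit_scale by simp
qed

lemma Lit_nonneg:
  assumes "adm \<beta> \<omega>" "\<And>x. 0 < x \<Longrightarrow> x \<le> 1 \<Longrightarrow> 0 \<le> f x" "0 < x" "x \<le> 1"
  shows "0 \<le> Lit n \<omega> f x"
  using Lit_mono[OF assms(1) _ assms(3,4), of "\<lambda>_. 0" f n] assms(2) Lit_scale[of n \<omega> 0 f] by simp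

lemma Lit_measurable: "adm \<beta> \<omega> \<Longrightarrow> f \<in> borel_measurable U \<Longrightarrow> Lit n \<omega> f \<in> borel_measurable U"
  by (induction n) (auto intro: Lop_measurable admD)

text \<open>With the convention \<^term>\<open>lsv_x 0 \<omega> = 1\<close> the recursion holds from index 0 on.\<close>

lemma lsv_x_Suc: "adm \<beta> \<omega> \<Longrightarrow> lsv_x (Suc n) \<omega> = gl (\<omega> 0) (lsv_x n (shift 1 \<omega>))"
proof (cases n)
  case 0
  assume "adm \<beta> \<omega>"
  with 0 show ?thesis by (simp add: gl_1 admD)
qed (simp add: gl_def rlsv_def[abs_def])

lemma lsv_x_bounds: "adm \<beta> \<omega> \<Longrightarrow> 0 < lsv_x n \<omega> \<and> lsv_x n \<omega> \<le> 1"
proof (induction n arbitrary: \<omega>)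
  case (Suc n)
  then show ?case using gl_props[of "\<omega> 0" "lsv_x n (shift 1 \<omega>)"] admD(1)[OF Suc.prems, of 0] Suc.IH[of "shift 1 \<omega>"]
    by (auto simp: lsv_x_Suc)
qed simp

definition Acone :: "real \<Rightarrow> real" where "Acone \<beta> = 3 / (1 - \<beta>)"

definition kcone :: "real \<Rightarrow> (real \<Rightarrow> real) \<Rightarrow> bool" where
  "kcone \<beta> f \<longleftrightarrow> lcone f \<and> (\<forall>x. 0 < x \<longrightarrow> x \<le> 1 \<longrightarrow> f x \<le> Acone \<beta> * mass f * x powr (- \<beta>))"

lemma kcone_Lop:
  assumes f: "kcone \<beta> f" and a: "0 < a" "a \<le> \<beta>" "\<beta> < 1"
  shows "kcone \<beta> (Lop a f)"
proof -
  have lf: "lcone f" and K: "\<And>x. 0 < x \<Longrightarrow> x \<le> 1 \<Longrightarrow> f x \<le> Acone \<beta> * mass f * x powr (- \<beta>)"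
    using f by (auto simp: kcone_def)
  have m: "mass (Lop a f) = mass f" using mass_Lop[OF lf] a by simp
  have m0: "0 \<le> mass f" using mass_nonneg[OF lf] .
  have A: "0 < Acone \<beta>" using a by (simp add: Acone_def)
  have "Lop a f x \<le> Acone \<beta> * mass f * x powr (- \<beta>)" if x: "0 < x" "x \<le> 1" for x
  proof -
    define y where "y = gl a x"
    define t where "t = (2 * y) powr a"
    have y: "0 < y" "y \<le> 1/2" using gl_props[of a x] a x by (auto simp: y_def)
    have t: "0 < t" "t \<le> 1" using y a by (auto simp: t_def intro!: powr_le1)
    have xy: "x = y * (1 + t)" using gl_eq[of a x] a x by (simp add: y_def t_def)
    have d: "dlsv a y = 1 + (1 + a) * t" by (simp add: dlsv_def t_def)
    have d0: "0 < 1 + (1 + a) * t" using t a by (simp add: add_pos_nonneg)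
    have b1: "(1 + t) powr \<beta> \<le> 1 + \<beta> * t"
      using Youngs_inequality_0[of \<beta> "1-\<beta>" "1+t" 1] t a by (simp add: algebra_simps)
    have "x powr \<beta> \<le> (2 * y) powr \<beta>"
      using x xy y t a by (intro powr_mono2) (auto simp: algebra_simps mult_left_le)
    also have "\<dots> \<le> t" unfolding t_def using y a by (intro powr_mono') auto
    finally have b2: "x powr \<beta> \<le> t" .
    have key: "Acone \<beta> * ((1 + t) powr \<beta> / (1 + (1 + a) * t)) + x powr \<beta> \<le> Acone \<beta>"
    proof -
      have "(1 + (1 + a) * t) * t \<le> 3 * t" using t a
        by (intro mult_right_mono) (auto intro!: order_trans[OF mult_mono[of "1+a" 2 t 1]])
      also have "3 * t \<le> Acone \<beta> * ((1 + a - \<beta>) * t)"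
      proof -
        have "3 * t = Acone \<beta> * ((1 - \<beta>) * t)" using a by (simp add: Acone_def)
        also have "\<dots> \<le> Acone \<beta> * ((1 + a - \<beta>) * t)"
          using A t a by (intro mult_left_mono mult_right_mono) auto
        finally show ?thesis .
      qed
      finally have e: "(1 + (1 + a) * t) * t \<le> Acone \<beta> * ((1 + a - \<beta>) * t)" .
      have "Acone \<beta> * (1 + t) powr \<beta> + x powr \<beta> * (1 + (1 + a) * t) \<le> Acone \<beta> * (1 + \<beta> * t) + t * (1 + (1 + a) * t)"
        using b1 b2 A d0 by (intro add_mono mult_left_mono mult_right_mono) auto
      also have "\<dots> \<le> Acone \<beta> * (1 + (1 + a) * t)" using e by (simp add: algebra_simps)
      finally have f1: "Acone \<beta> * (1 + t) powr \<beta> + x powr \<beta> * (1 + (1 + a) * t) \<le> Acone \<beta> * (1 + (1 + a) * t)" .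
      have "Acone \<beta> * ((1 + t) powr \<beta> / (1 + (1 + a) * t)) + x powr \<beta>
          = (Acone \<beta> * (1 + t) powr \<beta> + x powr \<beta> * (1 + (1 + a) * t)) / (1 + (1 + a) * t)"
        using d0 by (simp add: add_divide_distrib)
      also have "\<dots> \<le> Acone \<beta>" using f1 d0 by (simp add: pos_divide_le_eq)
      finally show ?thesis .
    qed
    have "Lop a f x = f y / (1 + (1 + a) * t) + L1 f x"
      by (simp add: Lop_def L0_def y_def[symmetric] d)
    also have "\<dots> \<le> Acone \<beta> * mass f * y powr (- \<beta>) / (1 + (1 + a) * t) + mass f"
      using K[of y] y d0 L1_le_mass[OF lf x] by (intro add_mono divide_right_mono) auto
    also have "y powr (- \<beta>) = x powr (- \<beta>) * (1 + t) powr \<beta>"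
    proof -
      have "x powr \<beta> = y powr \<beta> * (1 + t) powr \<beta>" unfolding xy by (rule powr_mult)
      then show ?thesis using y t x by (simp add: powr_minus field_simps)
    qed
    also have "Acone \<beta> * mass f * (x powr (- \<beta>) * (1 + t) powr \<beta>) / (1 + (1 + a) * t) + mass f =
       mass f * x powr (- \<beta>) * (Acone \<beta> * ((1 + t) powr \<beta> / (1 + (1 + a) * t)) + x powr \<beta>)"
      using x by (simp add: distrib_left powr_minus mult_ac)
    also have "\<dots> \<le> mass f * x powr (- \<beta>) * Acone \<beta>"
      using m0 by (intro mult_left_mono key) auto
    finally show ?thesis by (simp add: mult_ac)
  qed
  then show ?thesis using lcone_Lop[OF lf] a m by (simp add: kcone_def)
qed

lemma kcone_lcone: "kcone \<beta> f \<Longrightarrow> lcone f" by (simp add: kcone_def)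

lemma kcone_Lit: "adm \<beta> \<omega> \<Longrightarrow> kcone \<beta> f \<Longrightarrow> kcone \<beta> (Lit n \<omega> f)"
  by (induction n) (auto intro: kcone_Lop admD)

lemma kcone_one: "0 < \<beta> \<Longrightarrow> \<beta> < 1 \<Longrightarrow> kcone \<beta> (\<lambda>_. 1)"
proof -
  assume b: "0 < \<beta>" "\<beta> < 1"
  have "1 \<le> Acone \<beta> * x powr (- \<beta>)" if "0 < x" "x \<le> 1" for x
  proof -
    have "1 * 1 \<le> Acone \<beta> * x powr (- \<beta>)"
      using b that powr_mono2'[of "-\<beta>" x 1] by (intro mult_mono) (auto simp: Acone_def field_simps)
    then show ?thesis by simp
  qed
  then show ?thesis by (simp add: kcone_def lcone_const mass_const)
qed

lemma powr_integral_U: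
  assumes b: "0 < \<beta>" "\<beta> < 1" and y: "0 < y" "y \<le> 1"
  shows "integrable U (\<lambda>x. x powr (-\<beta>) * indicator {..y} x)"
    and "(\<integral>x. x powr (-\<beta>) * indicator {..y} x \<partial>U) = y powr (1 - \<beta>) / (1 - \<beta>)"
proof -
  have "((\<lambda>x. x powr (-\<beta>)) has_integral (y powr (-\<beta>+1) / (-\<beta>+1))) {0..y}"
    by (rule has_integral_powr_from_0) (use b y in auto)
  then have "((\<lambda>x. if x \<in> {0..y} then x powr (-\<beta>) else 0) has_integral (y powr (1-\<beta>) / (1-\<beta>))) UNIV"
    by (subst has_integral_restrict_UNIV) simp
  then have "(\<integral>\<^sup>+x. ennreal (if x \<in> {0..y} then x powr (-\<beta>) else 0) \<partial>lborel) = y powr (1-\<beta>) / (1-\<beta>)"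
    by (intro nn_integral_has_integral_lborel) auto
  also have "(\<integral>\<^sup>+x. ennreal (if x \<in> {0..y} then x powr (-\<beta>) else 0) \<partial>lborel)
      = (\<integral>\<^sup>+x. ennreal (x powr (-\<beta>) * indicator {..y} x) \<partial>U)"
    unfolding nn_integral_U by (intro nn_integral_cong) (use y in \<open>auto simp: indicator_def\<close>)
  finally have nn: "(\<integral>\<^sup>+x. ennreal (x powr (-\<beta>) * indicator {..y} x) \<partial>U) = y powr (1-\<beta>) / (1-\<beta>)" .
  have m: "(\<lambda>x. x powr (-\<beta>) * indicator {..y} x) \<in> borel_measurable U" by (rule measurable_U1) measurable
  have r: "0 \<le> y powr (1-\<beta>) / (1-\<beta>)" using b by simp
  show "integrable U (\<lambda>x. x powr (-\<beta>) * indicator {..y} x)"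
    by (rule integrableI_nn_integral_finite[OF m _ nn]) (auto simp: r)
  show "(\<integral>x. x powr (-\<beta>) * indicator {..y} x \<partial>U) = y powr (1 - \<beta>) / (1 - \<beta>)"
    using r by (subst integral_eq_nn_integral[OF m]) (auto simp: nn)
qed

lemma powr_integrable_U: "0 < \<beta> \<Longrightarrow> \<beta> < 1 \<Longrightarrow> integrable U (\<lambda>x. x powr (-\<beta>))"
proof -
  assume b: "0 < \<beta>" "\<beta> < 1"
  have "integrable U (\<lambda>x. x powr (-\<beta>) * indicator {..1} x)" by (rule powr_integral_U) (use b in auto)
  then show ?thesis by (rule Bochner_Integration.integrable_cong[THEN iffD1, rotated -1]) auto
qed

lemma kcone_lmass:
  assumes f: "kcone \<beta> f" and b: "0 < \<beta>" "\<beta> < 1" and y: "0 < y" "y \<le> 1"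
  shows "lmass y f \<le> Acone \<beta> / (1 - \<beta>) * mass f * y powr (1 - \<beta>)"
proof -
  have "lmass y f \<le> (\<integral>x. Acone \<beta> * mass f * (x powr (-\<beta>) * indicator {..y} x) \<partial>U)"
    unfolding lmass_def
  proof (rule integral_mono)
    show "integrable U (\<lambda>x. f x * indicator {..y} x)" by (intro integrable_lmass lcone_integrable kcone_lcone[OF f])
    show "integrable U (\<lambda>x. Acone \<beta> * mass f * (x powr (-\<beta>) * indicator {..y} x))"
      using powr_integral_U(1)[OF b y] by simp
    show "f x * indicator {..y} x \<le> Acone \<beta> * mass f * (x powr (-\<beta>) * indicator {..y} x)" if "x \<in> space U" for x
      using that f by (auto simp: kcone_def indicator_def)
  qed
  also have "\<dots> = Acone \<beta> / (1 - \<beta>) * mass f * y powr (1 - \<beta>)"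
    using powr_integral_U(2)[OF b y] by simp
  finally show ?thesis .
qed

lemma lmass_small:
  assumes b: "0 < \<beta>" "\<beta> < 1" and "0 < e"
  obtains \<epsilon> where "0 < \<epsilon>" "\<epsilon> \<le> 1" "Acone \<beta> / (1 - \<beta>) * \<epsilon> powr (1 - \<beta>) \<le> e"
proof -
  define B where "B = Acone \<beta> / (1 - \<beta>)"
  have B: "0 < B" using b by (simp add: B_def Acone_def)
  define \<epsilon> where "\<epsilon> = min 1 ((e / B) powr (1 / (1 - \<beta>)))"
  have e0: "0 < \<epsilon>" using assms B by (simp add: \<epsilon>_def)
  have "\<epsilon> powr (1 - \<beta>) \<le> ((e / B) powr (1 / (1 - \<beta>))) powr (1 - \<beta>)"
    using b e0 by (intro powr_mono2) (auto simp: \<epsilon>_def)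
  also have "\<dots> = e / B" using b B assms by (simp add: powr_powr)
  finally have "B * \<epsilon> powr (1 - \<beta>) \<le> e" using B by (simp add: field_simps)
  then show ?thesis using that[of \<epsilon>] e0 by (simp add: B_def \<epsilon>_def)
qed

lemma Lit_one_lower_ex:
  assumes b: "0 < \<beta>" "\<beta> < 1"
  shows "\<exists>g>0. g \<le> 1 \<and> (\<forall>\<omega> n x. adm \<beta> \<omega> \<longrightarrow> 0 < x \<longrightarrow> x \<le> 1 \<longrightarrow> g \<le> Lit n \<omega> (\<lambda>_. 1) x)"
proof -
  obtain \<epsilon> where e: "0 < \<epsilon>" "\<epsilon> \<le> 1" "Acone \<beta> / (1 - \<beta>) * \<epsilon> powr (1 - \<beta>) \<le> 1/2"
    using lmass_small[OF b, of "1/2"] by auto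
  have "\<epsilon>\<^sup>2 / 2 \<le> Lit n \<omega> (\<lambda>_. 1) x" if \<omega>: "adm \<beta> \<omega>" and x: "0 < x" "x \<le> 1" for \<omega> n x
  proof -
    let ?f = "Lit n \<omega> (\<lambda>_. 1)"
    have k: "kcone \<beta> ?f" by (rule kcone_Lit[OF \<omega> kcone_one[OF b]])
    have l: "lcone ?f" by (rule kcone_lcone[OF k])
    have m: "mass ?f = 1" using mass_Lit[OF \<omega> lcone_const[of 1]] by (simp add: mass_const)
    have "mass ?f \<le> mass (\<lambda>z. ?f z * indicator {..\<epsilon>} z + ?f 1 / \<epsilon>\<^sup>2)"
    proof (rule mass_mono)
      show "integrable U (\<lambda>z. ?f z * indicator {..\<epsilon>} z + ?f 1 / \<epsilon>\<^sup>2)"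
        using integrable_lmass[OF lcone_integrable[OF l]] by simp
      fix z :: real assume z: "0 < z" "z \<le> 1"
      show "?f z \<le> ?f z * indicator {..\<epsilon>} z + ?f 1 / \<epsilon>\<^sup>2"
      proof (cases "z \<le> \<epsilon>")
        case True
        then show ?thesis using lcone_nonneg[OF l, of 1] by simp
      next
        case False
        have "\<epsilon>\<^sup>2 * ?f z \<le> z\<^sup>2 * ?f z"
          using False e z lcone_nonneg[OF l z] by (intro mult_right_mono power_mono) auto
        also have "\<dots> \<le> ?f 1" using lcone_sq_mono[OF l, of z 1] z by simp
        finally show ?thesis using False e by (simp add: field_simps)
      qed
    qed (rule lcone_integrable[OF l])
    also have "\<dots> = lmass \<epsilon> ?f + ?f 1 / \<epsilon>\<^sup>2"
      unfolding mass_def lmass_def using integrable_lmass[OF lcone_integrable[OF l]] by simp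
    also have "lmass \<epsilon> ?f \<le> 1/2"
      using order_trans[OF kcone_lmass[OF k b e(1,2)], of "1/2"] e(3) by (simp only: m mult_1_right)
    finally have "1 \<le> 1/2 + ?f 1 / \<epsilon>\<^sup>2" by (simp only: m)
    then have "1/2 \<le> ?f 1 / \<epsilon>\<^sup>2" by linarith
    then have "\<epsilon>\<^sup>2 / 2 \<le> ?f 1" using e by (simp add: field_simps)
    also have "\<dots> \<le> ?f x" using lcone_antimono[OF l, of x 1] x by simp
    finally show ?thesis .
  qed
  moreover have "\<epsilon>\<^sup>2 / 2 > 0" "\<epsilon>\<^sup>2 / 2 \<le> 1" using e power_le_one[of \<epsilon> 2] by auto
  ultimately show ?thesis by blast
qed

definition lowc :: "real \<Rightarrow> real" where
  "lowc \<beta> = (SOME g. 0 < g \<and> g \<le> 1 \<and> (\<forall>\<omega> n x. adm \<beta> \<omega> \<longrightarrow> 0 < x \<longrightarrow> x \<le> 1 \<longrightarrow> g \<le> Lit n \<omega> (\<lambda>_. 1) x))"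

lemma lowc:
  assumes b: "0 < \<beta>" "\<beta> < 1"
  shows lowc_pos: "0 < lowc \<beta>" and lowc_le1: "lowc \<beta> \<le> 1"
    and lowc_le: "\<And>\<omega> n x. adm \<beta> \<omega> \<Longrightarrow> 0 < x \<Longrightarrow> x \<le> 1 \<Longrightarrow> lowc \<beta> \<le> Lit n \<omega> (\<lambda>_. 1) x"
  using someI_ex[OF Lit_one_lower_ex[OF b]] unfolding lowc_def[symmetric] by blast+

lemma Lit_lower:
  assumes "adm \<beta> \<omega>" "lcone f" "0 < x" "x \<le> 1"
  shows "lowc \<beta> / 4 * (mass f - lmass (lsv_x T \<omega>) f) \<le> Lit T \<omega> f x"
  using assms
proof (induction T arbitrary: \<omega> f)
  case 0
  then show ?case by (simp add: lmass_1 lcone_nonneg)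
next
  case (Suc T)
  note \<omega> = Suc.prems(1) and f = Suc.prems(2) and x = Suc.prems(3,4)
  let ?w = "shift 1 \<omega>" and ?a = "\<omega> 0"
  have a: "0 < ?a" "?a < 1" using admD[OF \<omega>] by auto
  have w: "adm \<beta> ?w" using \<omega> by simp
  have xb: "0 < lsv_x T ?w" "lsv_x T ?w \<le> 1" using lsv_x_bounds[OF w] by auto
  have m1: "0 \<le> mass (L1 f) / 4" using mass_nonneg[OF lcone_L1[OF f]] by simp
  have "lowc \<beta> / 4 * (mass f - lmass (lsv_x (Suc T) \<omega>) f)
     = lowc \<beta> / 4 * (mass (L0 ?a f) - lmass (lsv_x T ?w) (L0 ?a f)) + mass (L1 f) / 4 * lowc \<beta>"
    unfolding mass_L0_L1[OF f a, symmetric] lmass_L0[OF f a xb] lsv_x_Suc[OF \<omega>] by (simp add: algebra_simps)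
  also have "\<dots> \<le> Lit T ?w (L0 ?a f) x + Lit T ?w (L1 f) x"
  proof (rule add_mono)
    show "lowc \<beta> / 4 * (mass (L0 ?a f) - lmass (lsv_x T ?w) (L0 ?a f)) \<le> Lit T ?w (L0 ?a f) x"
      by (rule Suc.IH[OF w lcone_L0[OF f a] x])
    have "mass (L1 f) / 4 * lowc \<beta> \<le> mass (L1 f) / 4 * Lit T ?w (\<lambda>_. 1) x"
      using m1 lowc_le[OF admD(4,5)[OF \<omega>] w x] by (rule mult_left_mono[rotated])
    also have "\<dots> = Lit T ?w (\<lambda>_. mass (L1 f) / 4) x" by (rule Lit_const[symmetric])
    also have "\<dots> \<le> Lit T ?w (L1 f) x" by (rule Lit_mono[OF w L1_ge_mass[OF f] x])
    finally show "mass (L1 f) / 4 * lowc \<beta> \<le> Lit T ?w (L1 f) x" .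
  qed
  also have "\<dots> = Lit (Suc T) \<omega> f x"
    unfolding Lit_Suc_left Lop_def[abs_def] Lit_plus ..
  finally show ?case .
qed

lemma loss_of_memory:
  assumes "adm \<beta> \<omega>" "lcone F" "lcone G" "mass F = mass G"
    and "\<And>i. i < I \<Longrightarrow> lmass (lsv_x T (shift (int (i * Suc T)) \<omega>)) (Lit (i * Suc T) \<omega> F) \<le> \<tau>"
    and "\<And>i. i < I \<Longrightarrow> lmass (lsv_x T (shift (int (i * Suc T)) \<omega>)) (Lit (i * Suc T) \<omega> G) \<le> \<tau>"
  shows "\<exists>F' G'. lcone F' \<and> lcone G' \<and> mass F' = mass G' \<and> mass F' \<le> max (2 * \<tau>) ((1 - lowc \<beta> / 32) ^ I * mass F) \<and>
     (\<forall>x. 0 < x \<longrightarrow> x \<le> 1 \<longrightarrow> Lit (I * Suc T) \<omega> F x - Lit (I * Suc T) \<omega> G x = F' x - G' x)"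
  using assms
proof (induction I arbitrary: \<omega> F G)
  case 0
  then show ?case by (intro exI[of _ F] exI[of _ G]) auto
next
  case (Suc I)
  note \<omega> = Suc.prems(1) and F = Suc.prems(2) and G = Suc.prems(3) and FG = Suc.prems(4)
  have b: "0 < \<beta>" "\<beta> < 1" using admD(4,5)[OF \<omega>] .
  note g = lowc_pos[OF b] lowc_le1[OF b]
  show ?case
  proof (cases "mass F \<le> 2 * \<tau>")
    case True
    then show ?thesis
      by (intro exI[of _ "Lit (Suc I * Suc T) \<omega> F"] exI[of _ "Lit (Suc I * Suc T) \<omega> G"])
         (use lcone_Lit[OF \<omega> F] lcone_Lit[OF \<omega> G] mass_Lit[OF \<omega> F] mass_Lit[OF \<omega> G] FG in \<open>simp del: Lit.simps mult_Suc\<close>)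
  next
    case False
    define m where "m = mass F"
    define c where "c = lowc \<beta> / 32 * m"
    let ?S = "Suc T"
    let ?w = "shift (int ?S) \<omega>"
    have w: "adm \<beta> ?w" using \<omega> by simp
    have m0: "0 \<le> m" using mass_nonneg[OF F] by (simp add: m_def)
    have c0: "0 \<le> c" using g m0 by (simp add: c_def)
    have peel: "lcone (\<lambda>x. Lit ?S \<omega> H x - c) \<and> mass (\<lambda>x. Lit ?S \<omega> H x - c) = (1 - lowc \<beta> / 32) * m"
      if H: "lcone H" "mass H = m" "lmass (lsv_x T \<omega>) H \<le> \<tau>" for H
    proof -
      let ?u = "Lit T \<omega> H"
      have a: "0 < \<omega> (int T)" "\<omega> (int T) < 1" using admD[OF \<omega>] by auto
      have u: "lcone ?u" by (rule lcone_Lit[OF \<omega> H(1)])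
      have "c = lowc \<beta> / 4 * (m / 2) / 4" by (simp add: c_def)
      also have "\<dots> \<le> lowc \<beta> / 4 * (m - lmass (lsv_x T \<omega>) H) / 4"
        using False H(3) g by (intro divide_right_mono mult_left_mono) (auto simp: m_def)
      also have "\<dots> \<le> ?u 1 / 4"
        using Lit_lower[OF \<omega> H(1), of 1 T] H(2) by (intro divide_right_mono) auto
      finally have "lcone (\<lambda>x. L1 ?u x - c)" by (intro lcone_L1_diff[OF u c0])
      then have "lcone (\<lambda>x. L0 (\<omega> (int T)) ?u x + (L1 ?u x - c))"
        by (intro lcone_add lcone_L0[OF u a])
      moreover have "(\<lambda>x. L0 (\<omega> (int T)) ?u x + (L1 ?u x - c)) = (\<lambda>x. Lit ?S \<omega> H x - c)"
        by (simp add: Lop_def fun_eq_iff)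
      moreover have "mass (\<lambda>x. Lit ?S \<omega> H x - c) = m - c"
        using mass_diff_const[OF lcone_Lit[OF \<omega> H(1)]] mass_Lit[OF \<omega> H(1)] H(2) by (simp del: Lit.simps)
      ultimately show ?thesis by (simp add: c_def algebra_simps)
    qed
    let ?F1 = "\<lambda>x. Lit ?S \<omega> F x - c" and ?G1 = "\<lambda>x. Lit ?S \<omega> G x - c"
    have F1: "lcone ?F1" "mass ?F1 = (1 - lowc \<beta> / 32) * m"
      using peel[OF F] Suc.prems(5)[of 0] by (auto simp: m_def)
    have G1: "lcone ?G1" "mass ?G1 = (1 - lowc \<beta> / 32) * m"
      using peel[OF G] Suc.prems(6)[of 0] FG by (auto simp: m_def)
    have mon: "lmass (lsv_x T (shift (int (i * ?S)) ?w)) (Lit (i * ?S) ?w (\<lambda>x. Lit ?S \<omega> H x - c)) \<le> \<tau>"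
      if H: "lcone H" and i: "lmass (lsv_x T (shift (int (Suc i * ?S)) \<omega>)) (Lit (Suc i * ?S) \<omega> H) \<le> \<tau>"
        and H1: "lcone (\<lambda>x. Lit ?S \<omega> H x - c)" for H i
    proof -
      have e: "Lit (Suc i * ?S) \<omega> H = Lit (i * ?S) ?w (Lit ?S \<omega> H)"
        unfolding mult_Suc by (rule Lit_add)
      have "lmass (lsv_x T (shift (int (i * ?S)) ?w)) (Lit (i * ?S) ?w (\<lambda>x. Lit ?S \<omega> H x - c))
          \<le> lmass (lsv_x T (shift (int (i * ?S)) ?w)) (Lit (i * ?S) ?w (Lit ?S \<omega> H))"
        by (intro lmass_mono lcone_integrable lcone_Lit[OF w] lcone_Lit[OF \<omega>] H H1 Lit_mono[OF w]) (use c0 in auto)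
      also have "\<dots> \<le> \<tau>"
        using i unfolding e by (simp add: algebra_simps)
      finally show ?thesis .
    qed
    obtain F' G' where FG': "lcone F'" "lcone G'" "mass F' = mass G'"
      "mass F' \<le> max (2 * \<tau>) ((1 - lowc \<beta> / 32) ^ I * mass ?F1)"
      and eq: "\<And>x. 0 < x \<Longrightarrow> x \<le> 1 \<Longrightarrow> Lit (I * ?S) ?w ?F1 x - Lit (I * ?S) ?w ?G1 x = F' x - G' x"
      using Suc.IH[OF w F1(1) G1(1)] F1(2) G1(2) mon[OF F Suc.prems(5) F1(1)] mon[OF G Suc.prems(6) G1(1)] by auto
    have "Lit (Suc I * ?S) \<omega> F x - Lit (Suc I * ?S) \<omega> G x = F' x - G' x" if "0 < x" "x \<le> 1" for x
      using eq[OF that] unfolding mult_Suc[of I] Lit_add[of ?S] Lit_minus by linarith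
    moreover have "mass F' \<le> max (2 * \<tau>) ((1 - lowc \<beta> / 32) ^ Suc I * mass F)"
      using FG'(4) F1(2) by (simp add: m_def mult_ac)
    ultimately show ?thesis using FG' by blast
  qed
qed

section \<open>The equivariant density\<close>

definition cnt :: "real \<Rightarrow> nat \<Rightarrow> (int \<Rightarrow> real) \<Rightarrow> nat" where
  "cnt s n \<omega> = card {k. k < n \<and> \<omega> (int k) \<le> s}"

lemma cnt_Suc: "cnt s (Suc n) \<omega> = (if \<omega> 0 \<le> s then 1 else 0) + cnt s n (shift 1 \<omega>)"
proof -
  have "{k. k < Suc n \<and> \<omega> (int k) \<le> s} = (if \<omega> 0 \<le> s then {0} else {}) \<union> Suc ` {k. k < n \<and> shift 1 \<omega> (int k) \<le> s}"
  proof (intro set_eqI)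
    fix k
    show "k \<in> {k. k < Suc n \<and> \<omega> (int k) \<le> s} \<longleftrightarrow>
      k \<in> (if \<omega> 0 \<le> s then {0} else {}) \<union> Suc ` {k. k < n \<and> shift 1 \<omega> (int k) \<le> s}"
      by (cases k) (auto simp: shift_def add.commute)
  qed
  then have "cnt s (Suc n) \<omega> = card ((if \<omega> 0 \<le> s then {0} else {}) \<union> Suc ` {k. k < n \<and> shift 1 \<omega> (int k) \<le> s})"
    by (simp add: cnt_def)
  also have "\<dots> = card (if \<omega> 0 \<le> s then {0::nat} else {}) + card (Suc ` {k. k < n \<and> shift 1 \<omega> (int k) \<le> s})"
    by (rule card_Un_disjoint) auto
  finally show ?thesis by (simp add: cnt_def card_image)
qed

lemma cnt_all: "(\<And>k. \<omega> (int k) \<le> s) \<Longrightarrow> cnt s n \<omega> = n"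
  by (simp add: cnt_def)

lemma powr_one_plus_ge:
  assumes "0 < s" "0 \<le> t" "t \<le> (1::real)"
  shows "1 + s / 2 * t \<le> (1 + t) powr s"
proof -
  have "ln (1 / (1 + t)) \<le> 1 / (1 + t) - 1" using assms by (intro ln_le_minus_one) auto
  then have "1 - 1 / (1 + t) \<le> ln (1 + t)" using assms by (simp add: ln_div)
  moreover have "t / 2 \<le> 1 - 1 / (1 + t)" using assms mult_left_le[of t t] by (simp add: field_simps)
  ultimately have "s * (t / 2) \<le> s * ln (1 + t)" using assms by (intro mult_left_mono) auto
  then have "1 + s / 2 * t \<le> 1 + s * ln (1 + t)" by simp
  also have "\<dots> \<le> exp (s * ln (1 + t))" by (rule exp_ge_add_one_self)
  also have "\<dots> = (1 + t) powr s" using assms by (simp add: powr_def)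
  finally show ?thesis .
qed

lemma lsv_x_powr:
  assumes "adm \<beta> \<omega>" "0 < s"
  shows "1 + s / 2 * real (cnt s n \<omega>) \<le> lsv_x n \<omega> powr (- s)"
  using assms(1)
proof (induction n arbitrary: \<omega>)
  case 0
  then show ?case by (simp add: cnt_def)
next
  case (Suc n)
  let ?w = "shift 1 \<omega>"
  define a where "a = \<omega> 0"
  define x where "x = lsv_x n ?w"
  define y where "y = gl a x"
  define t where "t = (2 * y) powr a"
  have a: "0 < a" using admD(1)[OF Suc.prems] by (simp add: a_def)
  have x: "0 < x" "x \<le> 1" using lsv_x_bounds[of \<beta> ?w n] Suc.prems by (auto simp: x_def)
  have y: "0 < y" "y \<le> 1/2" using gl_props[of a x] a x by (auto simp: y_def)
  have t: "0 < t" "t \<le> 1" using y a by (auto simp: t_def intro!: powr_le1)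
  have xy: "x = y * (1 + t)" using gl_eq[of a x] a x by (simp add: y_def t_def)
  have ys: "y powr (- s) = x powr (- s) * (1 + t) powr s"
  proof -
    have "x powr s = y powr s * (1 + t) powr s" unfolding xy by (rule powr_mult)
    then show ?thesis using y t x by (simp add: powr_minus field_simps)
  qed
  have ge: "x powr (-s) + s / 2 * (if a \<le> s then 1 else 0) \<le> y powr (- s)"
  proof -
    have "(if a \<le> s then 1 else 0) \<le> x powr (-s) * t"
    proof (cases "a \<le> s")
      case True
      have "x powr s \<le> (2 * y) powr s"
        using x y t assms(2) by (intro powr_mono2) (auto simp: xy algebra_simps mult_left_le)
      also have "\<dots> \<le> t" unfolding t_def using y a True by (intro powr_mono') auto
      finally show ?thesis using x True by (simp add: powr_minus field_simps)
    qed (use t in simp)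
    then have "x powr (-s) + s / 2 * (if a \<le> s then 1 else 0) \<le> x powr (-s) + s / 2 * (x powr (-s) * t)"
      using assms(2) by (intro add_left_mono mult_left_mono) auto
    also have "\<dots> = x powr (-s) * (1 + s / 2 * t)" by (simp add: algebra_simps)
    also have "\<dots> \<le> y powr (-s)"
      unfolding ys using powr_one_plus_ge[OF assms(2)] t by (intro mult_left_mono) auto
    finally show ?thesis .
  qed
  have "1 + s / 2 * real (cnt s (Suc n) \<omega>) = (1 + s / 2 * real (cnt s n ?w)) + s / 2 * (if a \<le> s then 1 else 0)"
    by (simp add: cnt_Suc a_def algebra_simps)
  also have "\<dots> \<le> x powr (-s) + s / 2 * (if a \<le> s then 1 else 0)"
    using Suc.IH[of ?w] Suc.prems by (simp add: x_def)
  also have "\<dots> \<le> y powr (- s)" by (rule ge)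
  also have "y = lsv_x (Suc n) \<omega>" using lsv_x_Suc[OF Suc.prems, of n] by (simp add: y_def x_def a_def)
  finally show ?case .
qed

lemma lsv_x_le_cnt:
  assumes "adm \<beta> \<omega>" "0 < s" "0 < z" "z \<le> 1 + s / 2 * real (cnt s n \<omega>)"
  shows "lsv_x n \<omega> \<le> z powr (- 1 / s)"
proof -
  have x: "0 < lsv_x n \<omega>" using lsv_x_bounds[OF assms(1)] by auto
  have "z \<le> lsv_x n \<omega> powr (- s)" using lsv_x_powr[OF assms(1,2), of n] assms(4) by linarith
  then have "(lsv_x n \<omega> powr (- s)) powr (- 1 / s) \<le> z powr (- 1 / s)"
    using assms by (intro powr_mono2') auto
  then show ?thesis using assms(2) x by (simp add: powr_powr)
qed

lemma lsv_x_small: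
  assumes b: "0 < \<beta>" "\<beta> < 1" and e: "0 < e"
  shows "\<exists>T. \<forall>\<omega> n. adm \<beta> \<omega> \<longrightarrow> T \<le> n \<longrightarrow> lsv_x n \<omega> \<le> e"
proof -
  obtain T :: nat where T: "2 / \<beta> * (1 / e) powr \<beta> \<le> real T" using real_arch_simple by blast
  have "lsv_x n \<omega> \<le> e" if "adm \<beta> \<omega>" "T \<le> n" for \<omega> n
  proof -
    have c: "cnt \<beta> n \<omega> = n" using admD(3)[OF that(1)] by (intro cnt_all) auto
    have "(1 / e) powr \<beta> \<le> \<beta> / 2 * real T" using T b by (simp add: field_simps)
    also have "\<dots> \<le> 1 + \<beta> / 2 * real (cnt \<beta> n \<omega>)" using that b by (simp add: c add_increasing)
    finally have "lsv_x n \<omega> \<le> ((1 / e) powr \<beta>) powr (- 1 / \<beta>)"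
      using that b e by (intro lsv_x_le_cnt) auto
    also have "\<dots> = e" using b e by (simp add: powr_powr powr_minus)
    finally show ?thesis .
  qed
  then show ?thesis by blast
qed

lemma lmass_lsv_x_small:
  assumes b: "0 < \<beta>" "\<beta> < 1" and e: "0 < e"
  shows "\<exists>T. \<forall>\<omega> n f. adm \<beta> \<omega> \<longrightarrow> T \<le> n \<longrightarrow> kcone \<beta> f \<longrightarrow> mass f = 1 \<longrightarrow> lmass (lsv_x n \<omega>) f \<le> e"
proof -
  obtain \<epsilon> where \<epsilon>: "0 < \<epsilon>" "\<epsilon> \<le> 1" "Acone \<beta> / (1 - \<beta>) * \<epsilon> powr (1 - \<beta>) \<le> e"
    using lmass_small[OF b e] by auto
  obtain T where T: "\<And>\<omega> n. adm \<beta> \<omega> \<Longrightarrow> T \<le> n \<Longrightarrow> lsv_x n \<omega> \<le> \<epsilon>"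
    using lsv_x_small[OF b \<epsilon>(1)] by blast
  have "lmass (lsv_x n \<omega>) f \<le> e" if w: "adm \<beta> \<omega>" "T \<le> n" and f: "kcone \<beta> f" "mass f = 1" for \<omega> n f
  proof -
    have "lmass (lsv_x n \<omega>) f \<le> lmass \<epsilon> f" by (intro lmass_mono2 kcone_lcone[OF f(1)] T w)
    also have "\<dots> \<le> Acone \<beta> / (1 - \<beta>) * mass f * \<epsilon> powr (1 - \<beta>)" by (rule kcone_lmass[OF f(1) b \<epsilon>(1,2)])
    finally show ?thesis using \<epsilon>(3) f(2) by simp
  qed
  then show ?thesis by blast
qed

lemma uniform_loss:
  assumes b: "0 < \<beta>" "\<beta> < 1" and e: "0 < e"
  shows "\<exists>N. \<forall>\<omega> n F G. adm \<beta> \<omega> \<longrightarrow> N \<le> n \<longrightarrow> kcone \<beta> F \<longrightarrow> kcone \<beta> G \<longrightarrow> mass F = 1 \<longrightarrow> mass G = 1 \<longrightarrow>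
    (\<exists>F' G'. lcone F' \<and> lcone G' \<and> mass F' = mass G' \<and> mass F' \<le> e \<and>
     (\<forall>x. 0 < x \<longrightarrow> x \<le> 1 \<longrightarrow> Lit n \<omega> F x - Lit n \<omega> G x = F' x - G' x))"
proof -
  obtain T where T: "\<And>\<omega> n f. adm \<beta> \<omega> \<Longrightarrow> T \<le> n \<Longrightarrow> kcone \<beta> f \<Longrightarrow> mass f = 1 \<Longrightarrow> lmass (lsv_x n \<omega>) f \<le> e / 2"
    using lmass_lsv_x_small[OF b, of "e/2"] e by auto
  have "(\<lambda>i. (1 - lowc \<beta> / 32) ^ i) \<longlonglongrightarrow> 0"
    using lowc_pos[OF b] lowc_le1[OF b] by (intro LIMSEQ_power_zero) (auto simp: abs_if)
  then obtain I where I: "(1 - lowc \<beta> / 32) ^ I < e"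
    using order_tendstoD(2)[of _ 0 sequentially e] e by (auto simp: eventually_sequentially)
  show ?thesis
  proof (intro exI[of _ "I * Suc T"] allI impI)
    fix \<omega> n F G assume w: "adm \<beta> \<omega>" and n: "I * Suc T \<le> n" and F: "kcone \<beta> F" and G: "kcone \<beta> G"
      and m: "mass F = 1" "mass G = 1"
    define r where "r = n - I * Suc T"
    have nr: "n = r + I * Suc T" using n by (simp add: r_def)
    let ?w = "shift (int r) \<omega>"
    have w': "adm \<beta> ?w" using w by simp
    have *: "kcone \<beta> (Lit r \<omega> H)" "mass (Lit r \<omega> H) = 1"
      "lmass (lsv_x T (shift (int (i * Suc T)) ?w)) (Lit (i * Suc T) ?w (Lit r \<omega> H)) \<le> e / 2"
      if H: "kcone \<beta> H" "mass H = 1" for H i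
    proof -
      show k: "kcone \<beta> (Lit r \<omega> H)" by (rule kcone_Lit[OF w H(1)])
      show m: "mass (Lit r \<omega> H) = 1" using mass_Lit[OF w kcone_lcone[OF H(1)]] H(2) by simp
      show "lmass (lsv_x T (shift (int (i * Suc T)) ?w)) (Lit (i * Suc T) ?w (Lit r \<omega> H)) \<le> e / 2"
        by (intro T adm_shift w order_refl kcone_Lit k trans[OF mass_Lit[OF w' kcone_lcone[OF k]] m])
    qed
    obtain F' G' where FG: "lcone F'" "lcone G'" "mass F' = mass G'"
        "mass F' \<le> max (2 * (e / 2)) ((1 - lowc \<beta> / 32) ^ I * mass (Lit r \<omega> F))"
        "\<forall>x. 0 < x \<longrightarrow> x \<le> 1 \<longrightarrow> Lit (I * Suc T) ?w (Lit r \<omega> F) x - Lit (I * Suc T) ?w (Lit r \<omega> G) x = F' x - G' x"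
      using loss_of_memory[OF w' kcone_lcone[OF *(1)[OF F m(1)]] kcone_lcone[OF *(1)[OF G m(2)]], of I T "e/2"]
        *(2,3)[OF F m(1)] *(2,3)[OF G m(2)] by auto
    then show "\<exists>F' G'. lcone F' \<and> lcone G' \<and> mass F' = mass G' \<and> mass F' \<le> e \<and>
     (\<forall>x. 0 < x \<longrightarrow> x \<le> 1 \<longrightarrow> Lit n \<omega> F x - Lit n \<omega> G x = F' x - G' x)"
      using I *(2)[OF F m(1)] unfolding nr Lit_add by (intro exI[of _ F'] exI[of _ G']) auto
  qed
qed

definition hinv :: "(int \<Rightarrow> real) \<Rightarrow> real \<Rightarrow> real" where
  "hinv \<omega> x = lim (\<lambda>n. Lit n (shift (- int n) \<omega>) (\<lambda>_. 1) x)"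

lemma hinv_limit:
  assumes w: "adm \<beta> \<omega>" and x: "0 < x" "x \<le> 1"
  shows "(\<lambda>n. Lit n (shift (- int n) \<omega>) (\<lambda>_. 1) x) \<longlonglongrightarrow> hinv \<omega> x"
proof -
  let ?a = "\<lambda>n. Lit n (shift (- int n) \<omega>) (\<lambda>_. 1) x"
  have b: "0 < \<beta>" "\<beta> < 1" using admD(4,5)[OF w] .
  have "Cauchy ?a"
  proof (rule CauchyI')
    fix e :: real assume e: "0 < e"
    then have "0 < e * x / 2" using x by simp
    then obtain N where N: "\<And>\<omega> n F G. adm \<beta> \<omega> \<Longrightarrow> N \<le> n \<Longrightarrow> kcone \<beta> F \<Longrightarrow> kcone \<beta> G \<Longrightarrow> mass F = 1 \<Longrightarrow> mass G = 1 \<Longrightarrow>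
      (\<exists>F' G'. lcone F' \<and> lcone G' \<and> mass F' = mass G' \<and> mass F' \<le> e * x / 2 \<and>
       (\<forall>x. 0 < x \<longrightarrow> x \<le> 1 \<longrightarrow> Lit n \<omega> F x - Lit n \<omega> G x = F' x - G' x))"
      using uniform_loss[OF b] by metis
    show "\<exists>M. \<forall>m\<ge>M. \<forall>n>m. dist (?a m) (?a n) < e"
    proof (intro exI[of _ N] allI impI)
      fix m n assume mn: "N \<le> m" "m < n"
      let ?w = "shift (- int m) \<omega>"
      let ?G = "Lit (n - m) (shift (- int n) \<omega>) (\<lambda>_. 1)"
      have w1: "adm \<beta> ?w" and w2: "adm \<beta> (shift (- int n) \<omega>)" using w by simp_all
      have an: "?a n = Lit m ?w ?G x"
        using Lit_add[of "n - m" m "shift (- int n) \<omega>" "\<lambda>_. 1"] mn by (simp add: of_nat_diff)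
      have kG: "kcone \<beta> ?G" by (rule kcone_Lit[OF w2 kcone_one[OF b]])
      have mG: "mass ?G = 1" using mass_Lit[OF w2 lcone_const[of 1]] by (simp add: mass_const)
      obtain F' G' where FG: "lcone F'" "lcone G'" "mass F' = mass G'" "mass F' \<le> e * x / 2"
        "Lit m ?w (\<lambda>_. 1) x - Lit m ?w ?G x = F' x - G' x"
        using N[OF w1 mn(1) kcone_one[OF b] kG _ mG] x by (auto simp: mass_const)
      have "H x \<le> e / 2" if "lcone H" "mass H \<le> e * x / 2" for H
      proof -
        have "H x \<le> mass H / x" by (rule lcone_le_mass[OF that(1) x])
        also have "\<dots> \<le> (e * x / 2) / x" using that(2) x by (intro divide_right_mono) auto
        finally show ?thesis using x by simp
      qed
      then have "F' x \<le> e / 2" "G' x \<le> e / 2" using FG by auto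
      moreover have "0 \<le> F' x" "0 \<le> G' x" using lcone_nonneg FG(1,2) x by auto
      ultimately have "\<bar>F' x - G' x\<bar> < e" using e by (simp add: abs_if)
      then show "dist (?a m) (?a n) < e" unfolding an dist_real_def FG(5) by simp
    qed
  qed
  then have "convergent ?a" by (rule Cauchy_convergent)
  then show ?thesis unfolding hinv_def by (simp add: convergent_LIMSEQ_iff)
qed

lemma hinv_props:
  assumes w: "adm \<beta> \<omega>"
  shows hinv_kcone: "kcone \<beta> (hinv \<omega>)" and mass_hinv: "mass (hinv \<omega>) = 1"
proof -
  have b: "0 < \<beta>" "\<beta> < 1" using admD(4,5)[OF w] .
  let ?f = "\<lambda>n. Lit n (shift (- int n) \<omega>) (\<lambda>_. 1)"
  let ?B = "\<lambda>x. Acone \<beta> * x powr (- \<beta>)"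
  have k: "kcone \<beta> (?f n)" and m: "mass (?f n) = 1" for n
    using kcone_Lit[OF adm_shift[OF w] kcone_one[OF b]] mass_Lit[OF adm_shift[OF w] lcone_const[of 1]]
    by (auto simp: mass_const)
  have l: "lcone (?f n)" for n by (rule kcone_lcone[OF k])
  note lim = hinv_limit[OF w]
  have nn: "0 \<le> hinv \<omega> x" if "0 < x" "x \<le> 1" for x
    by (rule LIMSEQ_le_const[OF lim[OF that]]) (use lcone_nonneg[OF l that] in blast)
  have B: "hinv \<omega> x \<le> ?B x" if "0 < x" "x \<le> 1" for x
    by (rule LIMSEQ_le_const2[OF lim[OF that]]) (use k m that in \<open>auto simp: kcone_def\<close>)
  have fB: "?f n x \<le> ?B x" if "0 < x" "x \<le> 1" for x n
    using k[of n] m[of n] that by (auto simp: kcone_def)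
  have meas: "hinv \<omega> \<in> borel_measurable U"
    by (rule borel_measurable_LIMSEQ_real[where u = ?f]) (use lim l lcone_measurable in auto)
  have intB: "integrable U ?B" using powr_integrable_U[OF b] by simp
  have conv: "integrable U (hinv \<omega>)" "(\<lambda>n. \<integral>x. ?f n x \<partial>U) \<longlonglongrightarrow> (\<integral>x. hinv \<omega> x \<partial>U)"
  proof -
    have *: "AE x in U. (\<lambda>n. ?f n x) \<longlonglongrightarrow> hinv \<omega> x" "\<And>n. AE x in U. norm (?f n x) \<le> ?B x"
      using lim fB lcone_nonneg[OF l] by auto
    show "integrable U (hinv \<omega>)"
      by (rule integrable_dominated_convergence[OF meas _ intB *]) (use lcone_measurable[OF l] in auto)
    show "(\<lambda>n. \<integral>x. ?f n x \<partial>U) \<longlonglongrightarrow> (\<integral>x. hinv \<omega> x \<partial>U)"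
      by (rule integral_dominated_convergence[OF meas _ intB *]) (use lcone_measurable[OF l] in auto)
  qed
  show mh: "mass (hinv \<omega>) = 1"
  proof -
    have "(\<lambda>n. 1) \<longlonglongrightarrow> mass (hinv \<omega>)" using conv(2) m by (simp add: mass_def)
    then show ?thesis by (simp add: LIMSEQ_const_iff)
  qed
  have "lcone (hinv \<omega>)"
  proof (rule lconeI)
    fix x y :: real assume xy: "0 < x" "x \<le> y" "y \<le> 1"
    have x: "(\<lambda>n. ?f n x) \<longlonglongrightarrow> hinv \<omega> x" and y: "(\<lambda>n. ?f n y) \<longlonglongrightarrow> hinv \<omega> y"
      using xy by (auto intro!: lim)
    show "hinv \<omega> y \<le> hinv \<omega> x"
      by (rule LIMSEQ_le[OF y x]) (use lcone_antimono[OF l xy] in blast)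
    show "x\<^sup>2 * hinv \<omega> x \<le> y\<^sup>2 * hinv \<omega> y"
      by (rule LIMSEQ_le[OF tendsto_mult_left[OF x] tendsto_mult_left[OF y]]) (use lcone_sq_mono[OF l xy] in blast)
  qed (use conv nn in auto)
  then show "kcone \<beta> (hinv \<omega>)" using B by (auto simp: kcone_def mh)
qed

lemma hinv_lcone: "adm \<beta> \<omega> \<Longrightarrow> lcone (hinv \<omega>)"
  by (intro kcone_lcone hinv_kcone)

lemma Lop_hinv:
  assumes w: "adm \<beta> \<omega>" and x: "0 < x" "x \<le> 1"
  shows "Lop (\<omega> 0) (hinv \<omega>) x = hinv (shift 1 \<omega>) x"
proof (rule LIMSEQ_unique)
  have a: "0 < \<omega> 0" using admD[OF w] by auto
  let ?f = "\<lambda>n. Lit n (shift (- int n) \<omega>) (\<lambda>_. 1)"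
  have "(\<lambda>n. Lop (\<omega> 0) (?f n) x) \<longlonglongrightarrow> Lop (\<omega> 0) (hinv \<omega>) x"
    unfolding Lop_def L0_def L1_def
    using gl_props[OF a x] dlsv_ge1[OF a, of "gl (\<omega> 0) x"] x
    by (intro tendsto_intros hinv_limit[OF w]) auto
  moreover have "Lop (\<omega> 0) (?f n) x = Lit (Suc n) (shift (- int (Suc n)) (shift 1 \<omega>)) (\<lambda>_. 1) x" for n
    by (simp add: shift_def)
  ultimately show "(\<lambda>n. Lit (Suc n) (shift (- int (Suc n)) (shift 1 \<omega>)) (\<lambda>_. 1) x) \<longlonglongrightarrow> Lop (\<omega> 0) (hinv \<omega>) x"
    by (simp only:)
  show "(\<lambda>n. Lit (Suc n) (shift (- int (Suc n)) (shift 1 \<omega>)) (\<lambda>_. 1) x) \<longlonglongrightarrow> hinv (shift 1 \<omega>) x"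
    by (rule LIMSEQ_Suc[OF hinv_limit[OF adm_shift[OF w] x]])
qed

lemma Lit_hinv:
  assumes w: "adm \<beta> \<omega>" and x: "0 < x" "x \<le> 1"
  shows "Lit n \<omega> (hinv \<omega>) x = hinv (shift (int n) \<omega>) x"
  using w
proof (induction n arbitrary: \<omega>)
  case (Suc n)
  have "Lit (Suc n) \<omega> (hinv \<omega>) x = Lit n (shift 1 \<omega>) (hinv (shift 1 \<omega>)) x"
    unfolding Lit_Suc_left by (rule Lit_cong[OF adm_shift[OF Suc.prems] Lop_hinv[OF Suc.prems] x])
  then show ?case using Suc.IH[of "shift 1 \<omega>"] Suc.prems by (simp add: add.commute)
qed simp

text \<open>The mass of \<open>hinv\<close> below \<open>lsv_x T\<close> is a sum of the points \<open>lsv_x (T + j)\<close> over the fibres \<open>shift (- j)\<close>,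
  hence the windows of length \<open>T + j\<close> reaching \<open>j\<close> steps into the past.\<close>

definition good :: "real \<Rightarrow> real \<Rightarrow> nat \<Rightarrow> (int \<Rightarrow> real) \<Rightarrow> bool" where
  "good s p T \<omega> \<longleftrightarrow> (\<forall>j. p * real (T + j) / 2 \<le> real (cnt s (T + j) (shift (- int j) \<omega>)))"

lemma lmass_hinv_rec:
  assumes w: "adm \<beta> \<omega>"
  shows "lmass (lsv_x T \<omega>) (hinv \<omega>) \<le> lmass (lsv_x (T + r) (shift (- int r) \<omega>)) (hinv (shift (- int r) \<omega>))
    + (\<Sum>j<r. lsv_x (T + j) (shift (- int j) \<omega>))"
proof (induction r)
  case (Suc r)
  let ?w = "shift (- int (Suc r)) \<omega>"
  let ?y = "lsv_x (T + r) (shift (- int r) \<omega>)"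
  have w': "adm \<beta> ?w" using w by simp
  have s: "shift 1 ?w = shift (- int r) \<omega>" by simp
  have y: "0 < ?y" "?y \<le> 1" using lsv_x_bounds[OF adm_shift[OF w]] by auto
  have "lmass ?y (hinv (shift (- int r) \<omega>)) = lmass ?y (Lop (?w 0) (hinv ?w))"
    unfolding lmass_def by (intro Bochner_Integration.integral_cong) (use Lop_hinv[OF w'] s in auto)
  also have "\<dots> \<le> lmass (gl (?w 0) ?y) (hinv ?w) + ?y * mass (hinv ?w)"
    by (rule lmass_Lop_le[OF hinv_lcone[OF w'] admD(1,2)[OF w'] y])
  also have "gl (?w 0) ?y = lsv_x (T + Suc r) ?w"
    using lsv_x_Suc[OF w', of "T + r"] s by simp
  finally show ?case using Suc.IH mass_hinv[OF w'] by simp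
qed simp

lemma sum_powr_tail:
  fixes b :: real
  assumes b: "1 < b" and T: "1 \<le> T"
  shows "(\<Sum>j<r. real (T + j) powr (- b)) \<le> (1 + 1 / (b - 1)) * real T powr (1 - b)"
proof -
  have step: "(b - 1) * (x + 1) powr (- b) \<le> x powr (1 - b) - (x + 1) powr (1 - b)" if "1 \<le> x" for x :: real
  proof -
    have "(b - 1) * (1 / (x + 1)) \<le> (b - 1) * (- ln (1 - 1 / (x + 1)))"
      using that b ln_le_minus_one[of "1 - 1 / (x + 1)"] by (intro mult_left_mono) (auto simp: field_simps)
    also have "\<dots> \<le> exp ((1 - b) * ln (1 - 1 / (x + 1))) - 1"
      using exp_ge_add_one_self[of "(1 - b) * ln (1 - 1 / (x + 1))"] by (simp add: algebra_simps)
    also have "exp ((1 - b) * ln (1 - 1 / (x + 1))) = (x / (x + 1)) powr (1 - b)"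
      using that by (simp add: powr_def field_simps)
    finally have "(b - 1) * (1 / (x + 1)) \<le> (x / (x + 1)) powr (1 - b) - 1" .
    then have "(x + 1) powr (1 - b) * ((b - 1) * (1 / (x + 1))) \<le> (x + 1) powr (1 - b) * ((x / (x + 1)) powr (1 - b) - 1)"
      by (rule mult_left_mono) simp
    also have "(x + 1) powr (1 - b) * ((x / (x + 1)) powr (1 - b) - 1) = x powr (1 - b) - (x + 1) powr (1 - b)"
      using that by (simp add: powr_divide right_diff_distrib)
    also have "(x + 1) powr (1 - b) * ((b - 1) * (1 / (x + 1))) = (b - 1) * (x + 1) powr (- b)"
    proof -
      have "(x + 1) powr (- b) = (x + 1) powr ((1 - b) - 1)" by simp
      also have "\<dots> = (x + 1) powr (1 - b) / (x + 1)" using that by (subst powr_diff) simp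
      finally show ?thesis by simp
    qed
    finally show ?thesis .
  qed
  have *: "(\<Sum>j<Suc r. real (T + j) powr (- b)) \<le> real T powr (- b) + (real T powr (1 - b) - real (T + r) powr (1 - b)) / (b - 1)" for r
  proof (induction r)
    case (Suc r)
    have "real (T + Suc r) powr (- b) \<le> (real (T + r) powr (1 - b) - real (T + Suc r) powr (1 - b)) / (b - 1)"
      using step[of "real (T + r)"] T b by (simp add: field_simps)
    then show ?case using Suc.IH unfolding sum.lessThan_Suc[of _ "Suc r"] diff_divide_distrib by linarith
  qed simp
  have "(\<Sum>j<r. real (T + j) powr (- b)) \<le> (\<Sum>j<Suc r. real (T + j) powr (- b))" by simp
  also have "\<dots> \<le> real T powr (- b) + real T powr (1 - b) / (b - 1)"
    using *[of r] b by (simp add: diff_divide_distrib) (smt (verit) divide_nonneg_nonneg powr_ge_zero)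
  also have "real T powr (- b) \<le> real T powr (1 - b)" using T by (intro powr_mono) auto
  finally show ?thesis by (simp add: algebra_simps)
qed

lemma good_lmass:
  assumes w: "adm \<beta> \<omega>" and g: "good s p T \<omega>" and s: "0 < s" "s < 1" and p: "0 < p" and T: "1 \<le> T"
  shows "lmass (lsv_x T \<omega>) (hinv \<omega>) \<le> (s * p / 4) powr (- 1 / s) * (1 + 1 / (1 / s - 1)) * real T powr (1 - 1 / s)"
proof (rule field_le_epsilon)
  fix e :: real assume e: "0 < e"
  have b: "0 < \<beta>" "\<beta> < 1" using admD(4,5)[OF w] .
  obtain R where R: "\<And>\<omega> n f. adm \<beta> \<omega> \<Longrightarrow> R \<le> n \<Longrightarrow> kcone \<beta> f \<Longrightarrow> mass f = 1 \<Longrightarrow> lmass (lsv_x n \<omega>) f \<le> e"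
    using lmass_lsv_x_small[OF b e] by blast
  let ?K = "(s * p / 4) powr (- 1 / s)"
  have x: "lsv_x (T + j) (shift (- int j) \<omega>) \<le> ?K * real (T + j) powr (- (1 / s))" for j
  proof -
    have "s * p / 4 * real (T + j) = s / 2 * (p * real (T + j) / 2)" by simp
    also have "\<dots> \<le> s / 2 * real (cnt s (T + j) (shift (- int j) \<omega>))"
      using g s by (intro mult_left_mono) (auto simp: good_def)
    also have "\<dots> \<le> 1 + s / 2 * real (cnt s (T + j) (shift (- int j) \<omega>))" by simp
    finally have "lsv_x (T + j) (shift (- int j) \<omega>) \<le> (s * p / 4 * real (T + j)) powr (- 1 / s)"
      using s p T by (intro lsv_x_le_cnt[OF adm_shift[OF w] s(1)]) auto
    also have "\<dots> = ?K * real (T + j) powr (- (1 / s))"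
      by (subst powr_mult) simp
    finally show ?thesis .
  qed
  have "lmass (lsv_x T \<omega>) (hinv \<omega>) \<le> lmass (lsv_x (T + R) (shift (- int R) \<omega>)) (hinv (shift (- int R) \<omega>))
    + (\<Sum>j<R. lsv_x (T + j) (shift (- int j) \<omega>))" by (rule lmass_hinv_rec[OF w])
  also have "\<dots> \<le> e + (\<Sum>j<R. ?K * real (T + j) powr (- (1 / s)))"
    by (intro add_mono sum_mono x R hinv_kcone[OF adm_shift[OF w]] mass_hinv[OF adm_shift[OF w]] adm_shift w) simp
  also have "\<dots> \<le> e + ?K * ((1 + 1 / (1 / s - 1)) * real T powr (1 - 1 / s))"
    unfolding sum_distrib_left[symmetric] using s by (intro add_left_mono mult_left_mono sum_powr_tail[OF _ T]) auto
  finally show "lmass (lsv_x T \<omega>) (hinv \<omega>) \<le> ?K * (1 + 1 / (1 / s - 1)) * real T powr (1 - 1 / s) + e"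
    by (simp add: mult_ac)
qed


section \<open>Decay along a good orbit\<close>

text \<open>\<open>few n M \<omega> f\<close> is the part of the mass of \<open>f\<close> that passes the right branch fewer than
  \<open>M\<close> times in \<open>n\<close> steps.\<close>

fun few :: "nat \<Rightarrow> nat \<Rightarrow> (int \<Rightarrow> real) \<Rightarrow> (real \<Rightarrow> real) \<Rightarrow> real" where
  "few n 0 \<omega> f = 0"
| "few 0 (Suc M) \<omega> f = mass f"
| "few (Suc n) (Suc M) \<omega> f = few n (Suc M) (shift 1 \<omega>) (L0 (\<omega> 0) f) + few n M (shift 1 \<omega>) (L1 f)"

lemma few_bounds: "adm \<beta> \<omega> \<Longrightarrow> lcone f \<Longrightarrow> 0 \<le> few n M \<omega> f \<and> few n M \<omega> f \<le> mass f"
proof (induction n M \<omega> f rule: few.induct)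
  case (3 n M \<omega> f)
  have a: "0 < \<omega> 0" "\<omega> 0 < 1" using admD[OF 3(3)] by auto
  show ?case
    using 3(1)[OF adm_shift[OF 3(3)] lcone_L0[OF 3(4) a]] 3(2)[OF adm_shift[OF 3(3)] lcone_L1[OF 3(4)]]
      mass_L0_L1[OF 3(4) a] by simp
qed (auto simp: mass_nonneg)

lemma few_add:
  "adm \<beta> \<omega> \<Longrightarrow> lcone f \<Longrightarrow> lcone g \<Longrightarrow> few n M \<omega> (\<lambda>x. f x + g x) = few n M \<omega> f + few n M \<omega> g"
proof (induction n M \<omega> f arbitrary: g rule: few.induct)
  case (3 n M \<omega> f)
  have a: "0 < \<omega> 0" "\<omega> 0 < 1" using admD[OF 3(3)] by auto
  have "L0 (\<omega> 0) (\<lambda>x. f x + g x) = (\<lambda>x. L0 (\<omega> 0) f x + L0 (\<omega> 0) g x)"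
    "L1 (\<lambda>x. f x + g x) = (\<lambda>x. L1 f x + L1 g x)"
    by (simp_all add: L0_def L1_def fun_eq_iff add_divide_distrib)
  then show ?case
    using 3(1)[OF adm_shift[OF 3(3)] lcone_L0[OF 3(4) a] lcone_L0[OF 3(5) a]]
      3(2)[OF adm_shift[OF 3(3)] lcone_L1[OF 3(4)] lcone_L1[OF 3(5)]] by simp
qed (auto simp: mass_add)

lemma few_mono_count: "adm \<beta> \<omega> \<Longrightarrow> lcone f \<Longrightarrow> few n M \<omega> f \<le> few n (Suc M) \<omega> f"
proof (induction n M \<omega> f rule: few.induct)
  case (1 n \<omega> f)
  then show ?case using few_bounds[of \<beta> \<omega> f n "Suc 0"] by simp
next
  case (3 n M \<omega> f)
  have a: "0 < \<omega> 0" "\<omega> 0 < 1" using admD[OF 3(3)] by auto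
  show ?case
    using 3(1)[OF adm_shift[OF 3(3)] lcone_L0[OF 3(4) a]] 3(2)[OF adm_shift[OF 3(3)] lcone_L1[OF 3(4)]]
    by simp
qed auto

lemma few_forget:
  assumes w: "adm \<beta> \<omega>" and f: "lcone f"
  shows "few (T + n) M \<omega> f \<le> few n M (shift (int T) \<omega>) (Lit T \<omega> f)"
  using assms
proof (induction T arbitrary: \<omega> f)
  case (Suc T)
  note w = Suc.prems(1) and f = Suc.prems(2)
  have a: "0 < \<omega> 0" "\<omega> 0 < 1" using admD[OF w] by auto
  note f0 = lcone_L0[OF f a] and f1 = lcone_L1[OF f] and w1 = adm_shift[OF w, of 1]
  have "few (Suc T + n) M \<omega> f \<le> few (T + n) M (shift 1 \<omega>) (Lop (\<omega> 0) f)"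
  proof (cases M)
    case (Suc M')
    then show ?thesis
      using few_mono_count[OF w1 f1, of "T + n" M'] unfolding Lop_def[abs_def]
      by (simp add: few_add[OF w1 f0 f1])
  qed simp
  also have "\<dots> \<le> few n M (shift (int T) (shift 1 \<omega>)) (Lit T (shift 1 \<omega>) (Lop (\<omega> 0) f))"
    by (rule Suc.IH[OF w1 lcone_Lop[OF f a]])
  also have "\<dots> = few n M (shift (int (Suc T)) \<omega>) (Lit (Suc T) \<omega> f)"
    unfolding Lit_Suc_left by (simp add: add.commute)
  finally show ?case .
qed simp

lemma few_block:
  assumes w: "adm \<beta> \<omega>" and f: "lcone f"
  shows "few (T + n) (Suc M) \<omega> f \<le> lmass (lsv_x T \<omega>) f + few n M (shift (int T) \<omega>) (Lit T \<omega> f)"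
  using assms
proof (induction T arbitrary: \<omega> f)
  case 0
  then show ?case using few_bounds[OF 0, of n "Suc M"] few_bounds[OF 0, of n M] by (simp add: lmass_1)
next
  case (Suc T)
  note w = Suc.prems(1) and f = Suc.prems(2)
  have a: "0 < \<omega> 0" "\<omega> 0 < 1" using admD[OF w] by auto
  note f0 = lcone_L0[OF f a] and f1 = lcone_L1[OF f] and w1 = adm_shift[OF w, of 1]
  let ?w = "shift (int T) (shift 1 \<omega>)"
  have x: "0 < lsv_x T (shift 1 \<omega>)" "lsv_x T (shift 1 \<omega>) \<le> 1" using lsv_x_bounds[OF w1] by auto
  have "few (Suc T + n) (Suc M) \<omega> f = few (T + n) (Suc M) (shift 1 \<omega>) (L0 (\<omega> 0) f) + few (T + n) M (shift 1 \<omega>) (L1 f)"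
    by simp
  also have "\<dots> \<le> (lmass (lsv_x T (shift 1 \<omega>)) (L0 (\<omega> 0) f) + few n M ?w (Lit T (shift 1 \<omega>) (L0 (\<omega> 0) f)))
      + few n M ?w (Lit T (shift 1 \<omega>) (L1 f))"
    by (intro add_mono Suc.IH[OF w1 f0] few_forget[OF w1 f1])
  also have "\<dots> = lmass (lsv_x (Suc T) \<omega>) f + few n M ?w (Lit (Suc T) \<omega> f)"
    unfolding Lit_Suc_left Lop_def[abs_def] Lit_plus
    using lmass_L0[OF f a x] lsv_x_Suc[OF w, of T]
      few_add[OF adm_shift[OF w1] lcone_Lit[OF w1 f0] lcone_Lit[OF w1 f1]] by simp
  finally show ?case by (simp add: add.commute)
qed

lemma few_blocks:
  assumes w: "adm \<beta> \<omega>" and f: "lcone f"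
  shows "few (M * S) M \<omega> f \<le> (\<Sum>i<M. lmass (lsv_x S (shift (int (i * S)) \<omega>)) (Lit (i * S) \<omega> f))"
  using assms
proof (induction M arbitrary: \<omega> f)
  case (Suc M)
  note w = Suc.prems(1) and f = Suc.prems(2)
  let ?w = "shift (int S) \<omega>"
  have "few (Suc M * S) (Suc M) \<omega> f \<le> lmass (lsv_x S \<omega>) f + few (M * S) M ?w (Lit S \<omega> f)"
    unfolding mult_Suc by (rule few_block[OF w f])
  also have "few (M * S) M ?w (Lit S \<omega> f) \<le> (\<Sum>i<M. lmass (lsv_x S (shift (int (i * S)) ?w)) (Lit (i * S) ?w (Lit S \<omega> f)))"
    by (rule Suc.IH[OF adm_shift[OF w] lcone_Lit[OF w f]])
  also have "\<dots> = (\<Sum>i<M. lmass (lsv_x S (shift (int (Suc i * S)) \<omega>)) (Lit (Suc i * S) \<omega> f))"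
    unfolding mult_Suc Lit_add by (simp add: add.commute)
  finally show ?case unfolding sum.lessThan_Suc_shift[of _ M] by simp
qed simp

lemma gl_contract:
  assumes a: "0 < a" and x: "0 < x" "x \<le> 1" and y: "0 < y" "y \<le> 1"
  shows "\<bar>gl a x - gl a y\<bar> \<le> \<bar>x - y\<bar>"
proof -
  have *: "\<bar>gl a x - gl a y\<bar> \<le> \<bar>x - y\<bar>" if x: "0 < x" and y: "y \<le> 1" and xy: "x \<le> y" for x y
  proof -
    let ?s = "gl a x" and ?t = "gl a y"
    have st: "0 < ?s" "?s \<le> ?t" using gl_props[of a x] gl_mono[of a x y] a that by auto
    have "?t - ?s \<le> ?t * (1 + (2 * ?t) powr a) - ?s * (1 + (2 * ?s) powr a)"
      using mult_mono[of ?s ?t "(2 * ?s) powr a" "(2 * ?t) powr a"] powr_mono2[of a "2 * ?s" "2 * ?t"] st a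
      by (simp add: algebra_simps)
    also have "\<dots> = y - x" using gl_eq[of a x] gl_eq[of a y] a that by simp
    finally show ?thesis using st xy by simp
  qed
  show ?thesis using *[of x y] *[of y x] x y by (cases "x \<le> y") (auto simp: abs_minus_commute)
qed

text \<open>Freeze the Hoelder function on every cylinder that has passed the right branch at least \<open>M\<close> times.\<close>

lemma holder_regularize:
  assumes "adm \<beta> \<omega>" "lcone f" "0 < \<eta>" "0 \<le> H"
    and "\<And>x. 0 < x \<Longrightarrow> x \<le> 1 \<Longrightarrow> 0 \<le> \<psi> x \<and> \<psi> x \<le> B"
    and "\<And>x y. 0 < x \<Longrightarrow> x \<le> 1 \<Longrightarrow> 0 < y \<Longrightarrow> y \<le> 1 \<Longrightarrow> \<bar>\<psi> x - \<psi> y\<bar> \<le> H * \<bar>x - y\<bar> powr \<eta>"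
  shows "\<exists>F E. lcone F \<and> lcone E \<and> mass E \<le> H * 2 powr (- \<eta> * real M) * mass f + B * few n M \<omega> f \<and>
     (\<forall>x. 0 < x \<longrightarrow> x \<le> 1 \<longrightarrow> \<bar>Lit n \<omega> (\<lambda>x. \<psi> x * f x) x - F x\<bar> \<le> E x \<and> F x \<le> B * Lit n \<omega> f x)"
  using assms
proof (induction n arbitrary: \<psi> \<omega> f H M)
  case 0
  note f = 0(2)
  have B: "0 \<le> B" using 0(5)[of 1] by auto
  have p: "\<bar>\<psi> x - \<psi> 1\<bar> \<le> H" if "0 < x" "x \<le> 1" for x
  proof -
    have "\<bar>\<psi> x - \<psi> 1\<bar> \<le> H * \<bar>x - 1\<bar> powr \<eta>" using 0(6)[of x 1] that by auto
    also have "\<dots> \<le> H * 1" using 0(3,4) that by (intro mult_left_mono powr_le1) auto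
    finally show ?thesis by simp
  qed
  show ?case
  proof (cases M)
    case 0
    have "\<bar>\<psi> x * f x - \<psi> 1 * f x\<bar> \<le> H * f x" if "0 < x" "x \<le> 1" for x
      using mult_right_mono[OF p[OF that] lcone_nonneg[OF f that]] lcone_nonneg[OF f that]
      by (simp add: abs_mult left_diff_distrib[symmetric])
    then show ?thesis using 0 \<open>0 \<le> H\<close> \<open>\<And>x. 0 < x \<Longrightarrow> x \<le> 1 \<Longrightarrow> 0 \<le> \<psi> x \<and> \<psi> x \<le> B\<close>[of 1]
      by (intro exI[of _ "\<lambda>x. \<psi> 1 * f x"] exI[of _ "\<lambda>x. H * f x"])
         (auto intro!: lcone_scale f mult_right_mono lcone_nonneg[OF f] simp: mass_scale)
  next
    case (Suc M')
    have "\<bar>\<psi> x * f x\<bar> \<le> B * f x" if "0 < x" "x \<le> 1" for x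
      using \<open>\<And>x. 0 < x \<Longrightarrow> x \<le> 1 \<Longrightarrow> 0 \<le> \<psi> x \<and> \<psi> x \<le> B\<close>[OF that] lcone_nonneg[OF f that]
      by (auto simp: abs_mult intro!: mult_right_mono)
    moreover have "0 \<le> H * 2 powr (- \<eta> * real M) * mass f" using \<open>0 \<le> H\<close> mass_nonneg[OF f] by simp
    ultimately show ?thesis using Suc B
      by (intro exI[of _ "\<lambda>x. 0"] exI[of _ "\<lambda>x. B * f x"])
         (auto intro!: lcone_scale lcone_const f mult_nonneg_nonneg lcone_nonneg[OF f] simp: mass_scale)
  qed
next
  case (Suc n)
  note w = Suc.prems(1) and f = Suc.prems(2) and \<eta> = Suc.prems(3) and H = Suc.prems(4) and bd = Suc.prems(5) and ho = Suc.prems(6)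
  have a: "0 < \<omega> 0" "\<omega> 0 < 1" using admD[OF w] by auto
  note f0 = lcone_L0[OF f a] and f1 = lcone_L1[OF f] and w1 = adm_shift[OF w, of 1]
  have B: "0 \<le> B" using bd[of 1] by auto
  let ?n = "Suc n"
  show ?case
  proof (cases M)
    case 0
    let ?g = "Lit ?n \<omega> f"
    have g: "lcone ?g" by (rule lcone_Lit[OF w f])
    have p: "\<bar>\<psi> x - \<psi> 1\<bar> \<le> H" if "0 < x" "x \<le> 1" for x
    proof -
      have "\<bar>\<psi> x - \<psi> 1\<bar> \<le> H * \<bar>x - 1\<bar> powr \<eta>" using ho[of x 1] that by auto
      also have "\<dots> \<le> H * 1" using \<eta> H that by (intro mult_left_mono powr_le1) auto
      finally show ?thesis by simp
    qed
    have "\<bar>Lit ?n \<omega> (\<lambda>x. \<psi> x * f x) x - \<psi> 1 * ?g x\<bar> \<le> H * ?g x" if "0 < x" "x \<le> 1" for x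
    proof -
      have "\<bar>Lit ?n \<omega> (\<lambda>x. \<psi> x * f x - \<psi> 1 * f x) x\<bar> \<le> Lit ?n \<omega> (\<lambda>x. H * f x) x"
      proof (rule Lit_abs_le[OF w _ that])
        fix z :: real assume z: "0 < z" "z \<le> 1"
        show "\<bar>\<psi> z * f z - \<psi> 1 * f z\<bar> \<le> H * f z"
          using mult_right_mono[OF p[OF z] lcone_nonneg[OF f z]] lcone_nonneg[OF f z]
          by (simp add: abs_mult left_diff_distrib[symmetric])
      qed
      then show ?thesis unfolding Lit_minus Lit_scale .
    qed
    moreover have "mass ?g = mass f" by (rule mass_Lit[OF w f])
    ultimately show ?thesis using 0 H bd[of 1] g
      by (intro exI[of _ "\<lambda>x. \<psi> 1 * ?g x"] exI[of _ "\<lambda>x. H * ?g x"])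
         (auto intro!: lcone_scale mult_right_mono lcone_nonneg[OF g] simp: mass_scale simp del: Lit.simps)
  next
    case (Suc M')
    let ?w = "shift 1 \<omega>"
    let ?p0 = "\<lambda>x. \<psi> (gl (\<omega> 0) x)" and ?p1 = "\<lambda>x. \<psi> ((x + 1) / 2)"
    have h0: "\<bar>?p0 x - ?p0 y\<bar> \<le> H * \<bar>x - y\<bar> powr \<eta>" if "0 < x" "x \<le> 1" "0 < y" "y \<le> 1" for x y
    proof -
      have "\<bar>?p0 x - ?p0 y\<bar> \<le> H * \<bar>gl (\<omega> 0) x - gl (\<omega> 0) y\<bar> powr \<eta>"
        using gl_props[of "\<omega> 0" x] gl_props[of "\<omega> 0" y] that a by (intro ho) auto
      also have "\<dots> \<le> H * \<bar>x - y\<bar> powr \<eta>"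
        using gl_contract[OF a(1) that] H \<eta> by (intro mult_left_mono powr_mono2) auto
      finally show ?thesis .
    qed
    have h1: "\<bar>?p1 x - ?p1 y\<bar> \<le> (H * 2 powr (- \<eta>)) * \<bar>x - y\<bar> powr \<eta>" if "0 < x" "x \<le> 1" "0 < y" "y \<le> 1" for x y
    proof -
      have "\<bar>?p1 x - ?p1 y\<bar> \<le> H * \<bar>(x + 1) / 2 - (y + 1) / 2\<bar> powr \<eta>"
        using that by (intro ho) auto
      also have "(x + 1) / 2 - (y + 1) / 2 = (x - y) / 2" by (simp add: field_simps)
      also have "\<bar>(x - y) / 2\<bar> powr \<eta> = 2 powr (- \<eta>) * \<bar>x - y\<bar> powr \<eta>"
        by (simp add: powr_divide powr_minus field_simps)
      finally show ?thesis by (simp add: mult_ac)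
    qed
    have b0: "0 \<le> ?p0 x \<and> ?p0 x \<le> B" if "0 < x" "x \<le> 1" for x
      using gl_props[of "\<omega> 0" x] that a by (intro bd) auto
    have b1: "0 \<le> ?p1 x \<and> ?p1 x \<le> B" if "0 < x" "x \<le> 1" for x
      using that by (intro bd) auto
    obtain F0 E0 where 0: "lcone F0" "lcone E0"
      "mass E0 \<le> H * 2 powr (- \<eta> * real M) * mass (L0 (\<omega> 0) f) + B * few n M ?w (L0 (\<omega> 0) f)"
      "\<And>x. 0 < x \<Longrightarrow> x \<le> 1 \<Longrightarrow> \<bar>Lit n ?w (\<lambda>x. ?p0 x * L0 (\<omega> 0) f x) x - F0 x\<bar> \<le> E0 x \<and> F0 x \<le> B * Lit n ?w (L0 (\<omega> 0) f) x"
      using Suc.IH[OF w1 f0 \<eta> H b0 h0, of M] by blast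
    have "0 \<le> H * 2 powr (- \<eta>)" using H by simp
    from Suc.IH[OF w1 f1 \<eta> this b1 h1, of M']
    obtain F1 E1 where 1: "lcone F1" "lcone E1"
      "mass E1 \<le> (H * 2 powr (- \<eta>)) * 2 powr (- \<eta> * real M') * mass (L1 f) + B * few n M' ?w (L1 f)"
      "\<And>x. 0 < x \<Longrightarrow> x \<le> 1 \<Longrightarrow> \<bar>Lit n ?w (\<lambda>x. ?p1 x * L1 f x) x - F1 x\<bar> \<le> E1 x \<and> F1 x \<le> B * Lit n ?w (L1 f) x"
      by blast
    have split: "Lit ?n \<omega> (\<lambda>x. \<psi> x * f x) x = Lit n ?w (\<lambda>x. ?p0 x * L0 (\<omega> 0) f x) x + Lit n ?w (\<lambda>x. ?p1 x * L1 f x) x"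
      "Lit ?n \<omega> f x = Lit n ?w (L0 (\<omega> 0) f) x + Lit n ?w (L1 f) x" for x
    proof -
      have e: "Lop (\<omega> 0) (\<lambda>x. \<psi> x * f x) = (\<lambda>x. ?p0 x * L0 (\<omega> 0) f x + ?p1 x * L1 f x)"
        by (simp add: Lop_def L0_def L1_def fun_eq_iff)
      show "Lit ?n \<omega> (\<lambda>x. \<psi> x * f x) x = Lit n ?w (\<lambda>x. ?p0 x * L0 (\<omega> 0) f x) x + Lit n ?w (\<lambda>x. ?p1 x * L1 f x) x"
        unfolding Lit_Suc_left e Lit_plus ..
      show "Lit ?n \<omega> f x = Lit n ?w (L0 (\<omega> 0) f) x + Lit n ?w (L1 f) x"
        unfolding Lit_Suc_left Lop_def[abs_def] Lit_plus ..
    qed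
    have pw: "(H * 2 powr (- \<eta>)) * 2 powr (- \<eta> * real M') = H * 2 powr (- \<eta> * real M)"
      by (simp add: Suc powr_add[symmetric] algebra_simps)
    have "mass (\<lambda>x. E0 x + E1 x) \<le> H * 2 powr (- \<eta> * real M) * mass f + B * few ?n M \<omega> f"
      using 0(3) 1(3) unfolding pw mass_add[OF 0(2) 1(2)] mass_L0_L1[OF f a, symmetric]
      by (simp add: Suc algebra_simps)
    moreover have "\<bar>Lit ?n \<omega> (\<lambda>x. \<psi> x * f x) x - (F0 x + F1 x)\<bar> \<le> E0 x + E1 x \<and> F0 x + F1 x \<le> B * Lit ?n \<omega> f x"
      if "0 < x" "x \<le> 1" for x
      using 0(4)[OF that] 1(4)[OF that] unfolding split distrib_left by linarith
    ultimately show ?thesis using lcone_add[OF 0(1) 1(1)] lcone_add[OF 0(2) 1(2)] by blast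
  qed
qed

lemma rlsv_iter_U: "adm \<beta> \<omega> \<Longrightarrow> rlsv_iter n \<omega> \<in> U \<rightarrow>\<^sub>M U"
proof (induction n)
  case 0
  have "rlsv_iter 0 \<omega> = (\<lambda>x. x)" by (simp add: fun_eq_iff)
  then show ?case by simp
next
  case (Suc n)
  have "rlsv (shift (int n) \<omega>) \<in> U \<rightarrow>\<^sub>M U"
    unfolding rlsv_def by (rule lsv_U) (use admD(1)[OF adm_shift[OF Suc.prems]] in auto)
  then show ?case using Suc by (auto intro: measurable_comp)
qed

lemma distr_Lit:
  assumes w: "adm \<beta> \<omega>" and u: "u \<in> borel_measurable U" "\<And>x. 0 < x \<Longrightarrow> x \<le> 1 \<Longrightarrow> 0 \<le> u x"
  shows "distr (density U (\<lambda>x. ennreal (u x))) U (rlsv_iter n \<omega>) = density U (\<lambda>x. ennreal (Lit n \<omega> u x))"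
proof (induction n)
  case 0
  have "rlsv_iter 0 \<omega> = (\<lambda>x. x)" by (simp add: fun_eq_iff)
  show ?case unfolding \<open>rlsv_iter 0 \<omega> = (\<lambda>x. x)\<close> Lit.simps by (rule distr_id2) simp
next
  case (Suc n)
  have a: "0 < \<omega> (int n)" using admD[OF w] by auto
  have r: "rlsv (shift (int n) \<omega>) = lsv (\<omega> (int n))" by (simp add: rlsv_def shift_def)
  have "distr (density U (\<lambda>x. ennreal (u x))) U (rlsv_iter (Suc n) \<omega>)
      = distr (distr (density U (\<lambda>x. ennreal (u x))) U (rlsv_iter n \<omega>)) U (lsv (\<omega> (int n)))"
    unfolding rlsv_iter.simps r
    by (rule distr_distr[symmetric]) (use lsv_U[OF a] rlsv_iter_U[OF w] in auto)
  also have "\<dots> = density U (\<lambda>x. ennreal (Lit (Suc n) \<omega> u x))"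
    unfolding Suc by (simp, rule distr_Lop[OF a Lit_measurable[OF w u(1)] Lit_nonneg[OF w u(2)]])
  finally show ?case .
qed

lemma integral_Lit:
  fixes \<phi> :: "real \<Rightarrow> real"
  assumes w: "adm \<beta> \<omega>" and u: "u \<in> borel_measurable U" "\<And>x. 0 < x \<Longrightarrow> x \<le> 1 \<Longrightarrow> 0 \<le> u x"
    and \<phi>: "\<phi> \<in> borel_measurable U"
  shows "(\<integral>x. \<phi> (rlsv_iter n \<omega> x) * u x \<partial>U) = (\<integral>x. \<phi> x * Lit n \<omega> u x \<partial>U)"
    and "integrable U (\<lambda>x. \<phi> (rlsv_iter n \<omega> x) * u x) \<longleftrightarrow> integrable U (\<lambda>x. \<phi> x * Lit n \<omega> u x)"
proof -
  have D: "distr (density U (\<lambda>x. ennreal (u x))) U (rlsv_iter n \<omega>) = density U (\<lambda>x. ennreal (Lit n \<omega> u x))"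
    by (rule distr_Lit[OF w u])
  note it = rlsv_iter_U[OF w, of n]
  have m: "rlsv_iter n \<omega> \<in> density U (\<lambda>x. ennreal (u x)) \<rightarrow>\<^sub>M U" using it by simp
  have L: "Lit n \<omega> u \<in> borel_measurable U" by (rule Lit_measurable[OF w u(1)])
  have Lnn: "AE x in U. 0 \<le> Lit n \<omega> u x" using Lit_nonneg[OF w u(2)] by auto
  have unn: "AE x in U. 0 \<le> u x" using u(2) by auto
  have c: "(\<lambda>x. \<phi> (rlsv_iter n \<omega> x)) \<in> borel_measurable U" by (rule measurable_compose[OF it \<phi>])
  have "(\<integral>x. \<phi> (rlsv_iter n \<omega> x) * u x \<partial>U) = (\<integral>x. \<phi> (rlsv_iter n \<omega> x) \<partial>density U (\<lambda>x. ennreal (u x)))"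
    using integral_density[OF c u(1) unn] by (simp add: mult.commute)
  also have "\<dots> = (\<integral>x. \<phi> x \<partial>distr (density U (\<lambda>x. ennreal (u x))) U (rlsv_iter n \<omega>))"
    by (rule integral_distr[OF m \<phi>, symmetric])
  also have "\<dots> = (\<integral>x. \<phi> x * Lit n \<omega> u x \<partial>U)"
    unfolding D using integral_density[OF \<phi> L Lnn] by (simp add: mult.commute)
  finally show "(\<integral>x. \<phi> (rlsv_iter n \<omega> x) * u x \<partial>U) = (\<integral>x. \<phi> x * Lit n \<omega> u x \<partial>U)" .
  have "integrable U (\<lambda>x. \<phi> (rlsv_iter n \<omega> x) * u x) \<longleftrightarrow> integrable (density U (\<lambda>x. ennreal (u x))) (\<lambda>x. \<phi> (rlsv_iter n \<omega> x))"
    using integrable_density[OF c u(1) unn] by (simp add: mult.commute)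
  also have "\<dots> \<longleftrightarrow> integrable (distr (density U (\<lambda>x. ennreal (u x))) U (rlsv_iter n \<omega>)) \<phi>"
    by (rule integrable_distr_eq[OF m \<phi>, symmetric])
  also have "\<dots> \<longleftrightarrow> integrable U (\<lambda>x. \<phi> x * Lit n \<omega> u x)"
    unfolding D using integrable_density[OF \<phi> L Lnn] by (simp add: mult.commute)
  finally show "integrable U (\<lambda>x. \<phi> (rlsv_iter n \<omega> x) * u x) \<longleftrightarrow> integrable U (\<lambda>x. \<phi> x * Lit n \<omega> u x)" .
qed

lemma mass_Lit_nonneg:
  assumes w: "adm \<beta> \<omega>" and u: "u \<in> borel_measurable U" "\<And>x. 0 < x \<Longrightarrow> x \<le> 1 \<Longrightarrow> 0 \<le> u x"
  shows "mass (Lit n \<omega> u) = mass u"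
  using integral_Lit(1)[OF w u, of "\<lambda>_. 1"] by (simp add: mass_def)

lemma mass_abs_diff:
  assumes f: "f \<in> borel_measurable U" and g: "integrable U g" and E: "integrable U E"
    and d: "\<And>x. 0 < x \<Longrightarrow> x \<le> 1 \<Longrightarrow> \<bar>f x - g x\<bar> \<le> E x"
  shows "(\<integral>x. \<bar>f x - g x\<bar> \<partial>U) \<le> mass E" "integrable U f" "\<bar>mass f - mass g\<bar> \<le> mass E"
    "integrable U (\<lambda>x. f x - g x)"
proof -
  have fg: "integrable U (\<lambda>x. f x - g x)"
  proof (rule Bochner_Integration.integrable_bound[OF E])
    show "(\<lambda>x. f x - g x) \<in> borel_measurable U" using f g by simp
    have "norm (f x - g x) \<le> norm (E x)" if "x \<in> space U" for x
      using d[of x] that by (auto intro: order_trans[OF _ abs_ge_self])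
    then show "AE x in U. norm (f x - g x) \<le> norm (E x)" by (rule AE_I2)
  qed
  then have "integrable U (\<lambda>x. f x - g x + g x)" by (rule Bochner_Integration.integrable_add[OF _ g])
  then show i: "integrable U f" by simp
  show 1: "(\<integral>x. \<bar>f x - g x\<bar> \<partial>U) \<le> mass E"
    unfolding mass_def by (intro integral_mono) (use fg E d in auto)
  have "\<bar>mass f - mass g\<bar> = \<bar>\<integral>x. f x - g x \<partial>U\<bar>" unfolding mass_def using i g by simp
  also have "\<dots> \<le> (\<integral>x. \<bar>f x - g x\<bar> \<partial>U)" by (rule integral_abs_bound)
  finally show "\<bar>mass f - mass g\<bar> \<le> mass E" using 1 by simp
  show "integrable U (\<lambda>x. f x - g x)" by (rule fg)
qed

lemma decay_core:
  assumes w: "adm \<beta> \<omega>" and s: "0 < s" "s < 1" and p: "0 < p" and T: "1 \<le> T"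
    and g: "\<And>i. i \<le> n \<Longrightarrow> good s p T (shift (int i) \<omega>)"
    and n: "M * T + M * Suc T \<le> n"
    and \<eta>: "0 < \<eta>" and H: "0 \<le> H"
    and bd: "\<And>x. 0 < x \<Longrightarrow> x \<le> 1 \<Longrightarrow> 0 \<le> \<psi> x \<and> \<psi> x \<le> B"
    and ho: "\<And>x y. 0 < x \<Longrightarrow> x \<le> 1 \<Longrightarrow> 0 < y \<Longrightarrow> y \<le> 1 \<Longrightarrow> \<bar>\<psi> x - \<psi> y\<bar> \<le> H * \<bar>x - y\<bar> powr \<eta>"
    and \<psi>: "\<psi> \<in> borel_measurable U"
  defines "\<tau> \<equiv> (s * p / 4) powr (- 1 / s) * (1 + 1 / (1 / s - 1)) * real T powr (1 - 1 / s)"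
  defines "u \<equiv> \<lambda>x. \<psi> x * hinv \<omega> x"
  shows "integrable U (\<lambda>x. Lit n \<omega> u x - mass u * hinv (shift (int n) \<omega>) x)"
    and "(\<integral>x. \<bar>Lit n \<omega> u x - mass u * hinv (shift (int n) \<omega>) x\<bar> \<partial>U)
      \<le> (B + H) * (2 * 2 powr (- \<eta> * real M) + 2 * real M * \<tau> + 4 * \<tau> + 2 * (1 - lowc \<beta> / 32) ^ M)"
proof -
  have B: "0 \<le> B" using bd[of 1] by auto
  have b: "0 < \<beta>" "\<beta> < 1" using admD(4,5)[OF w] .
  have \<tau>0: "0 \<le> \<tau>" unfolding \<tau>_def using s by simp
  define \<rho> where "\<rho> = 1 - lowc \<beta> / 32"
  have \<rho>: "0 \<le> \<rho>" "\<rho> \<le> 1" using lowc_pos[OF b] lowc_le1[OF b] by (auto simp: \<rho>_def)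
  define n1 where "n1 = M * T"
  define n2 where "n2 = M * Suc T"
  define r where "r = n - n1 - n2"
  have nr: "n = n1 + (n2 + r)" using n by (simp add: n1_def n2_def r_def)
  define w1 where "w1 = shift (int n1) \<omega>"
  define w2 where "w2 = shift (int n2) w1"
  have aw: "adm \<beta> w1" "adm \<beta> w2" using w by (simp_all add: w1_def w2_def)
  define h where "h = hinv \<omega>"
  define h1 where "h1 = hinv w1"
  have lh: "lcone h" "mass h = 1" unfolding h_def by (auto intro: hinv_lcone[OF w] mass_hinv[OF w])
  have lh1: "lcone h1" "mass h1 = 1" unfolding h1_def by (auto intro: hinv_lcone[OF aw(1)] mass_hinv[OF aw(1)])
  have tail: "lmass (lsv_x T (shift (int i) \<omega>)) (hinv (shift (int i) \<omega>)) \<le> \<tau>" if "i \<le> n" for i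
    unfolding \<tau>_def by (rule good_lmass[OF adm_shift[OF w] g[OF that] s p T])
  have lc: "lmass y f = lmass y g" if "\<And>x. 0 < x \<Longrightarrow> x \<le> 1 \<Longrightarrow> f x = g x" for y f g
    unfolding lmass_def by (intro Bochner_Integration.integral_cong) (use that in auto)
  have few: "few n1 M \<omega> h \<le> real M * \<tau>"
  proof -
    have "few n1 M \<omega> h \<le> (\<Sum>i<M. lmass (lsv_x T (shift (int (i * T)) \<omega>)) (Lit (i * T) \<omega> h))"
      unfolding n1_def by (rule few_blocks[OF w lh(1)])
    also have "\<dots> \<le> (\<Sum>i<M. \<tau>)"
    proof (rule sum_mono)
      fix i assume "i \<in> {..<M}"
      then have "i * T \<le> n1" unfolding n1_def by (intro mult_right_mono) auto
      then have "i * T \<le> n" using nr by simp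
      have "lmass (lsv_x T (shift (int (i * T)) \<omega>)) (Lit (i * T) \<omega> h) =
         lmass (lsv_x T (shift (int (i * T)) \<omega>)) (hinv (shift (int (i * T)) \<omega>))"
        unfolding h_def by (rule lc) (rule Lit_hinv[OF w])
      then show "lmass (lsv_x T (shift (int (i * T)) \<omega>)) (Lit (i * T) \<omega> h) \<le> \<tau>"
        using tail[OF \<open>i * T \<le> n\<close>] by simp
    qed
    finally show ?thesis by simp
  qed
  obtain F E where FE: "lcone F" "lcone E" "mass E \<le> H * 2 powr (- \<eta> * real M) * mass h + B * few n1 M \<omega> h"
     "\<And>x. 0 < x \<Longrightarrow> x \<le> 1 \<Longrightarrow> \<bar>Lit n1 \<omega> (\<lambda>x. \<psi> x * h x) x - F x\<bar> \<le> E x \<and> F x \<le> B * Lit n1 \<omega> h x"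
    using holder_regularize[OF w lh(1) \<eta> H bd ho, of M n1] by blast
  have u: "u = (\<lambda>x. \<psi> x * h x)" by (simp add: u_def h_def)
  have um: "u \<in> borel_measurable U" unfolding u using \<psi> lcone_measurable[OF lh(1)] by simp
  have unn: "0 \<le> u x" if "0 < x" "x \<le> 1" for x using bd[OF that] lcone_nonneg[OF lh(1) that] by (simp add: u)
  have massE: "mass E \<le> H * 2 powr (- \<eta> * real M) + B * (real M * \<tau>)"
    using FE(3) mult_left_mono[OF few B] lh(2) by simp
  have FB: "F x \<le> B * h1 x" if "0 < x" "x \<le> 1" for x
    using FE(4)[OF that] Lit_hinv[OF w that, of n1] by (simp add: h_def h1_def w1_def)
  define mF where "mF = mass F"
  have "mass F \<le> mass (\<lambda>x. B * h1 x)"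
    by (rule mass_mono) (use FB lcone_integrable[OF FE(1)] lcone_integrable[OF lh1(1)] in auto)
  then have mF: "0 \<le> mF" "mF \<le> B" using mass_nonneg[OF FE(1)] lh1(2) by (auto simp: mF_def mass_scale)
  define G where "G = (\<lambda>x. mF * h1 x)"
  have G: "lcone G" "mass G = mF" unfolding G_def using lh1 mF by (auto intro: lcone_scale simp: mass_scale)
  have tail2: "lmass (lsv_x T (shift (int (i * Suc T)) w1)) (Lit (i * Suc T) w1 K) \<le> B * \<tau>"
    if i: "i < M" and K: "lcone K" "\<And>x. 0 < x \<Longrightarrow> x \<le> 1 \<Longrightarrow> K x \<le> B * h1 x" for K i
  proof -
    have "i * Suc T \<le> n2" unfolding n2_def using i by (intro mult_right_mono) auto
    then have le: "n1 + i * Suc T \<le> n" using nr by simp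
    have sh: "shift (int (i * Suc T)) w1 = shift (int (n1 + i * Suc T)) \<omega>" by (simp add: w1_def add.commute)
    have "lmass (lsv_x T (shift (int (i * Suc T)) w1)) (Lit (i * Suc T) w1 K) \<le>
      lmass (lsv_x T (shift (int (i * Suc T)) w1)) (Lit (i * Suc T) w1 (\<lambda>x. B * h1 x))"
      by (intro lmass_mono lcone_integrable lcone_Lit[OF aw(1)] K(1) Lit_mono[OF aw(1)] K(2)
           lcone_scale[OF lh1(1) B]) auto
    also have "\<dots> = B * lmass (lsv_x T (shift (int (i * Suc T)) w1)) (Lit (i * Suc T) w1 h1)"
      unfolding Lit_scale lmass_scale ..
    also have "lmass (lsv_x T (shift (int (i * Suc T)) w1)) (Lit (i * Suc T) w1 h1) =
       lmass (lsv_x T (shift (int (i * Suc T)) w1)) (hinv (shift (int (i * Suc T)) w1))"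
      unfolding h1_def by (rule lc) (rule Lit_hinv[OF aw(1)])
    also have "\<dots> \<le> \<tau>" unfolding sh by (rule tail[OF le])
    finally show ?thesis using B by (simp add: mult_left_mono)
  qed
  have GB: "G x \<le> B * h1 x" if "0 < x" "x \<le> 1" for x
    unfolding G_def by (rule mult_right_mono[OF mF(2) lcone_nonneg[OF lh1(1) that]])
  have mFG: "mass F = mass G" by (simp add: G(2) mF_def)
  have tF: "lmass (lsv_x T (shift (int (i * Suc T)) w1)) (Lit (i * Suc T) w1 F) \<le> B * \<tau>" if "i < M" for i
    by (rule tail2[OF that FE(1) FB])
  have tG: "lmass (lsv_x T (shift (int (i * Suc T)) w1)) (Lit (i * Suc T) w1 G) \<le> B * \<tau>" if "i < M" for i
    by (rule tail2[OF that G(1) GB])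
  obtain F' G' where FG: "lcone F'" "lcone G'" "mass F' = mass G'" "mass F' \<le> max (2 * (B * \<tau>)) (\<rho> ^ M * mF)"
    "\<And>x. 0 < x \<Longrightarrow> x \<le> 1 \<Longrightarrow> Lit n2 w1 F x - Lit n2 w1 G x = F' x - G' x"
    using loss_of_memory[OF aw(1) FE(1) G(1) mFG tF tG] unfolding \<rho>_def n2_def mF_def by blast
  have mF': "mass F' \<le> 2 * B * \<tau> + \<rho> ^ M * B"
  proof -
    have "\<rho> ^ M * mF \<le> \<rho> ^ M * B" using mF \<rho> by (intro mult_left_mono) auto
    moreover have "0 \<le> B * \<tau>" "0 \<le> \<rho> ^ M * B" using B \<tau>0 \<rho> by auto
    ultimately show ?thesis using FG(4) by linarith
  qed
  have c: "mass u = mass (Lit n1 \<omega> u)" using mass_Lit_nonneg[OF w um unn] by simp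
  have dF: "\<bar>mass u - mF\<bar> \<le> mass E"
    unfolding c mF_def
    by (rule mass_abs_diff(3)[OF Lit_measurable[OF w um] lcone_integrable[OF FE(1)] lcone_integrable[OF FE(2)]])
       (use FE(4) in \<open>simp add: u\<close>)
  define hn where "hn = hinv (shift (int n) \<omega>)"
  have lhn: "lcone hn" "mass hn = 1" unfolding hn_def by (auto intro: hinv_lcone[OF adm_shift[OF w]] mass_hinv[OF adm_shift[OF w]])
  define R where "R = (\<lambda>x. (Lit (n2 + r) w1 E x + (Lit r w2 F' x + Lit r w2 G' x)) + \<bar>mass u - mF\<bar> * hn x)"
  have lR: "lcone R" unfolding R_def
    by (intro lcone_add lcone_scale lcone_Lit[OF aw(1)] lcone_Lit[OF aw(2)] FE FG lhn) simp
  have mR: "mass R = (mass E + (mass F' + mass G')) + \<bar>mass u - mF\<bar>"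
    unfolding R_def
    using mass_Lit[OF aw(1) FE(2)] mass_Lit[OF aw(2) FG(1)] mass_Lit[OF aw(2) FG(2)] lhn
      lcone_Lit[OF aw(1) FE(2)] lcone_Lit[OF aw(2) FG(1)] lcone_Lit[OF aw(2) FG(2)]
    by (simp add: mass_add mass_scale lcone_add lcone_scale)
  have hn1: "Lit (n2 + r) w1 h1 x = hn x" if "0 < x" "x \<le> 1" for x
    using Lit_hinv[OF aw(1) that, of "n2 + r"] by (simp add: h1_def hn_def w1_def nr add_ac)
  have main: "\<bar>Lit n \<omega> u x - mass u * hn x\<bar> \<le> R x" if x: "0 < x" "x \<le> 1" for x
  proof -
    have "Lit n \<omega> u x - mass u * hn x =
       Lit (n2 + r) w1 (\<lambda>x. Lit n1 \<omega> u x - F x) x + (Lit (n2 + r) w1 F x - Lit (n2 + r) w1 G x)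
       + (mF * Lit (n2 + r) w1 h1 x - mass u * hn x)"
      unfolding nr Lit_add[of n1] w1_def[symmetric] Lit_minus G_def Lit_scale by simp
    also have "Lit (n2 + r) w1 F x - Lit (n2 + r) w1 G x = Lit r w2 (\<lambda>x. Lit n2 w1 F x - Lit n2 w1 G x) x"
      unfolding Lit_add Lit_minus w2_def ..
    also have "\<dots> = Lit r w2 (\<lambda>x. F' x - G' x) x" by (rule Lit_cong[OF aw(2) FG(5) x])
    also have "\<dots> = Lit r w2 F' x - Lit r w2 G' x" unfolding Lit_minus ..
    finally have e: "Lit n \<omega> u x - mass u * hn x = Lit (n2 + r) w1 (\<lambda>x. Lit n1 \<omega> u x - F x) x
       + (Lit r w2 F' x - Lit r w2 G' x) + (mF - mass u) * hn x"
      unfolding hn1[OF x] by (simp add: left_diff_distrib)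
    have "\<bar>Lit (n2 + r) w1 (\<lambda>x. Lit n1 \<omega> u x - F x) x\<bar> \<le> Lit (n2 + r) w1 E x"
      by (rule Lit_abs_le[OF aw(1) _ x]) (use FE(4) in \<open>auto simp: u\<close>)
    moreover have "0 \<le> Lit r w2 F' x" "0 \<le> Lit r w2 G' x"
      using lcone_nonneg[OF lcone_Lit[OF aw(2) FG(1)] x] lcone_nonneg[OF lcone_Lit[OF aw(2) FG(2)] x] .
    moreover have "\<bar>(mF - mass u) * hn x\<bar> = \<bar>mass u - mF\<bar> * hn x"
      using lcone_nonneg[OF lhn(1) x] by (simp add: abs_mult abs_minus_commute)
    ultimately show ?thesis unfolding e R_def by linarith
  qed
  have ih: "integrable U (\<lambda>x. mass u * hn x)" using lcone_integrable[OF lhn(1)] by simp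
  note md = mass_abs_diff[OF Lit_measurable[OF w um, of n] ih lcone_integrable[OF lR] main]
  show "integrable U (\<lambda>x. Lit n \<omega> u x - mass u * hinv (shift (int n) \<omega>) x)"
    using md(4) by (simp add: hn_def)
  have "(\<integral>x. \<bar>Lit n \<omega> u x - mass u * hinv (shift (int n) \<omega>) x\<bar> \<partial>U) \<le> mass R"
    using md(1) by (simp add: hn_def)
  also have "\<dots> \<le> 2 * (H * 2 powr (- \<eta> * real M) + B * (real M * \<tau>)) + 2 * (2 * B * \<tau> + \<rho> ^ M * B)"
  proof -
    have "mass R \<le> 2 * mass E + 2 * mass F'" unfolding mR using dF FG(3) by simp
    also have "\<dots> \<le> 2 * (H * 2 powr (- \<eta> * real M) + B * (real M * \<tau>)) + 2 * (2 * B * \<tau> + \<rho> ^ M * B)"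
      by (intro add_mono mult_left_mono massE mF') auto
    finally show ?thesis .
  qed
  also have "\<dots> \<le> (B + H) * (2 * 2 powr (- \<eta> * real M) + 2 * real M * \<tau> + 4 * \<tau> + 2 * \<rho> ^ M)"
    using B H \<tau>0 \<rho> by (simp add: algebra_simps)
  finally show "(\<integral>x. \<bar>Lit n \<omega> u x - mass u * hinv (shift (int n) \<omega>) x\<bar> \<partial>U)
      \<le> (B + H) * (2 * 2 powr (- \<eta> * real M) + 2 * real M * \<tau> + 4 * \<tau> + 2 * (1 - lowc \<beta> / 32) ^ M)"
    by (simp add: \<rho>_def)
qed

lemma exp_powr_bound:
  fixes c d k :: real
  assumes "0 < c" "0 < d"
  shows "\<exists>C\<ge>0. \<forall>n::nat. 1 \<le> n \<longrightarrow> exp (- c * real n powr d) \<le> C * real n powr (- k)"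
proof -
  have "(\<lambda>n. real n powr k * exp (- c * real n powr d)) \<longlonglongrightarrow> 0"
    using assms by real_asymp
  then have "Bseq (\<lambda>n. real n powr k * exp (- c * real n powr d))"
    by (intro convergent_imp_Bseq) (auto simp: convergent_def)
  then obtain C where C: "0 < C" "\<And>n. norm (real n powr k * exp (- c * real n powr d)) \<le> C"
    by (auto simp: Bseq_def)
  show ?thesis
  proof (intro exI[of _ C] conjI allI impI)
    fix n :: nat assume n: "1 \<le> n"
    have "real n powr k * exp (- c * real n powr d) \<le> C" using C(2)[of n] by simp
    then show "exp (- c * real n powr d) \<le> C * real n powr (- k)"
      using n by (simp add: powr_minus field_simps)
  qed (use C in simp)
qed

definition Tn :: "real \<Rightarrow> nat \<Rightarrow> nat" where "Tn v n = nat \<lfloor>real n powr v\<rfloor>"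

definition Mn :: "real \<Rightarrow> nat \<Rightarrow> nat" where "Mn v n = n div (2 * Suc (Tn v n))"

lemma Tn_bounds:
  assumes "0 < v" "1 \<le> n"
  shows "1 \<le> Tn v n" "real (Tn v n) \<le> real n powr v" "real n powr v \<le> real (Tn v n) + 1" "real n powr v / 2 \<le> real (Tn v n)"
proof -
  have 1: "1 \<le> real n powr v" using assms by (intro ge_one_powr_ge_zero) auto
  have f: "(1::int) \<le> \<lfloor>real n powr v\<rfloor>" using 1 by (simp add: le_floor_iff)
  have e: "real (Tn v n) = real_of_int \<lfloor>real n powr v\<rfloor>" using f by (simp add: Tn_def)
  show "1 \<le> Tn v n" using f unfolding Tn_def by linarith
  show "real (Tn v n) \<le> real n powr v" unfolding e by linarith
  show g: "real n powr v \<le> real (Tn v n) + 1" unfolding e by linarith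
  show "real n powr v / 2 \<le> real (Tn v n)" using g \<open>1 \<le> Tn v n\<close> by simp
qed

lemma rate_bound:
  fixes v b \<kappa> K \<rho> \<eta> :: real
  assumes v: "0 < v" "v < 1" and b: "1 < b" and k: "1 - v * b \<le> - \<kappa>" and K: "0 \<le> K" and \<rho>: "0 < \<rho>" "\<rho> < 1" and \<eta>: "0 < \<eta>"
  shows "\<exists>D\<ge>0. \<forall>n::nat. 1 \<le> n \<longrightarrow>
    2 * 2 powr (- \<eta> * real (Mn v n)) + 2 * real (Mn v n) * (K * real (Tn v n) powr (1 - b)) + 4 * (K * real (Tn v n) powr (1 - b)) + 2 * \<rho> ^ Mn v n
    \<le> D * real n powr (- \<kappa>)"
proof -
  have expM: "\<exists>C\<ge>0. \<forall>n::nat. 1 \<le> n \<longrightarrow> exp (- c * real (Mn v n)) \<le> C * real n powr (- \<kappa>)" if c: "0 < c" for c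
  proof -
    obtain C where C: "0 \<le> C" "\<And>n::nat. 1 \<le> n \<Longrightarrow> exp (- (c/4) * real n powr (1 - v)) \<le> C * real n powr (- \<kappa>)"
      using exp_powr_bound[of "c/4" "1-v" \<kappa>] c v by auto
    show ?thesis
    proof (intro exI[of _ "exp c * C"] conjI allI impI)
      fix n :: nat assume n: "1 \<le> n"
      note t = Tn_bounds[OF v(1) n]
      have "real n < (real (Mn v n) + 1) * real (2 * Suc (Tn v n))"
      proof -
        have "n < (Mn v n + 1) * (2 * Suc (Tn v n))"
          unfolding Mn_def using div_less_iff_less_mult[of "2 * Suc (Tn v n)" n "n div (2 * Suc (Tn v n)) + 1"] by simp
        then have "real n < real ((Mn v n + 1) * (2 * Suc (Tn v n)))" by (simp only: of_nat_less_iff)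
        then show ?thesis by (simp only: of_nat_mult of_nat_add of_nat_1)
      qed
      also have "\<dots> \<le> (real (Mn v n) + 1) * (4 * real n powr v)"
        using t(1,2) by (intro mult_left_mono) auto
      finally have "real n / real n powr v \<le> (real (Mn v n) + 1) * 4"
        using n by (simp add: field_simps)
      moreover have "real n / real n powr v = real n powr (1 - v)" using n by (simp add: powr_diff)
      ultimately have "real n powr (1 - v) / 4 - 1 \<le> real (Mn v n)" by simp
      then have "c * (real n powr (1 - v) / 4 - 1) \<le> c * real (Mn v n)" using c by (intro mult_left_mono) auto
      then have "exp (- c * real (Mn v n)) \<le> exp (c + - (c/4) * real n powr (1 - v))"
        by (simp add: algebra_simps)
      also have "\<dots> \<le> exp c * (C * real n powr (- \<kappa>))" unfolding exp_add by (intro mult_left_mono C(2) n) auto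
      finally show "exp (- c * real (Mn v n)) \<le> exp c * C * real n powr (- \<kappa>)" by (simp add: mult_ac)
    qed (use C in simp)
  qed
  obtain C1 where C1: "0 \<le> C1" "\<And>n::nat. 1 \<le> n \<Longrightarrow> exp (- (\<eta> * ln 2) * real (Mn v n)) \<le> C1 * real n powr (- \<kappa>)"
    using expM[of "\<eta> * ln 2"] \<eta> by auto
  obtain C2 where C2: "0 \<le> C2" "\<And>n::nat. 1 \<le> n \<Longrightarrow> exp (- (- ln \<rho>) * real (Mn v n)) \<le> C2 * real n powr (- \<kappa>)"
    using expM[of "- ln \<rho>"] \<rho> by auto
  define Q where "Q = K * 2 powr (b - 1)"
  have Q: "0 \<le> Q" using K by (simp add: Q_def)
  have tau: "K * real (Tn v n) powr (1 - b) \<le> Q * real n powr (v * (1 - b))" if n: "1 \<le> n" for n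
  proof -
    note t = Tn_bounds[OF v(1) n]
    have "real (Tn v n) powr (1 - b) \<le> (real n powr v / 2) powr (1 - b)"
      using t n b by (intro powr_mono2') auto
    also have "\<dots> = 2 powr (b - 1) * real n powr (v * (1 - b))"
      by (simp add: powr_divide powr_powr powr_diff field_simps)
    finally show ?thesis using K by (simp add: Q_def mult.assoc mult_left_mono)
  qed
  have M: "real (Mn v n) \<le> real n powr (1 - v)" if n: "1 \<le> n" for n
  proof -
    note t = Tn_bounds[OF v(1) n]
    have "real (Mn v n) \<le> real n / real (2 * Suc (Tn v n))" unfolding Mn_def
      using of_int_floor_le[of "real n / real (2 * Suc (Tn v n))"] unfolding floor_divide_of_nat_eq by simp
    also have "\<dots> \<le> real n / real n powr v"
      using t n by (intro divide_left_mono mult_pos_pos) auto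
    also have "\<dots> = real n powr (1 - v)" using n by (simp add: powr_diff)
    finally show ?thesis .
  qed
  show ?thesis
  proof (intro exI[of _ "2 * C1 + 2 * Q + 4 * Q + 2 * C2"] conjI allI impI)
    fix n :: nat assume n: "1 \<le> n"
    have 1: "2 powr (- \<eta> * real (Mn v n)) \<le> C1 * real n powr (- \<kappa>)"
      using C1(2)[OF n] by (simp add: powr_def mult_ac)
    have 2: "\<rho> ^ Mn v n \<le> C2 * real n powr (- \<kappa>)"
      using C2(2)[OF n] \<rho> by (simp add: powr_realpow[symmetric] powr_def mult_ac)
    have e1: "real n powr (1 - v) * real n powr (v * (1 - b)) \<le> real n powr (- \<kappa>)"
      unfolding powr_add[symmetric] using n k by (intro powr_mono) (auto simp: algebra_simps)
    have e2: "real n powr (v * (1 - b)) \<le> real n powr (- \<kappa>)"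
      using n k v by (intro powr_mono) (auto simp: algebra_simps)
    have 3: "real (Mn v n) * (K * real (Tn v n) powr (1 - b)) \<le> Q * real n powr (- \<kappa>)"
    proof -
      have "real (Mn v n) * (K * real (Tn v n) powr (1 - b)) \<le> real n powr (1 - v) * (Q * real n powr (v * (1 - b)))"
        using K by (intro mult_mono M tau n) auto
      also have "\<dots> = Q * (real n powr (1 - v) * real n powr (v * (1 - b)))" by (simp add: mult_ac)
      also have "\<dots> \<le> Q * real n powr (- \<kappa>)" by (intro mult_left_mono e1 Q)
      finally show ?thesis .
    qed
    have 4: "K * real (Tn v n) powr (1 - b) \<le> Q * real n powr (- \<kappa>)"
      using tau[OF n] mult_left_mono[OF e2 Q] by linarith
    show "2 * 2 powr (- \<eta> * real (Mn v n)) + 2 * real (Mn v n) * (K * real (Tn v n) powr (1 - b)) + 4 * (K * real (Tn v n) powr (1 - b)) + 2 * \<rho> ^ Mn v n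
      \<le> (2 * C1 + 2 * Q + 4 * Q + 2 * C2) * real n powr (- \<kappa>)"
      using 1 2 3 4 unfolding distrib_right by linarith
  qed (use C1 C2 Q in simp)
qed

section \<open>The random environment\<close>

locale lsv_random =
  fixes \<alpha>\<^sub>0 \<alpha>\<^sub>1 :: real and \<nu> :: "real measure" and P :: "(int \<Rightarrow> real) measure"
  assumes \<alpha>: "0 < \<alpha>\<^sub>0" "\<alpha>\<^sub>0 < \<alpha>\<^sub>1" "\<alpha>\<^sub>1 < 1"
    and prob_\<nu>: "prob_space \<nu>" and sets_\<nu>: "sets \<nu> = sets (restrict_space borel {\<alpha>\<^sub>0..\<alpha>\<^sub>1})"
    and P_def: "P = (\<Pi>\<^sub>M i\<in>(UNIV :: int set). \<nu>)"
begin

lemma space_\<nu>: "space \<nu> = {\<alpha>\<^sub>0..\<alpha>\<^sub>1}"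
  using sets_eq_imp_space_eq[OF sets_\<nu>] by (simp add: space_restrict_space)

sublocale nu: prob_space \<nu> by (rule prob_\<nu>)

sublocale P: prob_space P unfolding P_def by (intro prob_space_PiM prob_\<nu>)

lemma space_P: "space P = (\<Pi>\<^sub>E i\<in>UNIV. {\<alpha>\<^sub>0..\<alpha>\<^sub>1})"
  by (simp add: P_def space_PiM space_\<nu>)

lemma coord_bounds: "\<omega> \<in> space P \<Longrightarrow> \<alpha>\<^sub>0 \<le> \<omega> i \<and> \<omega> i \<le> \<alpha>\<^sub>1"
  by (auto simp: space_P PiE_def Pi_def)

lemma adm_P: "\<omega> \<in> space P \<Longrightarrow> adm \<alpha>\<^sub>1 \<omega>"
  using \<alpha> coord_bounds[of \<omega>] unfolding adm_def by (auto intro: less_le_trans)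

lemma coord_\<nu> [measurable]: "(\<lambda>\<omega>. \<omega> i) \<in> P \<rightarrow>\<^sub>M \<nu>"
  unfolding P_def by (rule measurable_component_singleton) simp

lemma \<nu>_borel: "f \<in> borel_measurable borel \<Longrightarrow> f \<in> borel_measurable \<nu>"
  unfolding measurable_cong_sets[OF sets_\<nu> refl] by (rule measurable_restrict_space1)

lemma coord_borel [measurable]: "(\<lambda>\<omega>. \<omega> i) \<in> borel_measurable P"
  by (rule measurable_compose[OF coord_\<nu>]) (rule \<nu>_borel, simp)

lemma shift_P [measurable]: "shift m \<in> P \<rightarrow>\<^sub>M P"
proof -
  have "shift m \<in> P \<rightarrow>\<^sub>M (\<Pi>\<^sub>M i\<in>(UNIV :: int set). \<nu>)"
    unfolding shift_def[abs_def] by (rule measurable_PiM_single') (auto simp: space_P space_\<nu> PiE_def Pi_def)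
  then show ?thesis unfolding P_def .
qed

lemma shift_space_P: "\<omega> \<in> space P \<Longrightarrow> shift m \<omega> \<in> space P"
  using measurable_space[OF shift_P] .

lemma distr_shift: "distr P P (shift m) = P"
proof -
  have "distr (Pi\<^sub>M UNIV (\<lambda>_. \<nu>)) (\<Pi>\<^sub>M i\<in>(UNIV :: int set). \<nu>) (\<lambda>\<omega>. \<lambda>n\<in>UNIV. \<omega> (n + m)) = (\<Pi>\<^sub>M i\<in>UNIV. \<nu>)"
    by (rule distr_PiM_reindex[of UNIV "\<lambda>_. \<nu>" "\<lambda>n. n + m" UNIV]) (auto simp: prob_\<nu> inj_on_def)
  then show ?thesis unfolding P_def shift_def[abs_def] restrict_UNIV .
qed

lemma measure_shift:
  assumes "{\<omega> \<in> space P. Q \<omega>} \<in> sets P"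
  shows "measure P {\<omega> \<in> space P. Q (shift m \<omega>)} = measure P {\<omega> \<in> space P. Q \<omega>}"
proof -
  have "measure P {\<omega> \<in> space P. Q \<omega>} = measure (distr P P (shift m)) {\<omega> \<in> space P. Q \<omega>}"
    by (simp add: distr_shift)
  also have "\<dots> = measure P (shift m -` {\<omega> \<in> space P. Q \<omega>} \<inter> space P)"
    by (rule measure_distr) (use assms in auto)
  also have "shift m -` {\<omega> \<in> space P. Q \<omega>} \<inter> space P = {\<omega> \<in> space P. Q (shift m \<omega>)}"
    using shift_space_P by auto
  finally show ?thesis by simp
qed

lemma indep_coords: "P.indep_vars (\<lambda>_. \<nu>) (\<lambda>i \<omega>. \<omega> i) (UNIV :: int set)"
proof (subst P.indep_vars_iff_distr_eq_PiM')
  have e: "(\<lambda>\<omega>. \<lambda>i\<in>UNIV. \<omega> i) = (\<lambda>\<omega>::int\<Rightarrow>real. \<omega>)" by (simp add: fun_eq_iff)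
  have d: "distr P \<nu> (\<lambda>\<omega>. \<omega> i) = \<nu>" for i
    unfolding P_def by (rule distr_PiM_component) (auto simp: prob_\<nu>)
  show "distr P (\<Pi>\<^sub>M i\<in>UNIV. \<nu>) (\<lambda>\<omega>. \<lambda>i\<in>UNIV. \<omega> i) = (\<Pi>\<^sub>M i\<in>UNIV. distr P \<nu> (\<lambda>\<omega>. \<omega> i))"
    unfolding e d P_def[symmetric] by (rule distr_id2) simp
qed auto

definition pr :: "real \<Rightarrow> real" where "pr s = measure \<nu> ({..s} \<inter> space \<nu>)"

lemma Iic_\<nu>: "{..s} \<inter> space \<nu> \<in> sets \<nu>"
  unfolding sets_\<nu> space_\<nu> by (auto simp: sets_restrict_space)

lemma cnt_sum: "real (cnt s n \<omega>) = (\<Sum>i\<in>int ` {..<n}. indicator {..s} (\<omega> i))"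
proof -
  have "(\<Sum>i\<in>int ` {..<n}. indicator {..s} (\<omega> i)) = (\<Sum>k<n. indicator {..s} (\<omega> (int k)) :: real)"
    by (subst sum.reindex) (auto simp: inj_on_def)
  also have "\<dots> = (\<Sum>k<n. if \<omega> (int k) \<le> s then 1 else 0)"
    by (intro sum.cong) (auto simp: indicator_def)
  also have "\<dots> = real (cnt s n \<omega>)"
    by (simp add: cnt_def sum.If_cases) (intro arg_cong[where f=card], auto)
  finally show ?thesis by simp
qed

lemma cnt_measurable [measurable]: "(\<lambda>\<omega>. real (cnt s n \<omega>)) \<in> borel_measurable P"
  unfolding cnt_sum by measurable

lemma cnt_tail:
  assumes n: "1 \<le> n" and s: "0 \<le> pr s"
  shows "measure P {\<omega> \<in> space P. real (cnt s n \<omega>) < pr s * real n / 2} \<le> exp (- ((pr s)\<^sup>2 / 2) * real n)"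
proof -
  define X where "X = (\<lambda>(i::int) (\<omega>::int\<Rightarrow>real). indicator {..s} (\<omega> i) :: real)"
  let ?I = "int ` {..<n}"
  have ind: "(indicator {..s} :: real \<Rightarrow> real) \<in> borel_measurable \<nu>" by (rule \<nu>_borel) simp
  have dX: "distr P borel (X i) = distr \<nu> borel (indicator {..s})" for i
  proof -
    have "distr \<nu> borel (indicator {..s} :: real \<Rightarrow> real) = distr (distr P \<nu> (\<lambda>\<omega>. \<omega> i)) borel (indicator {..s})"
      unfolding P_def by (subst distr_PiM_component) (auto simp: prob_\<nu>)
    also have "\<dots> = distr P borel (X i)"
      by (subst distr_distr[OF ind coord_\<nu>]) (simp add: X_def comp_def)
    finally show ?thesis ..
  qed
  have mX: "X i \<in> borel_measurable P" for i unfolding X_def by measurable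
  have EX: "P.expectation (X 0) = pr s"
  proof -
    have "P.expectation (X 0) = (\<integral>x. x \<partial>distr P borel (X 0))" using mX by (simp add: integral_distr)
    also have "\<dots> = (\<integral>x. indicator {..s} x \<partial>\<nu>)" unfolding dX using ind by (simp add: integral_distr)
    also have "\<dots> = (\<integral>x. indicator ({..s} \<inter> space \<nu>) x \<partial>\<nu>)"
      by (intro Bochner_Integration.integral_cong) (auto simp: indicator_def)
    also have "\<dots> = pr s" unfolding pr_def using Iic_\<nu>[of s] by simp
    finally show ?thesis .
  qed
  interpret H: Hoeffding_ineq_iid P ?I X "X 0" 0 1 "P.expectation (X 0)"
  proof unfold_locales
    have "P.indep_vars (\<lambda>_. borel) (\<lambda>i \<omega>. indicator {..s} (\<omega> i) :: real) (UNIV :: int set)"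
      by (rule P.indep_vars_compose2[OF indep_coords, of "\<lambda>_. indicator {..s}"]) (use ind in auto)
    then show "P.indep_vars (\<lambda>_. borel) X ?I" unfolding X_def by (rule P.indep_vars_subset) simp
  qed (use mX dX in \<open>auto simp: X_def indicator_def\<close>)
  have c: "card ?I = n" by (simp add: card_image)
  have "measure P {\<omega> \<in> space P. real (cnt s n \<omega>) < pr s * real n / 2} \<le>
     measure P {\<omega> \<in> space P. (\<Sum>i\<in>?I. X i \<omega>) \<le> real (card ?I) * pr s - real n * pr s / 2}"
    by (rule P.finite_measure_mono) (auto simp: c cnt_sum X_def mult.commute[of "pr s"])
  also have "\<dots> \<le> exp (- 2 * (real n * pr s / 2)\<^sup>2 / (real (card ?I) * (1 - 0)\<^sup>2))"
    using H.Hoeffding_ineq_le[of "real n * pr s / 2"] s n unfolding EX by (simp add: lessThan_empty_iff)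
  also have "- 2 * (real n * pr s / 2)\<^sup>2 / (real (card ?I) * (1 - 0)\<^sup>2) = - ((pr s)\<^sup>2 / 2) * real n"
    unfolding c using n by (simp add: power2_eq_square field_simps)
  finally show ?thesis .
qed

lemma good_measurable [measurable]: "Measurable.pred P (good s p T)"
  unfolding good_def[abs_def] by measurable

lemma measure_countable_Un:
  fixes A :: "nat \<Rightarrow> (int \<Rightarrow> real) set"
  assumes "\<And>i. A i \<in> sets P" "\<And>i. measure P (A i) \<le> f i" "summable f"
  shows "measure P (\<Union>i. A i) \<le> suminf f"
proof -
  have s: "summable (\<lambda>i. measure P (A i))"
    by (rule summable_comparison_test'[OF assms(3), of 0]) (use assms in auto)
  have "measure P (\<Union>i. A i) \<le> (\<Sum>i. measure P (A i))"
    by (rule P.finite_measure_subadditive_countably[OF _ s]) (use assms in auto)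
  also have "\<dots> \<le> suminf f" by (intro suminf_le assms s)
  finally show ?thesis .
qed

lemma good_tail:
  assumes p: "0 < pr s"
  shows "\<exists>K\<ge>0. \<forall>T\<ge>1. measure P {\<omega> \<in> space P. \<not> good s (pr s) T \<omega>} \<le> K * exp (- ((pr s)\<^sup>2 / 2) * real T)"
proof -
  define c where "c = (pr s)\<^sup>2 / 2"
  have c: "0 < c" using p by (simp add: c_def)
  have r: "0 \<le> exp (- c)" "exp (- c) < 1" using c by auto
  show ?thesis
  proof (intro exI[of _ "1 / (1 - exp (- c))"] conjI allI impI)
    fix T :: nat assume T: "1 \<le> T"
    define A where "A j = {\<omega> \<in> space P. real (cnt s (T + j) (shift (- int j) \<omega>)) < pr s * real (T + j) / 2}" for j
    have e: "exp (- c * real (T + j)) = exp (- c * real T) * exp (- c) ^ j" for j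
      by (simp add: exp_add[symmetric] exp_of_nat_mult[symmetric] algebra_simps)
    have "measure P {\<omega> \<in> space P. \<not> good s (pr s) T \<omega>} = measure P (\<Union>j. A j)"
      by (intro arg_cong[where f="measure P"]) (auto simp: A_def good_def not_le)
    also have "\<dots> \<le> (\<Sum>j. exp (- c * real T) * exp (- c) ^ j)"
    proof (rule measure_countable_Un)
      show "A j \<in> sets P" for j unfolding A_def by measurable
      have "{\<omega> \<in> space P. real (cnt s (T + j) \<omega>) < pr s * real (T + j) / 2} \<in> sets P" for j by measurable
      then have "measure P (A j) = measure P {\<omega> \<in> space P. real (cnt s (T + j) \<omega>) < pr s * real (T + j) / 2}" for j
        unfolding A_def by (rule measure_shift)
      moreover have "measure P {\<omega> \<in> space P. real (cnt s (T + j) \<omega>) < pr s * real (T + j) / 2} \<le> exp (- c * real (T + j))" for j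
        unfolding c_def by (rule cnt_tail) (use T p in auto)
      ultimately show "measure P (A j) \<le> exp (- c * real T) * exp (- c) ^ j" for j
        unfolding e[symmetric] by (simp only:)
      show "summable (\<lambda>j. exp (- c * real T) * exp (- c) ^ j)"
        by (intro summable_mult summable_geometric) (use r in simp)
    qed
    also have "\<dots> = exp (- c * real T) * (1 / (1 - exp (- c)))"
      using r by (subst suminf_mult) (auto simp: suminf_geometric summable_geometric)
    finally show "measure P {\<omega> \<in> space P. \<not> good s (pr s) T \<omega>} \<le> 1 / (1 - exp (- c)) * exp (- ((pr s)\<^sup>2 / 2) * real T)"
      by (simp add: c_def mult.commute)
  qed (use r in simp)
qed

definition allgood :: "real \<Rightarrow> real \<Rightarrow> nat \<Rightarrow> (int \<Rightarrow> real) \<Rightarrow> bool" where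
  "allgood s v n \<omega> \<longleftrightarrow> (\<forall>i\<in>{- int n..int n}. good s (pr s) (Tn v n) (shift i \<omega>))"

lemma allgood_measurable [measurable]: "Measurable.pred P (allgood s v n)"
proof -
  have [measurable]: "Measurable.pred P (\<lambda>\<omega>. good s (pr s) (Tn v n) (shift i \<omega>))" for i
    by (rule measurable_compose[OF shift_P good_measurable])
  show ?thesis unfolding allgood_def[abs_def] by (rule pred_intros_finite) auto
qed

lemma allgood_tail:
  assumes p: "0 < pr s" and v: "0 < v"
  shows "\<exists>K c. 0 \<le> K \<and> 0 < c \<and> (\<forall>k\<ge>1. measure P {\<omega> \<in> space P. \<not> (\<forall>n\<ge>k. allgood s v n \<omega>)} \<le> K * exp (- c * real k powr v))"
proof -
  define c where "c = (pr s)\<^sup>2 / 2"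
  have c: "0 < c" using p by (simp add: c_def)
  obtain K where K: "0 \<le> K" "\<And>T. 1 \<le> T \<Longrightarrow> measure P {\<omega> \<in> space P. \<not> good s (pr s) T \<omega>} \<le> K * exp (- c * real T)"
    using good_tail[OF p] unfolding c_def by blast
  define f where "f n = (2 * real n + 1) * exp (- (c/4) * real n powr v)" for n
  have "summable f"
  proof (rule summable_comparison_test_ev)
    have "(\<lambda>n. (2 * real n + 1) * exp (- (c/4) * real n powr v) * real n ^ 2) \<longlonglongrightarrow> 0"
      using c v by real_asymp
    then have "\<forall>\<^sub>F n in sequentially. (2 * real n + 1) * exp (- (c/4) * real n powr v) * real n ^ 2 < 1"
      by (rule order_tendstoD) simp
    then show "\<forall>\<^sub>F n in sequentially. norm (f n) \<le> 1 / real n ^ 2"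
      using eventually_gt_at_top[of 0] by eventually_elim (simp add: f_def field_simps)
    show "summable (\<lambda>n. 1 / real n ^ 2)" using inverse_power_summable[of 2, where 'a=real] by (simp add: field_simps)
  qed
  have one: "measure P {\<omega> \<in> space P. \<not> allgood s v n \<omega>} \<le> K * exp (- (c/4) * real k powr v) * f n" if k: "1 \<le> k" "k \<le> n" for k n
  proof -
    have n: "1 \<le> n" using k by simp
    note t = Tn_bounds[OF v n]
    have m: "measure P {\<omega> \<in> space P. \<not> good s (pr s) (Tn v n) (shift i \<omega>)} \<le> K * exp (- c * real (Tn v n))" for i
    proof -
      have "{\<omega> \<in> space P. \<not> good s (pr s) (Tn v n) \<omega>} \<in> sets P" by measurable
      from measure_shift[OF this, of i] show ?thesis using K(2)[OF t(1)] by simp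
    qed
    have mm: "{\<omega> \<in> space P. \<not> good s (pr s) (Tn v n) (shift i \<omega>)} \<in> sets P" for i
    proof -
      have [measurable]: "Measurable.pred P (\<lambda>\<omega>. good s (pr s) (Tn v n) (shift i \<omega>))"
        by (rule measurable_compose[OF shift_P good_measurable])
      show ?thesis by measurable
    qed
    have "{\<omega> \<in> space P. \<not> allgood s v n \<omega>} = (\<Union>i\<in>{- int n..int n}. {\<omega> \<in> space P. \<not> good s (pr s) (Tn v n) (shift i \<omega>)})"
      by (auto simp: allgood_def)
    also have "measure P \<dots> \<le> (\<Sum>i\<in>{- int n..int n}. measure P {\<omega> \<in> space P. \<not> good s (pr s) (Tn v n) (shift i \<omega>)})"
      by (rule P.finite_measure_subadditive_finite) (use mm in auto)
    also have "\<dots> \<le> (\<Sum>i\<in>{- int n..int n}. K * exp (- c * real (Tn v n)))" by (intro sum_mono m)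
    also have "\<dots> = (2 * real n + 1) * (K * exp (- c * real (Tn v n)))" by simp
    also have "\<dots> \<le> (2 * real n + 1) * (K * (exp (- (c/4) * real n powr v) * exp (- (c/4) * real k powr v)))"
    proof (intro mult_left_mono K(1))
      have "real k powr v \<le> real n powr v" using k v by (intro powr_mono2) auto
      then have "real n powr v + real k powr v \<le> 4 * real (Tn v n)" using t(4) by simp
      then have "(c / 4) * (real n powr v + real k powr v) \<le> (c / 4) * (4 * real (Tn v n))"
        using c by (intro mult_left_mono) auto
      then show "exp (- c * real (Tn v n)) \<le> exp (- (c/4) * real n powr v) * exp (- (c/4) * real k powr v)"
        unfolding exp_add[symmetric] by (simp add: algebra_simps)
    qed simp
    finally show ?thesis by (simp add: f_def mult_ac)
  qed
  show ?thesis
  proof (intro exI conjI allI impI)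
    show "0 \<le> K * suminf f" using K \<open>summable f\<close> by (intro mult_nonneg_nonneg suminf_nonneg) (auto simp: f_def)
    show "0 < c / 4" using c by simp
    fix k :: nat assume k: "1 \<le> k"
    let ?e = "K * exp (- (c/4) * real k powr v)"
    have "{\<omega> \<in> space P. \<not> (\<forall>n\<ge>k. allgood s v n \<omega>)} = (\<Union>n. {\<omega> \<in> space P. k \<le> n \<and> \<not> allgood s v n \<omega>})" by auto
    also have "measure P \<dots> \<le> (\<Sum>n. ?e * f n)"
    proof (rule measure_countable_Un)
      show "{\<omega> \<in> space P. k \<le> n \<and> \<not> allgood s v n \<omega>} \<in> sets P" for n by measurable
      show "measure P {\<omega> \<in> space P. k \<le> n \<and> \<not> allgood s v n \<omega>} \<le> ?e * f n" for n
      proof (cases "k \<le> n")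
        case True
        then show ?thesis using one[OF k True] by simp
      next
        case False
        then show ?thesis using K by (simp add: f_def)
      qed
      show "summable (\<lambda>n. ?e * f n)" using \<open>summable f\<close> by (rule summable_mult)
    qed
    also have "\<dots> = ?e * suminf f" using \<open>summable f\<close> by (rule suminf_mult)
    finally show "measure P {\<omega> \<in> space P. \<not> (\<forall>n\<ge>k. allgood s v n \<omega>)} \<le> K * suminf f * exp (- (c/4) * real k powr v)"
      by (simp add: mult_ac)
  qed
qed

end

lemma (in prob_space) integral_le_const_nonneg:
  fixes f :: "'a \<Rightarrow> real"
  assumes "AE x in M. f x \<le> C" "0 \<le> C"
  shows "(\<integral>x. f x \<partial>M) \<le> C"
proof (cases "integrable M f")
  case True
  have "(\<integral>x. f x \<partial>M) \<le> (\<integral>x. C \<partial>M)" by (rule integral_mono_AE) (use True assms in auto)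
  then show ?thesis by (simp add: prob_space)
qed (use assms in \<open>simp add: not_integrable_integral_eq\<close>)

lemma sum_powr_le_sqrt:
  fixes \<theta> :: real
  assumes "0 < \<theta>"
  shows "(\<Sum>k=1..l. real k powr (- \<theta>)) \<le> sqrt (real l) + real l * real l powr (- \<theta> / 2)"
proof -
  have "(\<Sum>k=1..l. real k powr (- \<theta>)) \<le> (\<Sum>k=1..l. (if real k \<le> sqrt (real l) then 1 else 0) + real l powr (- \<theta> / 2))"
  proof (rule sum_mono)
    fix k assume k: "k \<in> {1..l}"
    show "real k powr (- \<theta>) \<le> (if real k \<le> sqrt (real l) then 1 else 0) + real l powr (- \<theta> / 2)"
    proof (cases "real k \<le> sqrt (real l)")
      case True
      have "real k powr (- \<theta>) \<le> 1" using k assms powr_mono2'[of "-\<theta>" 1 "real k"] by simp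
      then show ?thesis using True by (simp add: add_increasing2)
    next
      case False
      have l: "0 < real l" using k by simp
      have "real k powr (- \<theta>) \<le> sqrt (real l) powr (- \<theta>)"
        using False assms l by (intro powr_mono2') auto
      also have "\<dots> = real l powr (- \<theta> / 2)" using l by (simp add: powr_half_sqrt[symmetric] powr_powr)
      finally show ?thesis using False by simp
    qed
  qed
  also have "\<dots> = real (card {k \<in> {1..l}. real k \<le> sqrt (real l)}) + real l * real l powr (- \<theta> / 2)"
    by (simp add: sum.distrib sum.If_cases Int_def conj_commute)
  also have "card {k \<in> {1..l}. real k \<le> sqrt (real l)} \<le> card {1..nat \<lfloor>sqrt (real l)\<rfloor>}"
    by (rule card_mono) (auto simp: le_nat_floor)
  also have "real (card {1..nat \<lfloor>sqrt (real l)\<rfloor>}) \<le> sqrt (real l)"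
    by simp
  finally show ?thesis by simp
qed

context lsv_random begin

lemma lsv_x_const_le:
  assumes "1 \<le> k"
  shows "0 < lsv_x k (\<lambda>_. \<alpha>\<^sub>0)" "lsv_x k (\<lambda>_. \<alpha>\<^sub>0) \<le> 1/2" "lsv_x k (\<lambda>_. \<alpha>\<^sub>0) \<le> (\<alpha>\<^sub>0 / 2) powr (- 1 / \<alpha>\<^sub>0) * real k powr (- 1 / \<alpha>\<^sub>0)"
proof -
  have w: "adm \<alpha>\<^sub>0 (\<lambda>_. \<alpha>\<^sub>0)" using \<alpha> by (simp add: adm_def)
  show "0 < lsv_x k (\<lambda>_. \<alpha>\<^sub>0)" using lsv_x_bounds[OF w] by auto
  obtain j where j: "k = Suc j" using assms by (cases k) auto
  show "lsv_x k (\<lambda>_. \<alpha>\<^sub>0) \<le> 1/2"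
    unfolding j lsv_x_Suc[OF w] using gl_props[of \<alpha>\<^sub>0 "lsv_x j (shift 1 (\<lambda>_. \<alpha>\<^sub>0))"] lsv_x_bounds[OF adm_shift[OF w]] \<alpha> by auto
  have "lsv_x k (\<lambda>_. \<alpha>\<^sub>0) \<le> (\<alpha>\<^sub>0 / 2 * real k) powr (- 1 / \<alpha>\<^sub>0)"
    by (rule lsv_x_le_cnt[OF w]) (use \<alpha> assms in \<open>auto simp: cnt_all\<close>)
  then show "lsv_x k (\<lambda>_. \<alpha>\<^sub>0) \<le> (\<alpha>\<^sub>0 / 2) powr (- 1 / \<alpha>\<^sub>0) * real k powr (- 1 / \<alpha>\<^sub>0)"
    unfolding powr_mult .
qed

text \<open>The averages of \<open>E A\<^sub>k\<close> only enter through this lemma: they would decay polynomially if \<open>\<alpha>\<^sub>0\<close>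
  were not in the support of \<open>\<nu>\<close>.\<close>

lemma support:
  assumes c: "0 < c" and lim: "(\<lambda>l. ln (real l) powr q / real l * (\<Sum>k=1..l. \<integral>\<omega>. lsv_A \<alpha>\<^sub>0 \<alpha>\<^sub>1 l k \<omega> \<partial>P)) \<longlonglongrightarrow> c"
    and s: "\<alpha>\<^sub>0 < s"
  shows "0 < pr s"
proof (rule ccontr)
  assume "\<not> 0 < pr s"
  then have p0: "measure \<nu> ({..s} \<inter> space \<nu>) = 0" by (simp add: pr_def zero_less_measure_iff)
  have AE\<nu>: "AE x in \<nu>. s < x"
  proof -
    have "emeasure \<nu> ({..s} \<inter> space \<nu>) = 0" using p0 by (simp add: nu.emeasure_eq_measure)
    then have "{..s} \<inter> space \<nu> \<in> null_sets \<nu>" using Iic_\<nu> by auto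
    then show ?thesis by (rule AE_I') auto
  qed
  have AEP: "AE \<omega> in P. s < \<omega> i" for i
    unfolding P_def by (rule AE_PiM_component) (use AE\<nu> prob_\<nu> in auto)
  define \<theta> where "\<theta> = (s - \<alpha>\<^sub>0) / \<alpha>\<^sub>0"
  have \<theta>: "0 < \<theta>" using s \<alpha> by (simp add: \<theta>_def)
  define Q where "Q = \<alpha>\<^sub>0 * 2 powr \<alpha>\<^sub>0 * (2 * (\<alpha>\<^sub>0 / 2) powr (- 1 / \<alpha>\<^sub>0)) powr (s - \<alpha>\<^sub>0)"
  have Q: "0 \<le> Q" using \<alpha> by (simp add: Q_def)
  have bound: "(\<integral>\<omega>. lsv_A \<alpha>\<^sub>0 \<alpha>\<^sub>1 l k \<omega> \<partial>P) \<le> Q * real k powr (- \<theta>)" if k: "1 \<le> k" for k l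
  proof (rule P.integral_le_const_nonneg)
    show "AE \<omega> in P. lsv_A \<alpha>\<^sub>0 \<alpha>\<^sub>1 l k \<omega> \<le> Q * real k powr (- \<theta>)"
      using AEP[of "int l - int k"]
    proof eventually_elim
      case (elim \<omega>)
      define a where "a = shift (int l - int k) \<omega> 0"
      have a: "s < a" using elim by (simp add: a_def shift_def)
      define x where "x = lsv_x k (\<lambda>_. \<alpha>\<^sub>0)"
      note x = lsv_x_const_le[OF k, folded x_def]
      have cx: "lsv_c k \<alpha>\<^sub>0 / real k powr (1 / \<alpha>\<^sub>0) = x" using k by (simp add: lsv_c_def x_def)
      have "lsv_A \<alpha>\<^sub>0 \<alpha>\<^sub>1 l k \<omega> \<le> \<alpha>\<^sub>0 * 2 powr \<alpha>\<^sub>0 * (2 * x) powr (a - \<alpha>\<^sub>0)"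
      proof (cases "k \<le> 1")
        case True
        then show ?thesis using \<alpha> by (simp add: lsv_A_def)
      next
        case False
        have "2 * lsv_c k \<alpha>\<^sub>0 / real k powr (1 / \<alpha>\<^sub>0) = 2 * x" using cx by simp
        moreover have "0 \<le> (1 + \<alpha>\<^sub>0) / 2 * \<alpha>\<^sub>0 * 2 powr \<alpha>\<^sub>0
            * (2 * lsv_c k \<alpha>\<^sub>1 / real k powr (1 / \<alpha>\<^sub>1)) powr (2 * a - \<alpha>\<^sub>0)"
          using \<alpha> by (intro mult_nonneg_nonneg) auto
        ultimately show ?thesis using False by (simp add: lsv_A_def Let_def a_def)
      qed
      also have "(2 * x) powr (a - \<alpha>\<^sub>0) \<le> (2 * x) powr (s - \<alpha>\<^sub>0)"
        using x a by (intro powr_mono') auto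
      also have "(2 * x) powr (s - \<alpha>\<^sub>0) \<le> (2 * ((\<alpha>\<^sub>0 / 2) powr (- 1 / \<alpha>\<^sub>0) * real k powr (- 1 / \<alpha>\<^sub>0))) powr (s - \<alpha>\<^sub>0)"
        using x s by (intro powr_mono2) auto
      also have "\<dots> = (2 * (\<alpha>\<^sub>0 / 2) powr (- 1 / \<alpha>\<^sub>0)) powr (s - \<alpha>\<^sub>0) * real k powr (- \<theta>)"
      proof -
        have "- 1 / \<alpha>\<^sub>0 * (s - \<alpha>\<^sub>0) = - \<theta>" by (simp add: \<theta>_def)
        then show ?thesis unfolding mult.assoc[symmetric, of 2] powr_mult[of _ "real k powr (- 1 / \<alpha>\<^sub>0)"] powr_powr by simp
      qed
      finally show ?case using \<alpha> by (simp add: Q_def mult_ac mult_left_mono)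
    qed
  qed (use Q in simp)
  have lnq: "(\<lambda>l::nat. ln (real l) powr q * real l powr (- t)) \<longlonglongrightarrow> 0" if t: "0 < t" for t
  proof -
    define m where "m = max q 1"
    have m: "0 < m" by (simp add: m_def)
    show ?thesis
    proof (rule Lim_null_comparison)
      show "\<forall>\<^sub>F l::nat in sequentially. norm (ln (real l) powr q * real l powr (- t)) \<le> ln (real l) powr m * real l powr (- t)"
      proof -
        have "filterlim (\<lambda>l::nat. ln (real l)) at_top sequentially" by real_asymp
        then have "\<forall>\<^sub>F l::nat in sequentially. 1 \<le> ln (real l)" by (simp add: filterlim_at_top)
        then show ?thesis
          by eventually_elim (auto simp: abs_mult m_def intro!: mult_right_mono powr_mono)
      qed
      show "(\<lambda>l::nat. ln (real l) powr m * real l powr (- t)) \<longlonglongrightarrow> 0" using m t by real_asymp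
    qed
  qed
  have "(\<lambda>l. Q * (ln (real l) powr q * real l powr (- (1/2)) + ln (real l) powr q * real l powr (- (\<theta> / 2)))) \<longlonglongrightarrow> Q * (0 + 0)"
    by (intro tendsto_intros lnq) (use \<theta> in auto)
  moreover have "\<exists>N. \<forall>n\<ge>N. ln (real n) powr q / real n * (\<Sum>k=1..n. \<integral>\<omega>. lsv_A \<alpha>\<^sub>0 \<alpha>\<^sub>1 n k \<omega> \<partial>P) \<le>
      Q * (ln (real n) powr q * real n powr (- (1/2)) + ln (real n) powr q * real n powr (- (\<theta> / 2)))"
  proof (intro exI[of _ 1] allI impI)
    fix n :: nat assume n: "1 \<le> n"
    have "(\<Sum>k=1..n. \<integral>\<omega>. lsv_A \<alpha>\<^sub>0 \<alpha>\<^sub>1 n k \<omega> \<partial>P) \<le> (\<Sum>k=1..n. Q * real k powr (- \<theta>))"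
      by (intro sum_mono bound) auto
    also have "\<dots> \<le> Q * (sqrt (real n) + real n * real n powr (- \<theta> / 2))"
      unfolding sum_distrib_left[symmetric] by (intro mult_left_mono sum_powr_le_sqrt \<theta> Q)
    finally have "ln (real n) powr q / real n * (\<Sum>k=1..n. \<integral>\<omega>. lsv_A \<alpha>\<^sub>0 \<alpha>\<^sub>1 n k \<omega> \<partial>P) \<le>
        ln (real n) powr q / real n * (Q * (sqrt (real n) + real n * real n powr (- \<theta> / 2)))"
      by (intro mult_left_mono) auto
    also have "\<dots> = Q * (ln (real n) powr q * (sqrt (real n) / real n) + ln (real n) powr q * real n powr (- (\<theta> / 2)))"
      using n by (simp add: field_simps)
    also have "sqrt (real n) / real n = real n powr (- (1/2))"
      using n by (simp add: powr_minus powr_half_sqrt real_div_sqrt field_simps)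
    finally show "ln (real n) powr q / real n * (\<Sum>k=1..n. \<integral>\<omega>. lsv_A \<alpha>\<^sub>0 \<alpha>\<^sub>1 n k \<omega> \<partial>P) \<le>
      Q * (ln (real n) powr q * real n powr (- (1/2)) + ln (real n) powr q * real n powr (- (\<theta> / 2)))" .
  qed
  ultimately have "c \<le> Q * (0 + 0)" by (rule LIMSEQ_le[OF lim])
  then show False using c by simp
qed

definition loss_rate :: "real \<Rightarrow> real \<Rightarrow> real \<Rightarrow> real \<Rightarrow> real \<Rightarrow> bool" where
  "loss_rate \<eta> \<kappa> s v D \<longleftrightarrow> (\<forall>\<omega> n \<psi> B H. \<omega> \<in> space P \<longrightarrow> 1 \<le> n \<longrightarrow> (\<forall>i\<le>n. good s (pr s) (Tn v n) (shift (int i) \<omega>)) \<longrightarrow>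
       \<psi> \<in> borel_measurable U \<longrightarrow> 0 \<le> H \<longrightarrow> (\<forall>x. 0 < x \<longrightarrow> x \<le> 1 \<longrightarrow> 0 \<le> \<psi> x \<and> \<psi> x \<le> B) \<longrightarrow>
       (\<forall>x y. 0 < x \<longrightarrow> x \<le> 1 \<longrightarrow> 0 < y \<longrightarrow> y \<le> 1 \<longrightarrow> \<bar>\<psi> x - \<psi> y\<bar> \<le> H * \<bar>x - y\<bar> powr \<eta>) \<longrightarrow>
       integrable U (\<lambda>x. Lit n \<omega> (\<lambda>x. \<psi> x * hinv \<omega> x) x - mass (\<lambda>x. \<psi> x * hinv \<omega> x) * hinv (shift (int n) \<omega>) x) \<and>
       (\<integral>x. \<bar>Lit n \<omega> (\<lambda>x. \<psi> x * hinv \<omega> x) x - mass (\<lambda>x. \<psi> x * hinv \<omega> x) * hinv (shift (int n) \<omega>) x\<bar> \<partial>U)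
         \<le> (B + H) * D * real n powr (- \<kappa>))"

lemma loss_rateD:
  assumes "loss_rate \<eta> \<kappa> s v D" "\<omega> \<in> space P" "1 \<le> n" "\<And>i. i \<le> n \<Longrightarrow> good s (pr s) (Tn v n) (shift (int i) \<omega>)"
    "\<psi> \<in> borel_measurable U" "0 \<le> H" "\<And>x. 0 < x \<Longrightarrow> x \<le> 1 \<Longrightarrow> 0 \<le> \<psi> x \<and> \<psi> x \<le> B"
    "\<And>x y. 0 < x \<Longrightarrow> x \<le> 1 \<Longrightarrow> 0 < y \<Longrightarrow> y \<le> 1 \<Longrightarrow> \<bar>\<psi> x - \<psi> y\<bar> \<le> H * \<bar>x - y\<bar> powr \<eta>"
  shows "integrable U (\<lambda>x. Lit n \<omega> (\<lambda>x. \<psi> x * hinv \<omega> x) x - mass (\<lambda>x. \<psi> x * hinv \<omega> x) * hinv (shift (int n) \<omega>) x)"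
    and "(\<integral>x. \<bar>Lit n \<omega> (\<lambda>x. \<psi> x * hinv \<omega> x) x - mass (\<lambda>x. \<psi> x * hinv \<omega> x) * hinv (shift (int n) \<omega>) x\<bar> \<partial>U)
         \<le> (B + H) * D * real n powr (- \<kappa>)"
  using assms(1)[unfolded loss_rate_def, rule_format, OF assms(2-)] by auto

lemma quenched_loss:
  assumes supp: "\<And>s. \<alpha>\<^sub>0 < s \<Longrightarrow> 0 < pr s" and \<delta>: "0 < \<delta>" and \<eta>: "0 < \<eta>"
  shows "\<exists>s v K c D. 0 < v \<and> v < 1 \<and> 0 \<le> K \<and> 0 < c \<and> 0 \<le> D \<and>
    (\<forall>k\<ge>1. measure P {\<omega> \<in> space P. \<not> (\<forall>n\<ge>k. allgood s v n \<omega>)} \<le> K * exp (- c * real k powr v)) \<and>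
    loss_rate \<eta> (1 / \<alpha>\<^sub>0 - \<delta> - 1) s v D"
proof -
  define b where "b = max ((1 + 1 / \<alpha>\<^sub>0) / 2) (1 / \<alpha>\<^sub>0 - \<delta> / 2)"
  have ia: "1 < 1 / \<alpha>\<^sub>0" using \<alpha> by simp
  have b: "1 < b" "b < 1 / \<alpha>\<^sub>0" "1 / \<alpha>\<^sub>0 - \<delta> / 2 \<le> b" using ia \<delta> by (auto simp: b_def less_max_iff_disj)
  define s where "s = 1 / b"
  have s: "0 < s" "s < 1" "1 / s = b" using b by (auto simp: s_def)
  have s2: "\<alpha>\<^sub>0 < s" using b \<alpha> by (simp add: s_def field_simps)
  have p: "0 < pr s" by (rule supp[OF s2])
  define v where "v = max (1/2) ((1 / \<alpha>\<^sub>0 - \<delta>) / b)"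
  have v: "0 < v" "v < 1" using b \<delta> by (auto simp: v_def max_less_iff_conj)
  have "(1 / \<alpha>\<^sub>0 - \<delta>) / b * b \<le> v * b" using b by (intro mult_right_mono) (auto simp: v_def)
  then have vb: "1 - v * b \<le> - (1 / \<alpha>\<^sub>0 - \<delta> - 1)" using b by simp
  define KK where "KK = (s * pr s / 4) powr (- 1 / s) * (1 + 1 / (1 / s - 1))"
  have KK: "0 \<le> KK" using s b by (simp add: KK_def)
  define \<rho> where "\<rho> = 1 - lowc \<alpha>\<^sub>1 / 32"
  have a1: "0 < \<alpha>\<^sub>1" using \<alpha> by simp
  have \<rho>: "0 < \<rho>" "\<rho> < 1" using lowc_pos[OF a1 \<alpha>(3)] lowc_le1[OF a1 \<alpha>(3)] by (auto simp: \<rho>_def)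
  obtain D where D: "0 \<le> D" "\<And>n::nat. 1 \<le> n \<Longrightarrow>
    2 * 2 powr (- \<eta> * real (Mn v n)) + 2 * real (Mn v n) * (KK * real (Tn v n) powr (1 - b)) + 4 * (KK * real (Tn v n) powr (1 - b)) + 2 * \<rho> ^ Mn v n
    \<le> D * real n powr (- (1 / \<alpha>\<^sub>0 - \<delta> - 1))"
    using rate_bound[OF v b(1) vb KK \<rho> \<eta>] by blast
  obtain K c where Kc: "0 \<le> K" "0 < c"
    "\<And>k. 1 \<le> k \<Longrightarrow> measure P {\<omega> \<in> space P. \<not> (\<forall>n\<ge>k. allgood s v n \<omega>)} \<le> K * exp (- c * real k powr v)"
    using allgood_tail[OF p v(1)] by blast
  have "loss_rate \<eta> (1 / \<alpha>\<^sub>0 - \<delta> - 1) s v D"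
    unfolding loss_rate_def
  proof (intro allI impI)
    fix \<omega> and n :: nat and \<psi> :: "real \<Rightarrow> real" and B H
    assume w: "\<omega> \<in> space P" and n: "1 \<le> n" and g': "\<forall>i\<le>n. good s (pr s) (Tn v n) (shift (int i) \<omega>)"
      and \<psi>: "\<psi> \<in> borel_measurable U" and H: "0 \<le> H" and bd': "\<forall>x. 0 < x \<longrightarrow> x \<le> 1 \<longrightarrow> 0 \<le> \<psi> x \<and> \<psi> x \<le> B"
      and ho': "\<forall>x y. 0 < x \<longrightarrow> x \<le> 1 \<longrightarrow> 0 < y \<longrightarrow> y \<le> 1 \<longrightarrow> \<bar>\<psi> x - \<psi> y\<bar> \<le> H * \<bar>x - y\<bar> powr \<eta>"
    note g = g'[rule_format] and bd = bd'[rule_format] and ho = ho'[rule_format]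
    have B: "0 \<le> B" using bd[of 1] by auto
    have le: "Mn v n * Tn v n + Mn v n * Suc (Tn v n) \<le> n"
    proof -
      have "Mn v n * Tn v n + Mn v n * Suc (Tn v n) \<le> Mn v n * (2 * Suc (Tn v n))" by simp
      also have "\<dots> \<le> n" unfolding Mn_def by (rule div_times_less_eq_dividend)
      finally show ?thesis .
    qed
    note core = decay_core[OF adm_P[OF w] s(1,2) p Tn_bounds(1)[OF v(1) n] g le \<eta> H bd ho \<psi>]
    have "(\<integral>x. \<bar>Lit n \<omega> (\<lambda>x. \<psi> x * hinv \<omega> x) x - mass (\<lambda>x. \<psi> x * hinv \<omega> x) * hinv (shift (int n) \<omega>) x\<bar> \<partial>U)
      \<le> (B + H) * (2 * 2 powr (- \<eta> * real (Mn v n)) + 2 * real (Mn v n) * (KK * real (Tn v n) powr (1 - b)) + 4 * (KK * real (Tn v n) powr (1 - b)) + 2 * \<rho> ^ Mn v n)"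
      using core(2) unfolding KK_def \<rho>_def s(3) by simp
    also have "\<dots> \<le> (B + H) * (D * real n powr (- (1 / \<alpha>\<^sub>0 - \<delta> - 1)))"
      using B H by (intro mult_left_mono D(2) n) auto
    finally show "integrable U (\<lambda>x. Lit n \<omega> (\<lambda>x. \<psi> x * hinv \<omega> x) x - mass (\<lambda>x. \<psi> x * hinv \<omega> x) * hinv (shift (int n) \<omega>) x) \<and>
       (\<integral>x. \<bar>Lit n \<omega> (\<lambda>x. \<psi> x * hinv \<omega> x) x - mass (\<lambda>x. \<psi> x * hinv \<omega> x) * hinv (shift (int n) \<omega>) x\<bar> \<partial>U)
         \<le> (B + H) * D * real n powr (- (1 / \<alpha>\<^sub>0 - \<delta> - 1))"
      using core(1) by (simp add: mult.assoc)
  qed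
  then show ?thesis using v Kc D(1) by blast
qed

end

section \<open>The fibre measures and their correlations\<close>

lemma unit_measurable_U:
  assumes "f \<in> borel_measurable unit_lebesgue"
  shows "f \<in> borel_measurable U"
proof -
  have "(\<lambda>x. x) \<in> U \<rightarrow>\<^sub>M unit_lebesgue"
    unfolding U_def by (intro measurable_restrict_space2 measurable_restrict_space1) (auto simp: space_restrict_space)
  from measurable_compose[OF this assms] show ?thesis .
qed

lemma U_measurable_unit:
  fixes f :: "real \<Rightarrow> real"
  assumes "f \<in> borel_measurable U"
  shows "f \<in> borel_measurable unit_lebesgue"
proof -
  define g where "g = (\<lambda>x. indicator {0<..1} x *\<^sub>R f x)"
  have [measurable]: "g \<in> borel_measurable lborel"
    using assms unfolding U_def g_def by (subst (asm) borel_measurable_restrict_space_iff) auto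
  have "(\<lambda>x. if x = 0 then f 0 else g x) \<in> borel_measurable unit_lebesgue"
    by (rule measurable_restrict_space1) measurable
  then show ?thesis
    by (rule measurable_cong[THEN iffD1, rotated]) (auto simp: g_def space_restrict_space)
qed

lemma AE_unit_U: "(AE x in unit_lebesgue. Q x) \<longleftrightarrow> (AE x in U. Q x)"
proof -
  have "(AE x in unit_lebesgue. Q x) \<longleftrightarrow> (AE x in lborel. x \<in> {0..1} \<longrightarrow> Q x)"
    by (subst AE_restrict_space_iff) auto
  also have "\<dots> \<longleftrightarrow> (AE x in lborel. x \<in> {0<..1} \<longrightarrow> Q x)"
    using AE_lborel_singleton[of "0::real"] by (intro iffI; elim AE_mp; auto)
  also have "\<dots> \<longleftrightarrow> (AE x in U. Q x)" unfolding U_def by (subst AE_restrict_space_iff) auto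
  finally show ?thesis .
qed

lemma nn_integral_unit_U: "(\<integral>\<^sup>+x. f x \<partial>unit_lebesgue) = (\<integral>\<^sup>+x. f x \<partial>U)"
proof -
  have "(\<integral>\<^sup>+x. f x \<partial>unit_lebesgue) = (\<integral>\<^sup>+x. f x * indicator {0..1} x \<partial>lborel)"
    by (subst nn_integral_restrict_space) auto
  also have "\<dots> = (\<integral>\<^sup>+x. f x * indicator {0<..1} x \<partial>lborel)"
    by (rule nn_integral_cong_AE) (use AE_lborel_singleton[of "0::real"] in \<open>auto simp: indicator_def elim!: AE_mp\<close>)
  finally show ?thesis by (simp add: nn_integral_U)
qed

lemma integral_unit_U:
  fixes f :: "real \<Rightarrow> real"
  assumes f: "f \<in> borel_measurable U"
  shows "(\<integral>x. f x \<partial>unit_lebesgue) = (\<integral>x. f x \<partial>U)"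
proof -
  have m: "(\<lambda>x. indicator {0<..1} x *\<^sub>R f x) \<in> borel_measurable lborel"
    using f unfolding U_def by (subst (asm) borel_measurable_restrict_space_iff) auto
  have m': "(\<lambda>x. indicator {0..1} x *\<^sub>R f x) \<in> borel_measurable lborel"
    using U_measurable_unit[OF f] by (subst (asm) borel_measurable_restrict_space_iff) auto
  have "(\<integral>x. f x \<partial>unit_lebesgue) = (\<integral>x. indicator {0..1} x *\<^sub>R f x \<partial>lborel)"
    by (subst integral_restrict_space) auto
  also have "\<dots> = (\<integral>x. indicator {0<..1} x *\<^sub>R f x \<partial>lborel)"
  proof (rule integral_cong_AE[OF m' m])
    show "AE x in lborel. indicator {0..1} x *\<^sub>R f x = indicator {0<..1} x *\<^sub>R f x"
      using AE_lborel_singleton[of "0::real"] by eventually_elim (auto simp: indicator_def)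
  qed
  also have "\<dots> = (\<integral>x. f x \<partial>U)" unfolding U_def by (subst integral_restrict_space) auto
  finally show ?thesis .
qed

definition mu :: "(int \<Rightarrow> real) \<Rightarrow> real measure" where
  "mu \<omega> = density unit_lebesgue (\<lambda>x. ennreal (hinv \<omega> x))"

lemma sets_mu: "sets (mu \<omega>) = sets unit_borel"
  by (simp add: mu_def sets_restrict_space)

lemma hinv_unit: "adm \<beta> \<omega> \<Longrightarrow> hinv \<omega> \<in> borel_measurable unit_lebesgue"
  by (intro U_measurable_unit lcone_measurable hinv_lcone)

lemma hinv_nonneg_AE: "adm \<beta> \<omega> \<Longrightarrow> AE x in unit_lebesgue. 0 \<le> hinv \<omega> x"
  unfolding AE_unit_U using lcone_nonneg[OF hinv_lcone, of \<beta> \<omega>] by auto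

lemma integral_mu:
  fixes f :: "real \<Rightarrow> real"
  assumes "adm \<beta> \<omega>" "f \<in> borel_measurable U"
  shows "(\<integral>x. f x \<partial>mu \<omega>) = (\<integral>x. f x * hinv \<omega> x \<partial>U)"
proof -
  have "(\<lambda>x. f x * hinv \<omega> x) \<in> borel_measurable U"
    using assms(2) lcone_measurable[OF hinv_lcone[OF assms(1)]] by simp
  from integral_unit_U[OF this] show ?thesis
    unfolding mu_def integral_density[OF U_measurable_unit[OF assms(2)] hinv_unit[OF assms(1)] hinv_nonneg_AE[OF assms(1)]]
    by (simp add: mult.commute)
qed

lemma nn_integral_mu:
  assumes "adm \<beta> \<omega>" "f \<in> borel_measurable unit_lebesgue"
  shows "(\<integral>\<^sup>+x. f x \<partial>mu \<omega>) = (\<integral>\<^sup>+x. ennreal (hinv \<omega> x) * f x \<partial>U)"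
  unfolding mu_def using hinv_unit[OF assms(1)] assms(2)
  by (subst nn_integral_density) (auto simp: nn_integral_unit_U)

lemma nn_integral_hinv: "adm \<beta> \<omega> \<Longrightarrow> (\<integral>\<^sup>+x. ennreal (hinv \<omega> x) \<partial>U) = 1"
  using mass_hinv[of \<beta> \<omega>] lcone_nonneg[OF hinv_lcone, of \<beta> \<omega>]
  by (subst nn_integral_eq_integral) (auto intro: lcone_integrable hinv_lcone simp: mass_def)

lemma prob_space_mu: "adm \<beta> \<omega> \<Longrightarrow> prob_space (mu \<omega>)"
proof (rule prob_spaceI)
  assume w: "adm \<beta> \<omega>"
  have "emeasure (mu \<omega>) (space (mu \<omega>)) = (\<integral>\<^sup>+x. 1 \<partial>mu \<omega>)" by simp
  also have "\<dots> = 1" using nn_integral_mu[OF w, of "\<lambda>_. 1"] nn_integral_hinv[OF w] by simp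
  finally show "emeasure (mu \<omega>) (space (mu \<omega>)) = 1" .
qed

lemma lsv_unit: "0 < a \<Longrightarrow> lsv a \<in> unit_borel \<rightarrow>\<^sub>M unit_borel"
proof (rule measurable_restrict_space3)
  show "lsv a \<in> borel_measurable borel" unfolding lsv_def[abs_def] by measurable
  assume "0 < a"
  then show "lsv a \<in> {0..1} \<rightarrow> {0..1}"
    using lsv_maps[of a] by (fastforce simp: lsv_def less_eq_real_def)
qed

lemma distr_mu:
  assumes w: "adm \<beta> \<omega>"
  shows "distr (mu \<omega>) unit_borel (rlsv \<omega>) = mu (shift 1 \<omega>)"
proof (rule measure_eqI)
  have a: "0 < \<omega> 0" using admD[OF w] by auto
  have r: "rlsv \<omega> = lsv (\<omega> 0)" by (simp add: rlsv_def)
  have Lu: "lsv (\<omega> 0) \<in> mu \<omega> \<rightarrow>\<^sub>M unit_borel"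
    using lsv_unit[OF a] by (simp add: measurable_cong_sets[OF sets_mu refl])
  show "sets (distr (mu \<omega>) unit_borel (rlsv \<omega>)) = sets (mu (shift 1 \<omega>))" by (simp add: sets_mu)
  fix A assume "A \<in> sets (distr (mu \<omega>) unit_borel (rlsv \<omega>))"
  then have A: "A \<in> sets unit_borel" by simp
  have A0: "indicator A \<in> borel_measurable unit_lebesgue"
    using A by (intro borel_measurable_indicator) (simp add: sets_restrict_space)
  have pre: "indicator (lsv (\<omega> 0) -` A \<inter> space (mu \<omega>)) \<in> borel_measurable unit_lebesgue"
    using measurable_sets[OF Lu A] by (intro borel_measurable_indicator) (simp add: sets_mu sets_restrict_space)
  have h: "hinv \<omega> \<in> borel_measurable U" by (rule lcone_measurable[OF hinv_lcone[OF w]])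
  have hn: "0 \<le> hinv \<omega> x" if "0 < x" "x \<le> 1" for x by (rule lcone_nonneg[OF hinv_lcone[OF w] that])
  have iA: "(\<lambda>x. indicator A x :: ennreal) \<in> borel_measurable U"
    using borel_measurable_indicator unit_measurable_U[OF A0] by simp
  have "emeasure (distr (mu \<omega>) unit_borel (rlsv \<omega>)) A = emeasure (mu \<omega>) (lsv (\<omega> 0) -` A \<inter> space (mu \<omega>))"
    unfolding r by (rule emeasure_distr[OF Lu A])
  also have "\<dots> = (\<integral>\<^sup>+x. indicator (lsv (\<omega> 0) -` A \<inter> space (mu \<omega>)) x \<partial>mu \<omega>)"
    using measurable_sets[OF Lu A] by simp
  also have "\<dots> = (\<integral>\<^sup>+x. ennreal (hinv \<omega> x) * indicator (lsv (\<omega> 0) -` A \<inter> space (mu \<omega>)) x \<partial>U)"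
    by (rule nn_integral_mu[OF w pre])
  also have "\<dots> = (\<integral>\<^sup>+x. ennreal (hinv \<omega> x) * indicator A (lsv (\<omega> 0) x) \<partial>U)"
    by (intro nn_integral_cong) (auto simp: indicator_def mu_def space_restrict_space)
  also have "\<dots> = (\<integral>\<^sup>+x. indicator A x \<partial>distr (density U (\<lambda>x. ennreal (hinv \<omega> x))) U (lsv (\<omega> 0)))"
    using h lsv_U[OF a] iA
    by (subst nn_integral_distr) (auto simp: nn_integral_density measurable_compose[OF lsv_U[OF a] iA])
  also have "\<dots> = (\<integral>\<^sup>+x. indicator A x \<partial>density U (\<lambda>x. ennreal (Lop (\<omega> 0) (hinv \<omega>) x)))"
    by (subst distr_Lop[OF a h hn]) simp_all
  also have "\<dots> = (\<integral>\<^sup>+x. ennreal (Lop (\<omega> 0) (hinv \<omega>) x) * indicator A x \<partial>U)"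
    using Lop_measurable[OF a h] iA by (subst nn_integral_density) auto
  also have "\<dots> = (\<integral>\<^sup>+x. ennreal (hinv (shift 1 \<omega>) x) * indicator A x \<partial>U)"
    by (intro nn_integral_cong) (use Lop_hinv[OF w] in auto)
  also have "\<dots> = (\<integral>\<^sup>+x. indicator A x \<partial>mu (shift 1 \<omega>))"
    by (rule nn_integral_mu[OF adm_shift[OF w] A0, symmetric])
  also have "\<dots> = emeasure (mu (shift 1 \<omega>)) A" using A by (simp add: sets_mu)
  finally show "emeasure (distr (mu \<omega>) unit_borel (rlsv \<omega>)) A = emeasure (mu (shift 1 \<omega>)) A" .
qed

lemma absolutely_continuous_mu: "adm \<beta> \<omega> \<Longrightarrow> absolutely_continuous unit_lebesgue (mu \<omega>)"
  unfolding mu_def using hinv_unit by (intro absolutely_continuousI_density) auto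

lemma bounded_mult_integrable:
  fixes f g :: "'a \<Rightarrow> real"
  assumes "f \<in> borel_measurable M" "integrable M g" "AE x in M. \<bar>f x\<bar> \<le> B"
  shows "integrable M (\<lambda>x. f x * g x)" "\<bar>\<integral>x. f x * g x \<partial>M\<bar> \<le> B * (\<integral>x. \<bar>g x\<bar> \<partial>M)"
proof -
  have *: "AE x in M. \<bar>f x * g x\<bar> \<le> B * \<bar>g x\<bar>"
    using assms(3) by eventually_elim (auto simp: abs_mult intro: mult_right_mono)
  have Bg: "integrable M (\<lambda>x. B * \<bar>g x\<bar>)" using assms(2) by simp
  show i: "integrable M (\<lambda>x. f x * g x)"
  proof (rule Bochner_Integration.integrable_bound[OF Bg])
    show "(\<lambda>x. f x * g x) \<in> borel_measurable M" using assms by simp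
    show "AE x in M. norm (f x * g x) \<le> norm (B * \<bar>g x\<bar>)"
      using * by eventually_elim auto
  qed
  have "\<bar>\<integral>x. f x * g x \<partial>M\<bar> \<le> (\<integral>x. \<bar>f x * g x\<bar> \<partial>M)" by (rule integral_abs_bound)
  also have "\<dots> \<le> (\<integral>x. B * \<bar>g x\<bar> \<partial>M)" by (rule integral_mono_AE) (use i Bg * in auto)
  also have "\<dots> = B * (\<integral>x. \<bar>g x\<bar> \<partial>M)" by simp
  finally show "\<bar>\<integral>x. f x * g x \<partial>M\<bar> \<le> B * (\<integral>x. \<bar>g x\<bar> \<partial>M)" .
qed

lemma correlation_bound:
  fixes \<phi> \<psi> :: "real \<Rightarrow> real"
  assumes w: "adm \<beta> \<omega>" and \<phi>: "\<phi> \<in> borel_measurable U" "AE x in U. \<bar>\<phi> x\<bar> \<le> B\<phi>"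
    and \<psi>: "\<psi> \<in> borel_measurable U" "\<And>x. 0 < x \<Longrightarrow> x \<le> 1 \<Longrightarrow> \<bar>\<psi> x\<bar> \<le> B"
  defines "u \<equiv> \<lambda>x. (\<psi> x + B) * hinv \<omega> x"
  assumes D: "integrable U (\<lambda>x. Lit n \<omega> u x - mass u * hinv (shift (int n) \<omega>) x)"
  shows "\<bar>(\<integral>x. \<phi> (rlsv_iter n \<omega> x) * \<psi> x \<partial>mu \<omega>) - (\<integral>x. \<phi> x \<partial>mu (shift (int n) \<omega>)) * (\<integral>x. \<psi> x \<partial>mu \<omega>)\<bar>
    \<le> B\<phi> * (\<integral>x. \<bar>Lit n \<omega> u x - mass u * hinv (shift (int n) \<omega>) x\<bar> \<partial>U)"
proof -
  let ?h = "hinv \<omega>" and ?hn = "hinv (shift (int n) \<omega>)" and ?f = "rlsv_iter n \<omega>"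
  have l: "lcone ?h" and ln: "lcone ?hn" by (auto intro: hinv_lcone[OF w] hinv_lcone[OF adm_shift[OF w]])
  have hm: "?h \<in> borel_measurable U" by (rule lcone_measurable[OF l])
  have um: "u \<in> borel_measurable U" unfolding u_def using \<psi>(1) hm by simp
  have unn: "0 \<le> u x" if "0 < x" "x \<le> 1" for x
    using \<psi>(2)[OF that] lcone_nonneg[OF l that] by (auto simp: u_def intro!: mult_nonneg_nonneg)
  have hnn: "0 \<le> ?h x" if "0 < x" "x \<le> 1" for x by (rule lcone_nonneg[OF l that])
  have B\<psi>: "AE x in U. \<bar>\<psi> x\<bar> \<le> B" using \<psi>(2) by auto
  have i\<psi>: "integrable U (\<lambda>x. \<psi> x * ?h x)" by (rule bounded_mult_integrable(1)[OF \<psi>(1) lcone_integrable[OF l] B\<psi>])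
  have mu1: "mass u = (\<integral>x. \<psi> x * ?h x \<partial>U) + B"
    unfolding mass_def u_def distrib_right
    using i\<psi> lcone_integrable[OF l] mass_hinv[OF w] by (simp add: mass_def)
  have iLu: "integrable U (Lit n \<omega> u)"
  proof -
    have "integrable U (\<lambda>x. (Lit n \<omega> u x - mass u * ?hn x) + mass u * ?hn x)"
      by (intro Bochner_Integration.integrable_add D integrable_mult_right lcone_integrable[OF ln])
    then show ?thesis by simp
  qed
  have i1: "integrable U (\<lambda>x. \<phi> x * Lit n \<omega> u x)" by (rule bounded_mult_integrable(1)[OF \<phi>(1) iLu \<phi>(2)])
  have i2: "integrable U (\<lambda>x. \<phi> x * ?hn x)" by (rule bounded_mult_integrable(1)[OF \<phi>(1) lcone_integrable[OF ln] \<phi>(2)])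
  have Lh: "Lit n \<omega> ?h x = ?hn x" if "0 < x" "x \<le> 1" for x by (rule Lit_hinv[OF w that])
  have c2: "integrable U (\<lambda>x. \<phi> x * Lit n \<omega> ?h x)" "(\<integral>x. \<phi> x * Lit n \<omega> ?h x \<partial>U) = (\<integral>x. \<phi> x * ?hn x \<partial>U)"
  proof -
    show "integrable U (\<lambda>x. \<phi> x * Lit n \<omega> ?h x)"
      by (rule Bochner_Integration.integrable_cong[THEN iffD2, OF refl _ i2]) (use Lh in auto)
    show "(\<integral>x. \<phi> x * Lit n \<omega> ?h x \<partial>U) = (\<integral>x. \<phi> x * ?hn x \<partial>U)"
      by (rule Bochner_Integration.integral_cong) (use Lh in auto)
  qed
  have j1: "integrable U (\<lambda>x. \<phi> (?f x) * u x)" using i1 by (subst integral_Lit(2)[OF w um unn \<phi>(1)])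
  have j2: "integrable U (\<lambda>x. \<phi> (?f x) * ?h x)" using c2(1) by (subst integral_Lit(2)[OF w hm hnn \<phi>(1)])
  have \<phi>f: "(\<lambda>x. \<phi> (?f x)) \<in> borel_measurable U" by (rule measurable_compose[OF rlsv_iter_U[OF w] \<phi>(1)])
  have "(\<integral>x. \<phi> (?f x) * \<psi> x \<partial>mu \<omega>) = (\<integral>x. \<phi> (?f x) * u x - B * (\<phi> (?f x) * ?h x) \<partial>U)"
    using \<phi>f \<psi>(1) by (subst integral_mu[OF w]) (auto intro!: Bochner_Integration.integral_cong simp: u_def algebra_simps)
  also have "\<dots> = (\<integral>x. \<phi> (?f x) * u x \<partial>U) - B * (\<integral>x. \<phi> (?f x) * ?h x \<partial>U)"
    using j1 j2 by simp
  also have "\<dots> = (\<integral>x. \<phi> x * Lit n \<omega> u x \<partial>U) - B * (\<integral>x. \<phi> x * ?hn x \<partial>U)"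
  proof -
    have "(\<integral>x. \<phi> (?f x) * u x \<partial>U) = (\<integral>x. \<phi> x * Lit n \<omega> u x \<partial>U)"
      by (rule integral_Lit(1)[OF w um unn \<phi>(1)])
    moreover have "(\<integral>x. \<phi> (?f x) * ?h x \<partial>U) = (\<integral>x. \<phi> x * Lit n \<omega> ?h x \<partial>U)"
      by (rule integral_Lit(1)[OF w hm hnn \<phi>(1)])
    ultimately show ?thesis by (simp only: c2(2))
  qed
  finally have e1: "(\<integral>x. \<phi> (?f x) * \<psi> x \<partial>mu \<omega>) = (\<integral>x. \<phi> x * Lit n \<omega> u x \<partial>U) - B * (\<integral>x. \<phi> x * ?hn x \<partial>U)" .
  have e2: "(\<integral>x. \<phi> x \<partial>mu (shift (int n) \<omega>)) = (\<integral>x. \<phi> x * ?hn x \<partial>U)"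
    by (rule integral_mu[OF adm_shift[OF w] \<phi>(1)])
  have e3: "(\<integral>x. \<psi> x \<partial>mu \<omega>) = mass u - B" using integral_mu[OF w \<psi>(1)] mu1 by simp
  have "(\<integral>x. \<phi> (?f x) * \<psi> x \<partial>mu \<omega>) - (\<integral>x. \<phi> x \<partial>mu (shift (int n) \<omega>)) * (\<integral>x. \<psi> x \<partial>mu \<omega>)
      = (\<integral>x. \<phi> x * Lit n \<omega> u x \<partial>U) - mass u * (\<integral>x. \<phi> x * ?hn x \<partial>U)"
    unfolding e1 e2 e3 by (simp add: algebra_simps)
  also have "\<dots> = (\<integral>x. \<phi> x * Lit n \<omega> u x - mass u * (\<phi> x * ?hn x) \<partial>U)" using i1 i2 by simp
  also have "\<dots> = (\<integral>x. \<phi> x * (Lit n \<omega> u x - mass u * ?hn x) \<partial>U)"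
    by (intro Bochner_Integration.integral_cong) (auto simp: algebra_simps)
  finally show ?thesis using bounded_mult_integrable(2)[OF \<phi>(1) D \<phi>(2)] by simp
qed

lemma correlation_trivial:
  fixes \<phi> \<psi> :: "real \<Rightarrow> real"
  assumes w: "adm \<beta> \<omega>" and \<phi>: "\<phi> \<in> borel_measurable U" "AE x in U. \<bar>\<phi> x\<bar> \<le> B\<phi>"
    and \<psi>: "\<psi> \<in> borel_measurable U" "\<And>x. 0 < x \<Longrightarrow> x \<le> 1 \<Longrightarrow> \<bar>\<psi> x\<bar> \<le> B"
  shows "\<bar>(\<integral>x. \<phi> (rlsv_iter n \<omega> x) * \<psi> x \<partial>mu \<omega>) - (\<integral>x. \<phi> x \<partial>mu (shift (int n) \<omega>)) * (\<integral>x. \<psi> x \<partial>mu \<omega>)\<bar>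
    \<le> 4 * B\<phi> * B"
proof -
  let ?u = "\<lambda>x. (\<psi> x + B) * hinv \<omega> x"
  let ?h = "hinv \<omega>" and ?hn = "hinv (shift (int n) \<omega>)"
  have B: "0 \<le> B" using \<psi>(2)[of 1] by auto
  have l: "lcone ?h" and ln: "lcone ?hn" by (auto intro: hinv_lcone[OF w] hinv_lcone[OF adm_shift[OF w]])
  have um: "?u \<in> borel_measurable U" using \<psi>(1) lcone_measurable[OF l] by simp
  have ub: "0 \<le> ?u x \<and> ?u x \<le> 2 * B * ?h x" if "0 < x" "x \<le> 1" for x
    using \<psi>(2)[OF that] lcone_nonneg[OF l that] by (auto intro!: mult_nonneg_nonneg mult_right_mono)
  have Lb: "0 \<le> Lit n \<omega> ?u x \<and> Lit n \<omega> ?u x \<le> 2 * B * ?hn x" if x: "0 < x" "x \<le> 1" for x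
  proof -
    have "Lit n \<omega> ?u x \<le> Lit n \<omega> (\<lambda>x. 2 * B * ?h x) x" by (rule Lit_mono[OF w _ x]) (use ub in auto)
    also have "\<dots> = 2 * B * ?hn x" unfolding Lit_scale using Lit_hinv[OF w x] by simp
    finally show ?thesis using Lit_nonneg[OF w _ x, of ?u n] ub by auto
  qed
  have mu0: "0 \<le> mass ?u" unfolding mass_def by (rule Bochner_Integration.integral_nonneg) (use ub in auto)
  have "\<bar>\<psi> x + B\<bar> \<le> 2 * B" if "x \<in> space U" for x
    using \<psi>(2)[of x] that by auto
  then have "AE x in U. \<bar>\<psi> x + B\<bar> \<le> 2 * B" by (rule AE_I2)
  from bounded_mult_integrable(1)[OF _ lcone_integrable[OF l] this]
  have "integrable U ?u" using \<psi>(1) by simp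
  then have mu1: "mass ?u \<le> 2 * B"
    using mass_mono[of ?u "\<lambda>x. 2 * B * ?h x"] ub lcone_integrable[OF l] mass_hinv[OF w] by (simp add: mass_scale)
  have E: "\<bar>Lit n \<omega> ?u x - mass ?u * ?hn x\<bar> \<le> 4 * B * ?hn x" if x: "0 < x" "x \<le> 1" for x
  proof -
    have "0 \<le> mass ?u * ?hn x" "mass ?u * ?hn x \<le> 2 * B * ?hn x" "0 \<le> 2 * B * ?hn x"
      using mu0 mu1 B lcone_nonneg[OF ln x] by (auto intro!: mult_nonneg_nonneg mult_right_mono)
    then show ?thesis using Lb[OF x] by (simp add: abs_le_iff)
  qed
  have E': "integrable U (\<lambda>x. 4 * B * ?hn x)" "mass (\<lambda>x. 4 * B * ?hn x) = 4 * B"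
    using lcone_integrable[OF ln] mass_hinv[OF adm_shift[OF w]] by (simp_all add: mass_scale)
  have ih: "integrable U (\<lambda>x. mass ?u * ?hn x)" using lcone_integrable[OF ln] by simp
  note md = mass_abs_diff[OF Lit_measurable[OF w um, of n] ih E'(1) E]
  have B\<phi>: "0 \<le> B\<phi>"
  proof -
    have "AE x in U. 0 \<le> B\<phi>" using \<phi>(2) by eventually_elim auto
    then show ?thesis by simp
  qed
  show ?thesis
    using correlation_bound[OF w \<phi> \<psi> md(4)] mult_left_mono[OF md(1) B\<phi>] unfolding E'(2) by (simp add: mult_ac)
qed

lemma holder_continuous:
  assumes "holder_on \<eta> S \<psi>" "0 < \<eta>"
  shows "continuous_on S \<psi>"
proof -
  obtain H where H: "\<And>x y. x \<in> S \<Longrightarrow> y \<in> S \<Longrightarrow> \<bar>\<psi> x - \<psi> y\<bar> \<le> H * \<bar>x - y\<bar> powr \<eta>"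
    using assms(1) unfolding holder_on_def by blast
  show ?thesis unfolding continuous_on_def
  proof
    fix x assume x: "x \<in> S"
    have "((\<lambda>y. \<bar>y - x\<bar>) \<longlongrightarrow> \<bar>x - x\<bar>) (at x within S)" by (intro tendsto_intros)
    then have "((\<lambda>y. \<bar>y - x\<bar> powr \<eta>) \<longlongrightarrow> 0) (at x within S)"
      by (intro tendsto_zero_powrI[OF _ tendsto_const]) (use assms(2) in auto)
    then have z: "((\<lambda>y. H * \<bar>y - x\<bar> powr \<eta>) \<longlongrightarrow> 0) (at x within S)" by (rule tendsto_mult_right_zero)
    have "((\<lambda>y. \<psi> y - \<psi> x) \<longlongrightarrow> 0) (at x within S)"
      by (rule Lim_null_comparison[OF _ z]) (use H x in \<open>auto simp: eventually_at_filter\<close>)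
    then show "(\<psi> \<longlongrightarrow> \<psi> x) (at x within S)" by (simp add: LIM_zero_iff)
  qed
qed

lemma ennreal_le_suminf_greater:
  assumes "0 \<le> (c::real)"
  shows "ennreal c \<le> (\<Sum>n. if real n < c then 1 else 0)"
proof -
  let ?m = "nat \<lceil>c\<rceil>"
  have "ennreal c \<le> ennreal (real ?m)" using assms by (intro ennreal_leI real_nat_ceiling_ge)
  also have "\<dots> = (\<Sum>n<?m. 1)" by (simp add: ennreal_of_nat_eq_real_of_nat)
  also have "\<dots> = (\<Sum>n<?m. if real n < c then 1 else 0)"
    by (intro sum.cong refl) (auto simp: nat_less_iff less_ceiling_iff zless_nat_eq_int_zless)
  also have "\<dots> \<le> (\<Sum>n. if real n < c then 1 else 0)" by (rule sum_le_suminf) auto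
  finally show ?thesis .
qed

lemma (in prob_space) integrable_of_tail:
  fixes C :: "'a \<Rightarrow> real"
  assumes [measurable]: "C \<in> borel_measurable M" and C0: "\<And>x. x \<in> space M \<Longrightarrow> 0 \<le> C x"
    and t: "\<And>n. measure M {x \<in> space M. real n < C x} \<le> f n" and f: "summable f"
  shows "integrable M C"
proof (rule integrableI_nonneg)
  have f0: "0 \<le> f n" for n using t[of n] measure_nonneg order_trans by blast
  have "(\<integral>\<^sup>+x. ennreal (C x) \<partial>M) \<le> (\<integral>\<^sup>+x. (\<Sum>n. indicator {x \<in> space M. real n < C x} x) \<partial>M)"
  proof (rule nn_integral_mono)
    fix x assume x: "x \<in> space M"
    have "(\<lambda>n. indicator {x \<in> space M. real n < C x} x :: ennreal) = (\<lambda>n. if real n < C x then 1 else 0)"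
      using x by (auto simp: indicator_def fun_eq_iff)
    then show "ennreal (C x) \<le> (\<Sum>n. indicator {x \<in> space M. real n < C x} x)"
      using ennreal_le_suminf_greater[OF C0[OF x]] by simp
  qed
  also have "\<dots> = (\<Sum>n. \<integral>\<^sup>+x. indicator {x \<in> space M. real n < C x} x \<partial>M)"
    by (rule nn_integral_suminf) measurable
  also have "\<dots> = (\<Sum>n. emeasure M {x \<in> space M. real n < C x})"
    by (intro suminf_cong nn_integral_indicator) measurable
  also have "\<dots> \<le> (\<Sum>n. ennreal (f n))"
    by (intro suminf_le) (auto simp: emeasure_eq_measure intro!: ennreal_leI t)
  also have "\<dots> = ennreal (suminf f)" by (rule suminf_ennreal2[OF f0 f])
  also have "\<dots> < \<infinity>" by simp
  finally show "(\<integral>\<^sup>+x. ennreal (C x) \<partial>M) < \<infinity>" .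
qed (use C0 in auto)

context lsv_random begin

lemma AE_eventually_good:
  assumes c: "0 < c" and v: "0 < v"
    and tail: "\<forall>k\<ge>1. measure P {\<omega> \<in> space P. \<not> (\<forall>n\<ge>k. allgood s v n \<omega>)} \<le> K * exp (- c * real k powr v)"
  shows "AE \<omega> in P. \<exists>N\<ge>1. \<forall>n\<ge>N. allgood s v n \<omega>"
proof -
  define Z where "Z = {\<omega> \<in> space P. \<not> (\<exists>N\<ge>1. \<forall>n\<ge>N. allgood s v n \<omega>)}"
  have Z: "Z \<in> sets P" unfolding Z_def by measurable
  have le: "measure P Z \<le> K * exp (- c * real k powr v)" if k: "1 \<le> k" for k
  proof -
    have "measure P Z \<le> measure P {\<omega> \<in> space P. \<not> (\<forall>n\<ge>k. allgood s v n \<omega>)}"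
      by (rule P.finite_measure_mono) (use k in \<open>auto simp: Z_def\<close>)
    also have "\<dots> \<le> K * exp (- c * real k powr v)" using tail k by blast
    finally show ?thesis .
  qed
  have "(\<lambda>k::nat. exp (- c * real k powr v)) \<longlonglongrightarrow> 0" using c v by real_asymp
  from tendsto_mult_left[OF this, of K] have "(\<lambda>k::nat. K * exp (- c * real k powr v)) \<longlonglongrightarrow> 0" by simp
  then have "measure P Z \<le> 0" by (rule LIMSEQ_le_const) (use le in blast)
  then have "measure P Z = 0" using measure_nonneg[of P Z] by linarith
  then have "Z \<in> null_sets P" using Z by (auto simp: P.emeasure_eq_measure)
  then show ?thesis by (rule AE_I') (auto simp: Z_def)
qed

lemma correlations:
  assumes supp: "\<And>s. \<alpha>\<^sub>0 < s \<Longrightarrow> 0 < pr s" and \<eta>: "\<eta> \<in> {0<..1}" and \<delta>: "0 < \<delta>"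
  shows "\<exists>\<Omega>\<^sub>0 \<in> sets P. measure P \<Omega>\<^sub>0 = 1 \<and>
       (\<exists>C \<in> borel_measurable P.
          (\<forall>\<omega>\<in>\<Omega>\<^sub>0. 0 \<le> C \<omega>) \<and>
          (\<forall>\<phi> \<in> Linf_fun unit_lebesgue. \<forall>\<psi>. holder_on \<eta> {0..1} \<psi> \<longrightarrow>
             (\<exists>D :: real. \<forall>\<omega>\<in>\<Omega>\<^sub>0. \<forall>n::nat. n \<ge> 1 \<longrightarrow>
                \<bar>(\<integral>x. \<phi> (rlsv_iter n \<omega> x) * \<psi> x \<partial>mu \<omega>)
                   - (\<integral>x. \<phi> x \<partial>mu (shift (int n) \<omega>)) * (\<integral>x. \<psi> x \<partial>mu \<omega>)\<bar>
                  \<le> C \<omega> * D * (1 / real n powr (1 / \<alpha>\<^sub>0 - \<delta> - 1)) \<and>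
                \<bar>(\<integral>x. \<phi> (rlsv_iter n (shift (- int n) \<omega>) x) * \<psi> x \<partial>mu (shift (- int n) \<omega>))
                   - (\<integral>x. \<phi> x \<partial>mu \<omega>) * (\<integral>x. \<psi> x \<partial>mu (shift (- int n) \<omega>))\<bar>
                  \<le> C \<omega> * D * (1 / real n powr (1 / \<alpha>\<^sub>0 - \<delta> - 1)))) \<and>
          (\<exists>K u' v' :: real. K > 0 \<and> u' > 0 \<and> 0 < v' \<and> v' < 1 \<and>
             (\<forall>n::nat. measure P {\<omega> \<in> space P. C \<omega> > real n} \<le> K * exp (- u' * real n powr v'))) \<and>
          integrable P C)"
proof -
  have \<eta>0: "0 < \<eta>" using \<eta> by simp
  define \<kappa> where "\<kappa> = 1 / \<alpha>\<^sub>0 - \<delta> - 1"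
  obtain s v K c D\<^sub>0 where v: "0 < v" "v < 1" and K: "0 \<le> K" and c: "0 < c" and D0: "0 \<le> D\<^sub>0"
    and tail': "\<forall>k\<ge>1. measure P {\<omega> \<in> space P. \<not> (\<forall>n\<ge>k. allgood s v n \<omega>)} \<le> K * exp (- c * real k powr v)"
    and loss: "loss_rate \<eta> \<kappa> s v D\<^sub>0"
    using quenched_loss[OF supp \<delta> \<eta>0] unfolding \<kappa>_def by blast
  note tail = tail'[rule_format]
  define gf where "gf N \<omega> \<longleftrightarrow> 1 \<le> N \<and> (\<forall>n\<ge>N. allgood s v n \<omega>)" for N :: nat and \<omega>
  have gf_m [measurable]: "Measurable.pred P (gf N)" for N unfolding gf_def[abs_def] by measurable
  define \<Omega>\<^sub>0 where "\<Omega>\<^sub>0 = {\<omega> \<in> space P. \<exists>N. gf N \<omega>}"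
  have \<Omega>0 [measurable]: "\<Omega>\<^sub>0 \<in> sets P" unfolding \<Omega>\<^sub>0_def by measurable
  define Nf where "Nf \<omega> = (LEAST N. gf N \<omega>)" for \<omega>
  have Nf_m [measurable]: "Nf \<in> P \<rightarrow>\<^sub>M count_space UNIV" unfolding Nf_def[abs_def] by measurable
  have gNf: "gf (Nf \<omega>) \<omega>" if "\<omega> \<in> \<Omega>\<^sub>0" for \<omega>
    using that unfolding \<Omega>\<^sub>0_def Nf_def by (auto intro: LeastI)
  define C where "C \<omega> = indicator \<Omega>\<^sub>0 \<omega> * real (Nf \<omega>) powr (1 / \<alpha>\<^sub>0)" for \<omega>
  have C_m [measurable]: "C \<in> borel_measurable P" unfolding C_def[abs_def] by measurable
  have C0: "0 \<le> C \<omega>" for \<omega> by (simp add: C_def)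
  have full: "measure P \<Omega>\<^sub>0 = 1"
  proof -
    have "AE \<omega> in P. \<omega> \<in> \<Omega>\<^sub>0"
      using AE_eventually_good[OF c v(1) tail'] AE_space by eventually_elim (auto simp: \<Omega>\<^sub>0_def gf_def)
    then show ?thesis using P.prob_eq_1[OF \<Omega>0] by simp
  qed
  define u' where "u' = c * (1/2) powr v"
  define v' where "v' = \<alpha>\<^sub>0 * v"
  have a01: "0 < \<alpha>\<^sub>0" "\<alpha>\<^sub>0 < 1" using \<alpha> by auto
  have u': "0 < u'" using c by (simp add: u'_def)
  have v': "0 < v'" "v' < 1" using a01 v mult_strict_mono[of \<alpha>\<^sub>0 1 v 1] by (auto simp: v'_def)
  have Ctail: "measure P {\<omega> \<in> space P. C \<omega> > real n} \<le> (K + 1) * exp (- u' * real n powr v')" for n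
  proof (cases "n = 0")
    case True
    have "measure P {\<omega> \<in> space P. C \<omega> > real n} \<le> 1" by (rule P.prob_le_1)
    also have "1 \<le> (K + 1) * exp (- u' * real n powr v')" using True K by simp
    finally show ?thesis .
  next
    case False
    then have n: "1 \<le> n" by simp
    define k where "k = Tn \<alpha>\<^sub>0 n"
    note t = Tn_bounds[OF a01(1) n, folded k_def]
    have sub: "{\<omega> \<in> space P. C \<omega> > real n} \<subseteq> {\<omega> \<in> space P. \<not> (\<forall>n\<ge>k. allgood s v n \<omega>)}"
    proof clarify
      fix \<omega> assume w: "\<omega> \<in> space P" "real n < C \<omega>" and g: "\<forall>n\<ge>k. allgood s v n \<omega>"
      have "gf k \<omega>" using g t(1) by (simp add: gf_def)
      then have "Nf \<omega> \<le> k" unfolding Nf_def by (rule Least_le)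
      then have "real (Nf \<omega>) \<le> real n powr \<alpha>\<^sub>0" using t(2) by linarith
      then have "real (Nf \<omega>) powr (1 / \<alpha>\<^sub>0) \<le> (real n powr \<alpha>\<^sub>0) powr (1 / \<alpha>\<^sub>0)"
        using a01 by (intro powr_mono2) auto
      also have "\<dots> = real n" using a01 n by (simp add: powr_powr)
      finally have "C \<omega> \<le> real n" by (auto simp: C_def indicator_def)
      with w(2) show False by simp
    qed
    have "measure P {\<omega> \<in> space P. C \<omega> > real n} \<le> measure P {\<omega> \<in> space P. \<not> (\<forall>n\<ge>k. allgood s v n \<omega>)}"
      by (rule P.finite_measure_mono[OF sub]) measurable
    also have "\<dots> \<le> K * exp (- c * real k powr v)" by (rule tail[OF t(1)])
    also have "\<dots> \<le> K * exp (- u' * real n powr v')"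
    proof -
      have "(real n powr \<alpha>\<^sub>0 / 2) powr v \<le> real k powr v" using t(4) v by (intro powr_mono2) auto
      also have "(real n powr \<alpha>\<^sub>0 / 2) powr v = (real n powr \<alpha>\<^sub>0 * (1/2)) powr v" by simp
      also have "\<dots> = real n powr v' * (1/2) powr v" unfolding powr_mult powr_powr v'_def ..
      finally have "c * (real n powr v' * (1/2) powr v) \<le> c * real k powr v" using c by (intro mult_left_mono) auto
      then show ?thesis using K by (intro mult_left_mono) (auto simp: u'_def mult_ac)
    qed
    also have "\<dots> \<le> (K + 1) * exp (- u' * real n powr v')" by (simp add: distrib_right)
    finally show ?thesis .
  qed
  have intC: "integrable P C"
  proof (rule P.integrable_of_tail[OF C_m C0 Ctail])
    obtain Q where Q: "\<And>n::nat. 1 \<le> n \<Longrightarrow> exp (- u' * real n powr v') \<le> Q * real n powr (- 2)"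
      using exp_powr_bound[OF u' v'(1), of 2] by blast
    have "summable (\<lambda>n. Q * real n powr (-2))" by (intro summable_mult) (simp add: summable_real_powr_iff)
    then have "summable (\<lambda>n. exp (- u' * real n powr v'))"
      by (rule summable_comparison_test'[where N=1]) (use Q in auto)
    then show "summable (\<lambda>n. (K + 1) * exp (- u' * real n powr v'))" by (rule summable_mult)
  qed
  have main: "\<exists>D :: real. \<forall>\<omega>\<in>\<Omega>\<^sub>0. \<forall>n::nat. n \<ge> 1 \<longrightarrow> (\<forall>j\<in>{0, - int n}.
        \<bar>(\<integral>x. \<phi> (rlsv_iter n (shift j \<omega>) x) * \<psi> x \<partial>mu (shift j \<omega>))
                   - (\<integral>x. \<phi> x \<partial>mu (shift (int n + j) \<omega>)) * (\<integral>x. \<psi> x \<partial>mu (shift j \<omega>))\<bar>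
                  \<le> C \<omega> * D * (1 / real n powr \<kappa>))"
    if \<phi>: "\<phi> \<in> Linf_fun unit_lebesgue" and \<psi>: "holder_on \<eta> {0..1} \<psi>" for \<phi> \<psi>
  proof -
    have \<phi>m: "\<phi> \<in> borel_measurable U" using \<phi> by (auto simp: Linf_fun_def intro: unit_measurable_U)
    obtain B\<phi> where B\<phi>: "AE x in U. \<bar>\<phi> x\<bar> \<le> B\<phi>"
      using \<phi> unfolding Linf_fun_def AE_unit_U by auto
    have B\<phi>0: "0 \<le> B\<phi>"
    proof -
      have "AE x in U. 0 \<le> B\<phi>" using B\<phi> by eventually_elim auto
      then show ?thesis by simp
    qed
    obtain H where H: "\<And>x y. x \<in> {0..1} \<Longrightarrow> y \<in> {0..1} \<Longrightarrow> \<bar>\<psi> x - \<psi> y\<bar> \<le> H * \<bar>x - y\<bar> powr \<eta>"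
      using \<psi> unfolding holder_on_def by blast
    have H0: "0 \<le> H" using H[of 0 1] by simp
    have \<psi>m: "\<psi> \<in> borel_measurable U"
    proof (rule unit_measurable_U)
      have "\<psi> \<in> borel_measurable unit_borel"
        by (rule borel_measurable_continuous_on_restrict[OF holder_continuous[OF \<psi> \<eta>0]])
      then show "\<psi> \<in> borel_measurable unit_lebesgue"
        by (subst measurable_cong_sets[of _ unit_borel _ borel]) (auto simp: sets_restrict_space)
    qed
    define B where "B = \<bar>\<psi> 0\<bar> + H"
    have B: "\<bar>\<psi> x\<bar> \<le> B" if "0 < x" "x \<le> 1" for x
    proof -
      have "\<bar>\<psi> x - \<psi> 0\<bar> \<le> H * \<bar>x - 0\<bar> powr \<eta>" using that by (intro H) auto
      also have "\<dots> \<le> H * 1" using that \<eta>0 H0 by (intro mult_left_mono powr_le1) auto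
      finally show ?thesis by (simp add: B_def)
    qed
    have B0: "0 \<le> B" using H0 by (simp add: B_def)
    define D where "D = B\<phi> * ((2 * B + H) * D\<^sub>0) + 4 * B\<phi> * B"
    have D1: "0 \<le> B\<phi> * ((2 * B + H) * D\<^sub>0)" "0 \<le> 4 * B\<phi> * B" using B\<phi>0 B0 H0 D0 by auto
    show ?thesis
    proof (intro exI[of _ D] ballI allI impI)
      fix \<omega> and n :: nat and j assume w: "\<omega> \<in> \<Omega>\<^sub>0" and n: "1 \<le> n" and j: "j \<in> {0, - int n}"
      have wP: "\<omega> \<in> space P" using w by (simp add: \<Omega>\<^sub>0_def)
      have jP: "shift j \<omega> \<in> space P" by (rule shift_space_P[OF wP])
      let ?w = "shift j \<omega>"
      let ?c = "\<bar>(\<integral>x. \<phi> (rlsv_iter n ?w x) * \<psi> x \<partial>mu ?w) - (\<integral>x. \<phi> x \<partial>mu (shift (int n) ?w)) * (\<integral>x. \<psi> x \<partial>mu ?w)\<bar>"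
      have N1: "1 \<le> Nf \<omega>" using gNf[OF w] by (simp add: gf_def)
      have Cw: "C \<omega> = real (Nf \<omega>) powr (1 / \<alpha>\<^sub>0)" using w by (simp add: C_def)
      have C1: "1 \<le> C \<omega>" unfolding Cw using N1 a01 by (intro ge_one_powr_ge_zero) auto
      have np: "0 < real n powr (- \<kappa>)" using n by simp
      have "?c \<le> C \<omega> * D * real n powr (- \<kappa>)"
      proof (cases "Nf \<omega> \<le> n")
        case True
        have ag: "allgood s v n \<omega>" using gNf[OF w] True by (simp add: gf_def)
        have g: "good s (pr s) (Tn v n) (shift (int i) ?w)" if "i \<le> n" for i
          using ag that j unfolding allgood_def by (auto simp: shift_shift)
        have bd: "0 \<le> \<psi> x + B \<and> \<psi> x + B \<le> 2 * B" if "0 < x" "x \<le> 1" for x using B[OF that] by auto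
        have ho: "\<bar>(\<psi> x + B) - (\<psi> y + B)\<bar> \<le> H * \<bar>x - y\<bar> powr \<eta>" if "0 < x" "x \<le> 1" "0 < y" "y \<le> 1" for x y
          using H[of x y] that by simp
        have \<psi>m': "(\<lambda>x. \<psi> x + B) \<in> borel_measurable U" using \<psi>m by simp
        have l1: "integrable U (\<lambda>x. Lit n ?w (\<lambda>x. (\<psi> x + B) * hinv ?w x) x - mass (\<lambda>x. (\<psi> x + B) * hinv ?w x) * hinv (shift (int n) ?w) x)"
          and l2: "(\<integral>x. \<bar>Lit n ?w (\<lambda>x. (\<psi> x + B) * hinv ?w x) x - mass (\<lambda>x. (\<psi> x + B) * hinv ?w x) * hinv (shift (int n) ?w) x\<bar> \<partial>U)
            \<le> (2 * B + H) * D\<^sub>0 * real n powr (- \<kappa>)"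
          by (rule loss_rateD[OF loss jP n g \<psi>m' H0 bd ho]; assumption)+
        have "?c \<le> B\<phi> * (\<integral>x. \<bar>Lit n ?w (\<lambda>x. (\<psi> x + B) * hinv ?w x) x - mass (\<lambda>x. (\<psi> x + B) * hinv ?w x) * hinv (shift (int n) ?w) x\<bar> \<partial>U)"
          by (rule correlation_bound[OF adm_P[OF jP] \<phi>m B\<phi> \<psi>m B l1])
        also have "\<dots> \<le> B\<phi> * ((2 * B + H) * D\<^sub>0 * real n powr (- \<kappa>))"
          by (rule mult_left_mono[OF l2 B\<phi>0])
        also have "\<dots> \<le> D * real n powr (- \<kappa>)"
        proof -
          have "B\<phi> * ((2 * B + H) * D\<^sub>0 * real n powr (- \<kappa>)) = B\<phi> * ((2 * B + H) * D\<^sub>0) * real n powr (- \<kappa>)" by simp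
          moreover have "0 \<le> 4 * B\<phi> * B * real n powr (- \<kappa>)" by (rule mult_nonneg_nonneg[OF D1(2) less_imp_le[OF np]])
          ultimately show ?thesis unfolding D_def distrib_right by linarith
        qed
        also have "\<dots> \<le> C \<omega> * (D * real n powr (- \<kappa>))"
          using C1 D1 np mult_right_mono[of 1 "C \<omega>" "D * real n powr (- \<kappa>)"] by (simp add: D_def)
        finally show ?thesis by (simp add: mult.assoc)
      next
        case False
        have "real n powr \<kappa> \<le> real n powr (1 / \<alpha>\<^sub>0)" using n \<delta> by (intro powr_mono) (auto simp: \<kappa>_def)
        also have "\<dots> \<le> C \<omega>" unfolding Cw using False a01 by (intro powr_mono2) auto
        finally have "1 \<le> C \<omega> * real n powr (- \<kappa>)" using n by (simp add: powr_minus field_simps)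
        have "?c \<le> 4 * B\<phi> * B" by (rule correlation_trivial[OF adm_P[OF jP] \<phi>m B\<phi> \<psi>m B])
        also have "\<dots> \<le> D" using D1 by (simp add: D_def)
        also have "\<dots> \<le> D * (C \<omega> * real n powr (- \<kappa>))"
          using mult_left_mono[OF \<open>1 \<le> C \<omega> * real n powr (- \<kappa>)\<close>, of D] D1 by (simp add: D_def)
        finally show ?thesis by (simp add: mult_ac)
      qed
      then show "\<bar>(\<integral>x. \<phi> (rlsv_iter n ?w x) * \<psi> x \<partial>mu ?w)
                   - (\<integral>x. \<phi> x \<partial>mu (shift (int n + j) \<omega>)) * (\<integral>x. \<psi> x \<partial>mu ?w)\<bar>
                  \<le> C \<omega> * D * (1 / real n powr \<kappa>)"
        by (simp add: powr_minus divide_inverse)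
    qed
  qed
  have main': "\<exists>D :: real. \<forall>\<omega>\<in>\<Omega>\<^sub>0. \<forall>n::nat. n \<ge> 1 \<longrightarrow>
                \<bar>(\<integral>x. \<phi> (rlsv_iter n \<omega> x) * \<psi> x \<partial>mu \<omega>)
                   - (\<integral>x. \<phi> x \<partial>mu (shift (int n) \<omega>)) * (\<integral>x. \<psi> x \<partial>mu \<omega>)\<bar>
                  \<le> C \<omega> * D * (1 / real n powr (1 / \<alpha>\<^sub>0 - \<delta> - 1)) \<and>
                \<bar>(\<integral>x. \<phi> (rlsv_iter n (shift (- int n) \<omega>) x) * \<psi> x \<partial>mu (shift (- int n) \<omega>))
                   - (\<integral>x. \<phi> x \<partial>mu \<omega>) * (\<integral>x. \<psi> x \<partial>mu (shift (- int n) \<omega>))\<bar>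
                  \<le> C \<omega> * D * (1 / real n powr (1 / \<alpha>\<^sub>0 - \<delta> - 1))"
    if \<phi>: "\<phi> \<in> Linf_fun unit_lebesgue" and \<psi>: "holder_on \<eta> {0..1} \<psi>" for \<phi> \<psi>
    using main[OF that] unfolding \<kappa>_def by auto
  show ?thesis
  proof (rule bexI[OF _ \<Omega>0], intro conjI full, rule bexI[OF _ C_m], intro conjI)
    show "\<forall>\<omega>\<in>\<Omega>\<^sub>0. 0 \<le> C \<omega>" using C0 by simp
    show "\<exists>K u' v' :: real. K > 0 \<and> u' > 0 \<and> 0 < v' \<and> v' < 1 \<and>
             (\<forall>n::nat. measure P {\<omega> \<in> space P. C \<omega> > real n} \<le> K * exp (- u' * real n powr v'))"
      using Ctail u' v' K by (intro exI[of _ "K + 1"] exI[of _ u'] exI[of _ v']) auto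
  qed (use main' intC in blast)+
qed

end

section \<open>Mixing\<close>

lemma (in finite_measure) tendsto_integral_approx:
  fixes f :: "'a \<Rightarrow> real" and k :: "nat \<Rightarrow> 'a \<Rightarrow> real"
  assumes k: "\<And>n. k n \<in> borel_measurable M" "\<And>n x. x \<in> space M \<Longrightarrow> \<bar>k n x\<bar> \<le> B"
    and f: "integrable M f"
    and ap: "\<And>e. 0 < e \<Longrightarrow> \<exists>g. integrable M g \<and> (\<integral>x. \<bar>f x - g x\<bar> \<partial>M) \<le> e \<and> (\<lambda>n. \<integral>x. g x * k n x \<partial>M) \<longlonglongrightarrow> 0"
  shows "(\<lambda>n. \<integral>x. f x * k n x \<partial>M) \<longlonglongrightarrow> 0"
proof (rule LIMSEQ_I)
  fix e :: real assume e: "0 < e"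
  define B' where "B' = max B 1"
  have B': "0 < B'" "B \<le> B'" by (auto simp: B'_def)
  have kB: "\<bar>k n x\<bar> \<le> B'" if "x \<in> space M" for n x using k(2)[OF that] B'(2) by (rule order_trans)
  have "0 < e / (2 * B')" using e B' by simp
  then obtain g where g: "integrable M g" "(\<integral>x. \<bar>f x - g x\<bar> \<partial>M) \<le> e / (2 * B')" "(\<lambda>n. \<integral>x. g x * k n x \<partial>M) \<longlonglongrightarrow> 0"
    using ap by blast
  obtain N where N: "\<And>n. N \<le> n \<Longrightarrow> \<bar>\<integral>x. g x * k n x \<partial>M\<bar> < e / 2"
    using LIMSEQ_D[OF g(3), of "e/2"] e by auto
  have ik: "integrable M (\<lambda>x. h x * k n x)" if "integrable M h" for h n
    using bounded_mult_integrable(1)[OF k(1) that, of n B'] kB by (auto simp: mult.commute)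
  show "\<exists>N. \<forall>n\<ge>N. norm ((\<integral>x. f x * k n x \<partial>M) - 0) < e"
  proof (intro exI[of _ N] allI impI)
    fix n assume n: "N \<le> n"
    have d: "integrable M (\<lambda>x. f x - g x)" using f g(1) by simp
    have "\<bar>\<integral>x. k n x * (f x - g x) \<partial>M\<bar> \<le> B' * (\<integral>x. \<bar>f x - g x\<bar> \<partial>M)"
      by (rule bounded_mult_integrable(2)[OF k(1) d]) (use kB in auto)
    also have "\<dots> \<le> B' * (e / (2 * B'))" by (rule mult_left_mono[OF g(2)]) (use B' in simp)
    also have "\<dots> = e / 2" using B' by simp
    finally have 1: "\<bar>\<integral>x. k n x * (f x - g x) \<partial>M\<bar> \<le> e / 2" .
    have "(\<integral>x. f x * k n x \<partial>M) = (\<integral>x. k n x * (f x - g x) + g x * k n x \<partial>M)"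
      by (intro Bochner_Integration.integral_cong) (auto simp: algebra_simps)
    also have "\<dots> = (\<integral>x. k n x * (f x - g x) \<partial>M) + (\<integral>x. g x * k n x \<partial>M)"
      using ik[OF d, of n] ik[OF g(1), of n] by (intro Bochner_Integration.integral_add) (auto simp: mult.commute)
    finally show "norm ((\<integral>x. f x * k n x \<partial>M) - 0) < e" using 1 N[OF n] by auto
  qed
qed

lemma (in finite_measure) tendsto_integral_generator:
  fixes k :: "nat \<Rightarrow> 'a \<Rightarrow> real"
  assumes k: "\<And>n. k n \<in> borel_measurable M" "\<And>n x. x \<in> space M \<Longrightarrow> \<bar>k n x\<bar> \<le> B"
    and X: "X \<in> M \<rightarrow>\<^sub>M N" and G: "Int_stable G" "G \<subseteq> Pow (space N)" "sets N = sigma_sets (space N) G"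
    and lim: "\<And>A. A \<in> G \<Longrightarrow> (\<lambda>n. \<integral>x. indicator A (X x) * k n x \<partial>M) \<longlonglongrightarrow> 0"
    and lim1: "(\<lambda>n. \<integral>x. k n x \<partial>M) \<longlonglongrightarrow> 0"
    and A: "A \<in> sets N"
  shows "(\<lambda>n. \<integral>x. indicator A (X x) * k n x \<partial>M) \<longlonglongrightarrow> 0"
proof -
  have im: "(\<lambda>x. indicator A (X x) :: real) \<in> borel_measurable M" if "A \<in> sets N" for A
    by (rule measurable_compose[OF X]) (use that in simp)
  have ii: "integrable M (\<lambda>x. indicator A (X x) :: real)" if "A \<in> sets N" for A
    by (rule integrable_const_bound[of _ 1]) (use im[OF that] in \<open>auto simp: indicator_def\<close>)
  have ik: "integrable M (\<lambda>x. h x * k n x)" if "integrable M h" for h n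
    using bounded_mult_integrable(1)[OF k(1) that, of n B] k(2) by (auto simp: mult.commute)
  have ik1: "integrable M (k n)" for n using ik[of "\<lambda>_. 1" n] by simp
  have "A \<in> sigma_sets (space N) G" using A G(3) by simp
  with G(1,2) show ?thesis
  proof (induction rule: sigma_sets_induct_disjoint)
    case (basic A)
    then show ?case by (rule lim)
  next
    case empty
    then show ?case by simp
  next
    case (compl A)
    have A: "A \<in> sets N" using compl G(3) by simp
    have "(\<integral>x. indicator (space N - A) (X x) * k n x \<partial>M) = (\<integral>x. k n x \<partial>M) - (\<integral>x. indicator A (X x) * k n x \<partial>M)" for n
    proof -
      have "(\<integral>x. indicator (space N - A) (X x) * k n x \<partial>M) = (\<integral>x. k n x - indicator A (X x) * k n x \<partial>M)"
        by (intro Bochner_Integration.integral_cong) (use measurable_space[OF X] in \<open>auto simp: indicator_def\<close>)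
      then show ?thesis using ik1 ik[OF ii[OF A]] by simp
    qed
    then show ?case using tendsto_diff[OF lim1 compl.IH] by simp
  next
    case (union A)
    have As: "A i \<in> sets N" for i using union G(3) by auto
    have Us: "(\<Union>i. A i) \<in> sets N" using As by auto
    show ?case
    proof (rule tendsto_integral_approx[OF k ii[OF Us]])
      fix e :: real assume e: "0 < e"
      let ?g = "\<lambda>m x. \<Sum>i<m. indicator (A i) (X x) :: real"
      have g_eq: "?g m x = indicator (\<Union>i<m. A i) (X x)" for m x
        using union(1) by (subst indicator_UN_disjoint) (auto simp: disjoint_family_on_def)
      have gi: "integrable M (?g m)" for m by (intro Bochner_Integration.integrable_sum ii As)
      have "(\<lambda>m. \<integral>x. \<bar>indicator (\<Union>i. A i) (X x) - ?g m x\<bar> \<partial>M) \<longlonglongrightarrow> (\<integral>x. 0 \<partial>M)"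
      proof (rule integral_dominated_convergence[of _ _ _ "\<lambda>_. 1"])
        show "AE x in M. (\<lambda>m. \<bar>indicator (\<Union>i. A i) (X x) - ?g m x\<bar>) \<longlonglongrightarrow> 0"
        proof (rule AE_I2)
          fix x
          have "(\<lambda>m. indicator (\<Union>i<m. A i) (X x) :: real) \<longlonglongrightarrow> indicator (\<Union>i. A i) (X x)"
            by (rule LIMSEQ_indicator_UN)
          then show "(\<lambda>m. \<bar>indicator (\<Union>i. A i) (X x) - ?g m x\<bar>) \<longlonglongrightarrow> 0"
            unfolding g_eq by (auto intro!: tendsto_eq_intros)
        qed
        show "AE x in M. norm \<bar>indicator (\<Union>i. A i) (X x) - ?g m x\<bar> \<le> 1" for m
          unfolding g_eq by (auto simp: indicator_def)
      qed (use im[OF Us] im[OF As] in auto)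
      then obtain m where m: "(\<integral>x. \<bar>indicator (\<Union>i. A i) (X x) - ?g m x\<bar> \<partial>M) < e"
        using order_tendstoD(2)[of _ 0 sequentially e] e by (auto simp: eventually_sequentially)
      have "(\<lambda>n. \<integral>x. ?g m x * k n x \<partial>M) \<longlonglongrightarrow> 0"
      proof -
        have "(\<integral>x. ?g m x * k n x \<partial>M) = (\<Sum>i<m. \<integral>x. indicator (A i) (X x) * k n x \<partial>M)" for n
          unfolding sum_distrib_right by (rule Bochner_Integration.integral_sum) (intro ik ii As)
        then show ?thesis using tendsto_sum[of "{..<m}" "\<lambda>i n. \<integral>x. indicator (A i) (X x) * k n x \<partial>M" "\<lambda>_. 0"] union.IH by simp
      qed
      then show "\<exists>g. integrable M g \<and> (\<integral>x. \<bar>indicator (\<Union>i. A i) (X x) - g x\<bar> \<partial>M) \<le> e \<and> (\<lambda>n. \<integral>x. g x * k n x \<partial>M) \<longlonglongrightarrow> 0"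
        using gi m by (intro exI[of _ "?g m"]) auto
    qed
  qed
qed

lemma (in finite_measure) tendsto_integral_sets_imp_integrable:
  fixes k :: "nat \<Rightarrow> 'a \<Rightarrow> real" and f :: "'a \<Rightarrow> real"
  assumes k: "\<And>n. k n \<in> borel_measurable M" "\<And>n x. x \<in> space M \<Longrightarrow> \<bar>k n x\<bar> \<le> B"
    and lim: "\<And>A. A \<in> sets M \<Longrightarrow> (\<lambda>n. \<integral>x. indicator A x * k n x \<partial>M) \<longlonglongrightarrow> 0"
    and f: "integrable M f"
  shows "(\<lambda>n. \<integral>x. f x * k n x \<partial>M) \<longlonglongrightarrow> 0"
  using f
proof (induction rule: integrable_induct)
  case (base A c)
  have "(\<integral>x. (indicator A x *\<^sub>R c) * k n x \<partial>M) = c * (\<integral>x. indicator A x * k n x \<partial>M)" for n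
    by (subst integral_mult_right_zero[symmetric]) (simp add: mult_ac)
  then show ?case using tendsto_mult_left[OF lim[OF base(1)], of c] by simp
next
  case (add f g)
  have ik: "integrable M (\<lambda>x. h x * k n x)" if "integrable M h" for h n
    using bounded_mult_integrable(1)[OF k(1) that, of n B] k(2) by (auto simp: mult.commute)
  have "(\<integral>x. (f x + g x) * k n x \<partial>M) = (\<integral>x. f x * k n x \<partial>M) + (\<integral>x. g x * k n x \<partial>M)" for n
    unfolding distrib_right by (intro Bochner_Integration.integral_add ik add)
  then show ?case using tendsto_add[OF add.IH] by simp
next
  case (lim f s)
  show ?case
  proof (rule tendsto_integral_approx[OF k lim.hyps(4)])
    fix e :: real assume e: "0 < e"
    have "(\<lambda>i. \<integral>x. \<bar>f x - s i x\<bar> \<partial>M) \<longlonglongrightarrow> (\<integral>x. 0 \<partial>M)"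
    proof (rule integral_dominated_convergence[of _ _ _ "\<lambda>x. 3 * \<bar>f x\<bar>"])
      show "AE x in M. (\<lambda>i. \<bar>f x - s i x\<bar>) \<longlonglongrightarrow> 0"
      proof (rule AE_I2)
        fix x assume "x \<in> space M"
        from tendsto_rabs[OF tendsto_diff[OF tendsto_const lim.hyps(2)[OF this]], of "f x"]
        show "(\<lambda>i. \<bar>f x - s i x\<bar>) \<longlonglongrightarrow> 0" by simp
      qed
      show "AE x in M. norm \<bar>f x - s i x\<bar> \<le> 3 * \<bar>f x\<bar>" for i
      proof (rule AE_I2)
        fix x assume "x \<in> space M"
        from lim.hyps(3)[OF this, of i] show "norm \<bar>f x - s i x\<bar> \<le> 3 * \<bar>f x\<bar>" by simp
      qed
    qed (use lim.hyps(1,4) in auto)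
    then obtain i where "(\<integral>x. \<bar>f x - s i x\<bar> \<partial>M) < e"
      using order_tendstoD(2)[of _ 0 sequentially e] e by (auto simp: eventually_sequentially)
    then show "\<exists>g. integrable M g \<and> (\<integral>x. \<bar>f x - g x\<bar> \<partial>M) \<le> e \<and> (\<lambda>n. \<integral>x. g x * k n x \<partial>M) \<longlonglongrightarrow> 0"
      using lim.hyps(1) lim.IH by (intro exI[of _ "s i"]) auto
  qed
qed

context lsv_random begin

lemma cylinder_measure:
  assumes "finite J" "\<And>j. j \<in> J \<Longrightarrow> E j \<in> sets \<nu>"
  shows "measure P {\<omega> \<in> space P. \<forall>j\<in>J. \<omega> j \<in> E j} = (\<Prod>j\<in>J. measure \<nu> (E j))"
proof -
  interpret pp: product_prob_space "\<lambda>_. \<nu>" "UNIV :: int set" ..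
  have "{\<omega> \<in> space P. \<forall>j\<in>J. \<omega> j \<in> E j} = prod_emb UNIV (\<lambda>_. \<nu>) J (\<Pi>\<^sub>E j\<in>J. E j)"
    unfolding P_def by (auto simp: prod_emb_def space_PiM PiE_iff)
  then show ?thesis unfolding P_def by (simp add: pp.measure_PiM_emb assms)
qed

lemma cylinder_mixing:
  assumes A: "A \<in> prod_algebra (UNIV :: int set) (\<lambda>_. \<nu>)" and B: "B \<in> prod_algebra (UNIV :: int set) (\<lambda>_. \<nu>)"
  shows "\<exists>N. \<forall>n\<ge>N. measure P (A \<inter> (shift (int n) -` B \<inter> space P)) = measure P A * measure P B"
proof -
  obtain J E where A: "A = prod_emb UNIV (\<lambda>_. \<nu>) J (\<Pi>\<^sub>E j\<in>J. E j)" "finite J" "E \<in> (\<Pi> i\<in>J. sets \<nu>)"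
    using A unfolding prod_algebra_def by auto
  obtain J' E' where B: "B = prod_emb UNIV (\<lambda>_. \<nu>) J' (\<Pi>\<^sub>E j\<in>J'. E' j)" "finite J'" "E' \<in> (\<Pi> i\<in>J'. sets \<nu>)"
    using B unfolding prod_algebra_def by auto
  have E: "i \<in> J \<Longrightarrow> E i \<in> sets \<nu>" and E': "i \<in> J' \<Longrightarrow> E' i \<in> sets \<nu>" for i
    using A(3) B(3) by auto
  have A': "A = {\<omega> \<in> space P. \<forall>j\<in>J. \<omega> j \<in> E j}" and B': "B = {\<omega> \<in> space P. \<forall>j\<in>J'. \<omega> j \<in> E' j}"
    unfolding A B P_def by (auto simp: prod_emb_def space_PiM PiE_iff)
  obtain b where b: "\<And>j. j \<in> J \<union> J' \<Longrightarrow> \<bar>j\<bar> \<le> b"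
  proof -
    have "finite (abs ` (J \<union> J'))" using A(2) B(2) by simp
    then have "\<forall>j\<in>J \<union> J'. \<bar>j\<bar> \<le> Max (insert 0 (abs ` (J \<union> J')))" by (auto intro!: Max_ge)
    then show ?thesis using that by blast
  qed
  show ?thesis
  proof (intro exI[of _ "nat (2 * b + 1)"] allI impI)
    fix n assume "nat (2 * b + 1) \<le> n"
    then have n: "2 * b + 1 \<le> int n" by linarith
    define K where "K = (\<lambda>j. j + int n) ` J'"
    define F where "F i = (if i \<in> J then E i else E' (i - int n))" for i
    have disj: "J \<inter> K = {}"
    proof -
      have False if "j \<in> J" "j' \<in> J'" "j = j' + int n" for j j'
        using b[of j] b[of j'] that n by auto
      then show ?thesis by (auto simp: K_def)
    qed
    have FK: "F (j + int n) = E' j" if "j \<in> J'" for j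
      using disj that by (auto simp: F_def K_def)
    have fin: "finite (J \<union> K)" using A(2) B(2) by (simp add: K_def)
    have F: "F j \<in> sets \<nu>" if "j \<in> J \<union> K" for j
      using that E E' FK by (auto simp: K_def) (auto simp: F_def E)
    have "A \<inter> (shift (int n) -` B \<inter> space P) = {\<omega> \<in> space P. \<forall>j\<in>J \<union> K. \<omega> j \<in> F j}"
    proof (intro set_eqI iffI)
      fix \<omega> assume "\<omega> \<in> A \<inter> (shift (int n) -` B \<inter> space P)"
      then have w: "\<omega> \<in> space P" "\<forall>j\<in>J. \<omega> j \<in> E j" "\<forall>j\<in>J'. \<omega> (j + int n) \<in> E' j"
        by (auto simp: A' B' shift_def)
      then show "\<omega> \<in> {\<omega> \<in> space P. \<forall>j\<in>J \<union> K. \<omega> j \<in> F j}"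
        using FK by (auto simp: K_def) (simp add: F_def)
    next
      fix \<omega> assume w: "\<omega> \<in> {\<omega> \<in> space P. \<forall>j\<in>J \<union> K. \<omega> j \<in> F j}"
      have "\<omega> (j + int n) \<in> E' j" if "j \<in> J'" for j
      proof -
        have "j + int n \<in> K" using that by (auto simp: K_def)
        then have "\<omega> (j + int n) \<in> F (j + int n)" using w by auto
        then show ?thesis using FK[OF that] by simp
      qed
      moreover have "\<omega> j \<in> E j" if "j \<in> J" for j
      proof -
        have "\<omega> j \<in> F j" using w that by auto
        then show ?thesis using that by (simp add: F_def)
      qed
      ultimately show "\<omega> \<in> A \<inter> (shift (int n) -` B \<inter> space P)"
        using w shift_space_P[of \<omega> "int n"] by (auto simp: A' B' shift_def)
    qed
    then have "measure P (A \<inter> (shift (int n) -` B \<inter> space P)) = (\<Prod>j\<in>J \<union> K. measure \<nu> (F j))"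
      by (simp only: cylinder_measure[OF fin F])
    also have "\<dots> = (\<Prod>j\<in>J. measure \<nu> (F j)) * (\<Prod>j\<in>K. measure \<nu> (F j))"
      by (rule prod.union_disjoint) (use A(2) B(2) disj in \<open>auto simp: K_def\<close>)
    also have "(\<Prod>j\<in>J. measure \<nu> (F j)) = (\<Prod>j\<in>J. measure \<nu> (E j))" by (intro prod.cong) (auto simp: F_def)
    also have "(\<Prod>j\<in>K. measure \<nu> (F j)) = (\<Prod>j\<in>J'. measure \<nu> (E' j))"
      unfolding K_def by (subst prod.reindex) (auto simp: inj_on_def FK intro!: prod.cong)
    also have "(\<Prod>j\<in>J. measure \<nu> (E j)) * (\<Prod>j\<in>J'. measure \<nu> (E' j)) = measure P A * measure P B"
      unfolding A' B' by (simp only: cylinder_measure[OF A(2) E] cylinder_measure[OF B(2) E'])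
    finally show "measure P (A \<inter> (shift (int n) -` B \<inter> space P)) = measure P A * measure P B" .
  qed
qed

lemma sets_P: "sets P = sigma_sets (space P) (prod_algebra UNIV (\<lambda>_. \<nu>))"
  unfolding P_def sets_PiM space_PiM ..

lemma prod_algebra_P: "prod_algebra UNIV (\<lambda>_. \<nu>) \<subseteq> Pow (space P)" "prod_algebra UNIV (\<lambda>_. \<nu>) \<subseteq> sets P"
  unfolding sets_P using prod_algebra_sets_into_space[of "UNIV :: int set" "\<lambda>_. \<nu>"] by (auto simp: P_def space_PiM)

lemma shift_mixing_cylinder:
  assumes B: "B \<in> prod_algebra (UNIV :: int set) (\<lambda>_. \<nu>)" and f: "integrable P f"
  shows "(\<lambda>n. \<integral>\<omega>. f \<omega> * (indicator B (shift (int n) \<omega>) - measure P B) \<partial>P) \<longlonglongrightarrow> 0"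
proof (rule P.tendsto_integral_sets_imp_integrable[OF _ _ _ f])
  have Bs: "B \<in> sets P" using B prod_algebra_P by auto
  show k: "(\<lambda>\<omega>. indicator B (shift (int n) \<omega>) - measure P B :: real) \<in> borel_measurable P" for n
  proof -
    have "(\<lambda>\<omega>. indicator B (shift (int n) \<omega>) :: real) \<in> borel_measurable P"
      by (rule measurable_compose[OF shift_P borel_measurable_indicator[OF Bs]])
    then show ?thesis by simp
  qed
  show kb: "\<bar>indicator B (shift (int n) \<omega>) - measure P B :: real\<bar> \<le> 1" for n \<omega>
    by (cases "shift (int n) \<omega> \<in> B") (auto simp: abs_le_iff intro: order_trans[OF P.prob_le_1] order_trans[OF _ measure_nonneg])
  have int: "(\<integral>\<omega>. indicator A \<omega> * (indicator B (shift (int n) \<omega>) - measure P B) \<partial>P)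
     = measure P (A \<inter> (shift (int n) -` B \<inter> space P)) - measure P A * measure P B" if A: "A \<in> sets P" for A n
  proof -
    have S: "A \<inter> (shift (int n) -` B \<inter> space P) \<in> sets P" using A measurable_sets[OF shift_P Bs] by auto
    have "(\<integral>\<omega>. indicator A \<omega> * (indicator B (shift (int n) \<omega>) - measure P B) \<partial>P) =
      (\<integral>\<omega>. indicator (A \<inter> (shift (int n) -` B \<inter> space P)) \<omega> - measure P B * indicator A \<omega> \<partial>P)"
      by (intro Bochner_Integration.integral_cong) (auto simp: indicator_def)
    also have "\<dots> = measure P (A \<inter> (shift (int n) -` B \<inter> space P)) - measure P A * measure P B"
      using S A by (subst Bochner_Integration.integral_diff) (auto simp: P.emeasure_eq_measure mult.commute)
    finally show ?thesis .
  qed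
  have cyl: "(\<lambda>n. \<integral>\<omega>. indicator A \<omega> * (indicator B (shift (int n) \<omega>) - measure P B) \<partial>P) \<longlonglongrightarrow> 0"
    if A: "A \<in> prod_algebra UNIV (\<lambda>_. \<nu>)" for A
  proof -
    obtain N where "\<forall>n\<ge>N. measure P (A \<inter> (shift (int n) -` B \<inter> space P)) = measure P A * measure P B"
      using cylinder_mixing[OF A B] by blast
    then show ?thesis unfolding int[OF subsetD[OF prod_algebra_P(2) A]]
      by (intro tendsto_eventually) (auto simp: eventually_sequentially)
  qed
  have sp: "(\<lambda>n. \<integral>\<omega>. (indicator B (shift (int n) \<omega>) - measure P B) \<partial>P) \<longlonglongrightarrow> 0"
  proof -
    have "(\<integral>\<omega>. (indicator B (shift (int n) \<omega>) - measure P B) \<partial>P) = 0" for n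
    proof -
      have "{\<omega> \<in> space P. \<omega> \<in> B} = B" using sets.sets_into_space[OF Bs] by auto
      then have "measure P {\<omega> \<in> space P. shift (int n) \<omega> \<in> B} = measure P B"
        using measure_shift[of "\<lambda>\<omega>. \<omega> \<in> B" "int n"] Bs by simp
      moreover have "space P \<inter> (shift (int n) -` B \<inter> space P) = {\<omega> \<in> space P. shift (int n) \<omega> \<in> B}" by auto
      moreover have "(\<integral>\<omega>. (indicator B (shift (int n) \<omega>) - measure P B) \<partial>P)
         = (\<integral>\<omega>. indicator (space P) \<omega> * (indicator B (shift (int n) \<omega>) - measure P B) \<partial>P)"
        by (intro Bochner_Integration.integral_cong) auto
      ultimately show ?thesis using int[OF sets.top, of n] P.prob_space by simp
    qed
    then show ?thesis by simp
  qed
  fix A assume A: "A \<in> sets P"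
  show "(\<lambda>n. \<integral>\<omega>. indicator A \<omega> * (indicator B (shift (int n) \<omega>) - measure P B) \<partial>P) \<longlonglongrightarrow> 0"
    by (rule P.tendsto_integral_generator[OF k kb measurable_ident_sets[OF refl] Int_stable_prod_algebra prod_algebra_P(1) sets_P cyl sp A])
qed

lemma integral_shift:
  assumes "f \<in> borel_measurable P"
  shows "(\<integral>\<omega>. f (shift m \<omega>) \<partial>P) = (\<integral>\<omega>. f \<omega> \<partial>P :: real)"
  using integral_distr[OF shift_P[of m] assms] by (simp add: distr_shift)

lemma shift_mixing:
  fixes f g :: "(int \<Rightarrow> real) \<Rightarrow> real"
  assumes f: "f \<in> borel_measurable P" "\<And>\<omega>. \<omega> \<in> space P \<Longrightarrow> \<bar>f \<omega>\<bar> \<le> B" and g: "integrable P g"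
  shows "(\<lambda>n. \<integral>\<omega>. f \<omega> * g (shift (int n) \<omega>) \<partial>P) \<longlonglongrightarrow> (\<integral>\<omega>. f \<omega> \<partial>P) * (\<integral>\<omega>. g \<omega> \<partial>P)"
proof -
  define c where "c = (\<integral>\<omega>. f \<omega> \<partial>P)"
  have fi: "integrable P f" by (rule P.integrable_const_bound[of _ B]) (use f in auto)
  define k where "k n \<omega> = f (shift (- int n) \<omega>) - c" for n \<omega>
  have km: "k n \<in> borel_measurable P" for n
    unfolding k_def using measurable_compose[OF shift_P f(1)] by simp
  have kb: "\<bar>k n \<omega>\<bar> \<le> B + \<bar>c\<bar>" if "\<omega> \<in> space P" for n \<omega>
    unfolding k_def using f(2)[OF shift_space_P[OF that]] by (intro order_trans[OF abs_triangle_ineq4] add_mono) auto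
  have swap: "(\<integral>\<omega>. h \<omega> * k n \<omega> \<partial>P) = (\<integral>\<omega>. f \<omega> * h (shift (int n) \<omega>) \<partial>P) - c * (\<integral>\<omega>. h \<omega> \<partial>P)" if h: "integrable P h" for h n
  proof -
    have hm: "h \<in> borel_measurable P" using h by simp
    have fh: "(\<lambda>\<omega>. f \<omega> * h (shift (int n) \<omega>)) \<in> borel_measurable P"
      using f(1) measurable_compose[OF shift_P hm] by simp
    have i1: "integrable P (\<lambda>\<omega>. f (shift (- int n) \<omega>) * h \<omega>)"
      by (rule bounded_mult_integrable(1)[OF measurable_compose[OF shift_P f(1)] h, of _ B]) (use f(2) shift_space_P in auto)
    have "(\<integral>\<omega>. f \<omega> * h (shift (int n) \<omega>) \<partial>P) = (\<integral>\<omega>. f (shift (- int n) \<omega>) * h \<omega> \<partial>P)"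
      using integral_shift[OF fh, of "- int n"] by simp
    moreover have "(\<integral>\<omega>. h \<omega> * k n \<omega> \<partial>P) = (\<integral>\<omega>. f (shift (- int n) \<omega>) * h \<omega> - c * h \<omega> \<partial>P)"
      by (intro Bochner_Integration.integral_cong) (auto simp: k_def algebra_simps)
    ultimately show ?thesis using i1 h by simp
  qed
  have cyl: "(\<lambda>n. \<integral>\<omega>. indicator A \<omega> * k n \<omega> \<partial>P) \<longlonglongrightarrow> 0" if A: "A \<in> prod_algebra UNIV (\<lambda>_. \<nu>)" for A
  proof -
    have As: "A \<in> sets P" using A prod_algebra_P by auto
    have iA: "integrable P (indicator A :: _ \<Rightarrow> real)" using As by (simp add: P.emeasure_eq_measure)
    have "(\<integral>\<omega>. f \<omega> * (indicator A (shift (int n) \<omega>) - measure P A) \<partial>P) = (\<integral>\<omega>. indicator A \<omega> * k n \<omega> \<partial>P)" for n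
    proof -
      have "integrable P (\<lambda>\<omega>. f \<omega> * indicator A (shift (int n) \<omega>))"
        using bounded_mult_integrable(1)[OF measurable_compose[OF shift_P borel_measurable_indicator[OF As]] fi, of "int n" 1]
        by (simp add: mult.commute indicator_def)
      then have "(\<integral>\<omega>. f \<omega> * (indicator A (shift (int n) \<omega>) - measure P A) \<partial>P)
         = (\<integral>\<omega>. f \<omega> * indicator A (shift (int n) \<omega>) \<partial>P) - c * measure P A"
        unfolding right_diff_distrib c_def using fi by simp
      then show ?thesis unfolding swap[OF iA] using As by simp
    qed
    then show ?thesis using shift_mixing_cylinder[OF A fi] by simp
  qed
  have sp: "(\<lambda>n. \<integral>\<omega>. k n \<omega> \<partial>P) \<longlonglongrightarrow> 0"
    using swap[of "\<lambda>_. 1"] by (simp add: c_def P.prob_space)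
  have st: "(\<lambda>n. \<integral>\<omega>. indicator A \<omega> * k n \<omega> \<partial>P) \<longlonglongrightarrow> 0" if "A \<in> sets P" for A
    by (rule P.tendsto_integral_generator[OF km kb measurable_ident_sets[OF refl] Int_stable_prod_algebra prod_algebra_P(1) sets_P cyl sp that])
  have "(\<lambda>n. \<integral>\<omega>. g \<omega> * k n \<omega> \<partial>P) \<longlonglongrightarrow> 0"
    by (rule P.tendsto_integral_sets_imp_integrable[OF km kb st g])
  then have "(\<lambda>n. (\<integral>\<omega>. f \<omega> * g (shift (int n) \<omega>) \<partial>P) - c * (\<integral>\<omega>. g \<omega> \<partial>P)) \<longlonglongrightarrow> 0"
    unfolding swap[OF g] .
  then show ?thesis unfolding c_def by (simp add: LIM_zero_iff)
qed

sublocale PU: pair_sigma_finite P U ..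

lemma gl_coord_measurable:
  "(\<lambda>z. (fst z, gl (fst z i) (snd z))) \<in> P \<Otimes>\<^sub>M U \<rightarrow>\<^sub>M P \<Otimes>\<^sub>M U"
proof -
  have c: "(\<lambda>z. fst z i) \<in> borel_measurable (P \<Otimes>\<^sub>M U)" by (rule measurable_compose[OF measurable_fst coord_borel])
  have s: "snd \<in> borel_measurable (P \<Otimes>\<^sub>M U)" by (rule measurable_compose[OF measurable_snd id_U])
  have pos: "0 < fst z i \<and> 0 < snd z \<and> snd z \<le> 1" if "z \<in> space (P \<Otimes>\<^sub>M U)" for z
    using that admD(1)[OF adm_P] by (auto simp: space_pair_measure)
  have "(\<lambda>z. gl (fst z i) (snd z)) \<in> P \<Otimes>\<^sub>M U \<rightarrow>\<^sub>M U"
  proof (rule measurable_to_U[OF gl_measurable_joint[OF c s pos]])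
    fix z assume "z \<in> space (P \<Otimes>\<^sub>M U)"
    from pos[OF this] show "0 < gl (fst z i) (snd z) \<and> gl (fst z i) (snd z) \<le> 1"
      using gl_props[of "fst z i" "snd z"] by auto
  qed
  then show ?thesis by (intro measurable_Pair measurable_fst)
qed

lemma Lit_joint:
  assumes "(\<lambda>z. f (fst z) (snd z)) \<in> borel_measurable (P \<Otimes>\<^sub>M U)"
  shows "(\<lambda>z. Lit n (fst z) (f (fst z)) (snd z)) \<in> borel_measurable (P \<Otimes>\<^sub>M U)"
proof (induction n)
  case (Suc n)
  have g: "(\<lambda>z. gl (fst z (int n)) (snd z)) \<in> borel_measurable (P \<Otimes>\<^sub>M U)"
    using measurable_compose[OF measurable_compose[OF gl_coord_measurable[of "int n"] measurable_snd] id_U] by simp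
  have c: "(\<lambda>z. fst z (int n)) \<in> borel_measurable (P \<Otimes>\<^sub>M U)" by (rule measurable_compose[OF measurable_fst coord_borel])
  have d: "(\<lambda>z. dlsv (fst z (int n)) (gl (fst z (int n)) (snd z))) \<in> borel_measurable (P \<Otimes>\<^sub>M U)"
    unfolding dlsv_def using g c by measurable
  have h: "(\<lambda>z. (fst z, (snd z + 1) / 2)) \<in> P \<Otimes>\<^sub>M U \<rightarrow>\<^sub>M P \<Otimes>\<^sub>M U"
    by (intro measurable_Pair measurable_fst measurable_compose[OF measurable_snd half_U])
  have a: "(\<lambda>z. Lit n (fst z) (f (fst z)) (gl (fst z (int n)) (snd z))) \<in> borel_measurable (P \<Otimes>\<^sub>M U)"
    using measurable_compose[OF gl_coord_measurable[of "int n"] Suc.IH] by simp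
  have b: "(\<lambda>z. Lit n (fst z) (f (fst z)) ((snd z + 1) / 2)) \<in> borel_measurable (P \<Otimes>\<^sub>M U)"
    using measurable_compose[OF h Suc.IH] by simp
  have "(\<lambda>z. Lit n (fst z) (f (fst z)) (gl (fst z (int n)) (snd z)) / dlsv (fst z (int n)) (gl (fst z (int n)) (snd z))
       + Lit n (fst z) (f (fst z)) ((snd z + 1) / 2) / 2) \<in> borel_measurable (P \<Otimes>\<^sub>M U)"
    using a b d by simp
  then show ?case by (simp add: Lop_def L0_def L1_def)
qed (use assms in simp)

lemma shift_fst_measurable: "(\<lambda>z. (shift m (fst z), snd z)) \<in> P \<Otimes>\<^sub>M U \<rightarrow>\<^sub>M P \<Otimes>\<^sub>M U"
  by (intro measurable_Pair measurable_snd measurable_compose[OF measurable_fst shift_P])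

lemma hinv_joint: "(\<lambda>z. hinv (fst z) (snd z)) \<in> borel_measurable (P \<Otimes>\<^sub>M U)"
proof (rule borel_measurable_LIMSEQ_real)
  show "(\<lambda>n. Lit n (shift (- int n) (fst z)) (\<lambda>_. 1) (snd z)) \<longlonglongrightarrow> hinv (fst z) (snd z)" if "z \<in> space (P \<Otimes>\<^sub>M U)" for z
    using that by (intro hinv_limit[OF adm_P]) (auto simp: space_pair_measure)
  have "(\<lambda>z. Lit n (fst z) (\<lambda>_. 1) (snd z)) \<in> borel_measurable (P \<Otimes>\<^sub>M U)" for n
    using Lit_joint[of "\<lambda>_ _. 1" n] by simp
  from measurable_compose[OF shift_fst_measurable this]
  show "(\<lambda>z. Lit n (shift (- int n) (fst z)) (\<lambda>_. 1) (snd z)) \<in> borel_measurable (P \<Otimes>\<^sub>M U)" for n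
    by simp
qed

lemma rlsv_iter_joint: "(\<lambda>z. rlsv_iter n (fst z) (snd z)) \<in> P \<Otimes>\<^sub>M U \<rightarrow>\<^sub>M U"
proof (rule measurable_to_U)
  show "(\<lambda>z. rlsv_iter n (fst z) (snd z)) \<in> borel_measurable (P \<Otimes>\<^sub>M U)"
  proof (induction n)
    case 0
    show ?case using measurable_compose[OF measurable_snd id_U, of P] by simp
  next
    case (Suc n)
    have [measurable]: "(\<lambda>z. fst z (int n)) \<in> borel_measurable (P \<Otimes>\<^sub>M U)" by (rule measurable_compose[OF measurable_fst coord_borel])
    note [measurable] = Suc.IH
    have e: "rlsv_iter (Suc n) w x = (if rlsv_iter n w x \<le> 1/2
      then rlsv_iter n w x * (1 + 2 powr (w (int n)) * rlsv_iter n w x powr (w (int n))) else 2 * rlsv_iter n w x - 1)" for w x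
      by (simp add: rlsv_def lsv_def shift_def)
    show ?case unfolding e by measurable
  qed
  fix z assume z: "z \<in> space (P \<Otimes>\<^sub>M U)"
  have "rlsv_iter n (fst z) \<in> U \<rightarrow>\<^sub>M U" using z by (intro rlsv_iter_U[OF adm_P]) (auto simp: space_pair_measure)
  from measurable_space[OF this, of "snd z"] show "0 < rlsv_iter n (fst z) (snd z) \<and> rlsv_iter n (fst z) (snd z) \<le> 1"
    using z by (auto simp: space_pair_measure)
qed

definition skew :: "nat \<Rightarrow> (int \<Rightarrow> real) \<times> real \<Rightarrow> (int \<Rightarrow> real) \<times> real" where
  "skew n z = (shift (int n) (fst z), rlsv_iter n (fst z) (snd z))"

lemma skew_measurable: "skew n \<in> P \<Otimes>\<^sub>M U \<rightarrow>\<^sub>M P \<Otimes>\<^sub>M U"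
  unfolding skew_def[abs_def] by (intro measurable_Pair measurable_compose[OF measurable_fst shift_P] rlsv_iter_joint)

definition R :: "((int \<Rightarrow> real) \<times> real) measure" where
  "R = density (P \<Otimes>\<^sub>M U) (\<lambda>z. ennreal (hinv (fst z) (snd z)))"

lemma sets_R [measurable_cong]: "sets R = sets (P \<Otimes>\<^sub>M U)" and space_R: "space R = space P \<times> {0<..1}"
  by (simp_all add: R_def space_pair_measure)

lemma measurable_R: "f \<in> borel_measurable R \<longleftrightarrow> f \<in> borel_measurable (P \<Otimes>\<^sub>M U)"
  by (simp add: R_def)

lemma hinv_nonneg: "\<omega> \<in> space P \<Longrightarrow> 0 < x \<Longrightarrow> x \<le> 1 \<Longrightarrow> 0 \<le> hinv \<omega> x"
  using lcone_nonneg[OF hinv_lcone[OF adm_P]] by blast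

lemma nn_integral_R:
  assumes [measurable]: "f \<in> borel_measurable (P \<Otimes>\<^sub>M U)"
  shows "(\<integral>\<^sup>+z. f z \<partial>R) = (\<integral>\<^sup>+\<omega>. \<integral>\<^sup>+x. ennreal (hinv \<omega> x) * f (\<omega>, x) \<partial>U \<partial>P)"
proof -
  note [measurable] = hinv_joint
  have "(\<integral>\<^sup>+z. f z \<partial>R) = (\<integral>\<^sup>+z. ennreal (hinv (fst z) (snd z)) * f z \<partial>(P \<Otimes>\<^sub>M U))"
    unfolding R_def by (rule nn_integral_density) measurable
  also have "\<dots> = (\<integral>\<^sup>+\<omega>. \<integral>\<^sup>+x. ennreal (hinv \<omega> x) * f (\<omega>, x) \<partial>U \<partial>P)"
    by (subst U.nn_integral_fst[symmetric]) auto
  finally show ?thesis .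
qed

lemma prob_space_R: "prob_space R"
proof (rule prob_spaceI)
  have "emeasure R (space R) = (\<integral>\<^sup>+z. 1 \<partial>R)" by simp
  also have "\<dots> = (\<integral>\<^sup>+\<omega>. 1 \<partial>P)"
    unfolding nn_integral_R[OF borel_measurable_const]
    by (intro nn_integral_cong) (simp add: nn_integral_hinv[OF adm_P])
  finally show "emeasure R (space R) = 1" by (simp add: P.emeasure_space_1)
qed

sublocale R: prob_space R by (rule prob_space_R)

lemma integral_R:
  fixes f :: "_ \<Rightarrow> real"
  assumes f: "integrable R f"
  shows "(\<integral>z. f z \<partial>R) = (\<integral>\<omega>. \<integral>x. f (\<omega>, x) * hinv \<omega> x \<partial>U \<partial>P)"
    and "(\<integral>z. f z \<partial>R) = (\<integral>\<omega>. \<integral>x. f (\<omega>, x) \<partial>mu \<omega> \<partial>P)"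
proof -
  have fm: "f \<in> borel_measurable (P \<Otimes>\<^sub>M U)" using f by (simp add: measurable_R[symmetric])
  have nn: "AE z in P \<Otimes>\<^sub>M U. 0 \<le> hinv (fst z) (snd z)"
    by (rule AE_I2) (auto simp: space_pair_measure hinv_nonneg)
  have "integrable (P \<Otimes>\<^sub>M U) (\<lambda>z. hinv (fst z) (snd z) * f z)"
    using f unfolding R_def integrable_density[OF fm hinv_joint nn] by simp
  then have i: "integrable (P \<Otimes>\<^sub>M U) (\<lambda>z. f z * hinv (fst z) (snd z))" by (simp add: mult.commute)
  have "(\<integral>z. f z \<partial>R) = (\<integral>z. f z * hinv (fst z) (snd z) \<partial>(P \<Otimes>\<^sub>M U))"
    unfolding R_def integral_density[OF fm hinv_joint nn] by (simp add: mult.commute)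
  also have "\<dots> = (\<integral>\<omega>. \<integral>x. f (\<omega>, x) * hinv \<omega> x \<partial>U \<partial>P)"
    using PU.integral_fst'[OF i] by simp
  finally show 1: "(\<integral>z. f z \<partial>R) = (\<integral>\<omega>. \<integral>x. f (\<omega>, x) * hinv \<omega> x \<partial>U \<partial>P)" .
  show "(\<integral>z. f z \<partial>R) = (\<integral>\<omega>. \<integral>x. f (\<omega>, x) \<partial>mu \<omega> \<partial>P)"
    unfolding 1
    by (intro Bochner_Integration.integral_cong refl integral_mu[OF adm_P, symmetric]
        measurable_compose[OF measurable_Pair1' fm])
qed

lemma distr_skew: "distr R (P \<Otimes>\<^sub>M U) (skew n) = R"
proof (rule measure_eqI)
  have T: "skew n \<in> R \<rightarrow>\<^sub>M P \<Otimes>\<^sub>M U"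
    using skew_measurable by (simp add: R_def)
  fix A assume "A \<in> sets (distr R (P \<Otimes>\<^sub>M U) (skew n))"
  then have A: "A \<in> sets (P \<Otimes>\<^sub>M U)" by simp
  have iA: "(indicator A :: _ \<Rightarrow> ennreal) \<in> borel_measurable (P \<Otimes>\<^sub>M U)" using A by simp
  define G where "G \<omega> = (\<integral>\<^sup>+x. ennreal (hinv \<omega> x) * indicator A (\<omega>, x) \<partial>U)" for \<omega>
  have Gm: "G \<in> borel_measurable P"
  proof -
    have "(\<lambda>z. ennreal (hinv (fst z) (snd z)) * indicator A z) \<in> borel_measurable (P \<Otimes>\<^sub>M U)"
      using hinv_joint iA by measurable
    from U.borel_measurable_nn_integral_fst[OF this] show ?thesis unfolding G_def by simp
  qed
  have "emeasure (distr R (P \<Otimes>\<^sub>M U) (skew n)) A = (\<integral>\<^sup>+z. indicator A z \<partial>distr R (P \<Otimes>\<^sub>M U) (skew n))"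
    using A by simp
  also have "\<dots> = (\<integral>\<^sup>+z. indicator A (skew n z) \<partial>R)"
    by (rule nn_integral_distr[OF T]) (use iA in simp)
  also have "\<dots> = (\<integral>\<^sup>+\<omega>. \<integral>\<^sup>+x. ennreal (hinv \<omega> x) * indicator A (skew n (\<omega>, x)) \<partial>U \<partial>P)"
    by (rule nn_integral_R[OF measurable_compose[OF skew_measurable iA]])
  also have "\<dots> = (\<integral>\<^sup>+\<omega>. G (shift (int n) \<omega>) \<partial>P)"
  proof (intro nn_integral_cong)
    fix \<omega> assume w: "\<omega> \<in> space P"
    note l = hinv_lcone[OF adm_P[OF w]]
    have hm: "hinv \<omega> \<in> borel_measurable U" by (rule lcone_measurable[OF l])
    have hn: "0 \<le> hinv \<omega> x" if "0 < x" "x \<le> 1" for x by (rule hinv_nonneg[OF w that])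
    have hm': "hinv (shift (int n) \<omega>) \<in> borel_measurable U"
      by (rule lcone_measurable[OF hinv_lcone[OF adm_P[OF shift_space_P[OF w]]]])
    have sec: "(\<lambda>x. indicator A (shift (int n) \<omega>, x) :: ennreal) \<in> borel_measurable U"
      by (rule measurable_compose[OF measurable_Pair1'[OF shift_space_P[OF w]] iA])
    have it: "rlsv_iter n \<omega> \<in> U \<rightarrow>\<^sub>M U" by (rule rlsv_iter_U[OF adm_P[OF w]])
    have "(\<integral>\<^sup>+x. ennreal (hinv \<omega> x) * indicator A (skew n (\<omega>, x)) \<partial>U)
       = (\<integral>\<^sup>+x. indicator A (shift (int n) \<omega>, rlsv_iter n \<omega> x) \<partial>density U (\<lambda>x. ennreal (hinv \<omega> x)))"
      unfolding skew_def using hm measurable_compose[OF it sec] by (subst nn_integral_density) auto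
    also have "\<dots> = (\<integral>\<^sup>+x. indicator A (shift (int n) \<omega>, x) \<partial>distr (density U (\<lambda>x. ennreal (hinv \<omega> x))) U (rlsv_iter n \<omega>))"
      using it sec by (subst nn_integral_distr) auto
    also have "distr (density U (\<lambda>x. ennreal (hinv \<omega> x))) U (rlsv_iter n \<omega>) = density U (\<lambda>x. ennreal (Lit n \<omega> (hinv \<omega>) x))"
      by (rule distr_Lit[OF adm_P[OF w] hm hn])
    also have "\<dots> = density U (\<lambda>x. ennreal (hinv (shift (int n) \<omega>) x))"
      using hm' Lit_measurable[OF adm_P[OF w] hm] Lit_hinv[OF adm_P[OF w]]
      by (intro density_cong) auto
    also have "(\<integral>\<^sup>+x. indicator A (shift (int n) \<omega>, x) \<partial>density U (\<lambda>x. ennreal (hinv (shift (int n) \<omega>) x))) = G (shift (int n) \<omega>)"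
      unfolding G_def using hm' sec by (subst nn_integral_density) auto
    finally show "(\<integral>\<^sup>+x. ennreal (hinv \<omega> x) * indicator A (skew n (\<omega>, x)) \<partial>U) = G (shift (int n) \<omega>)" .
  qed
  also have "\<dots> = (\<integral>\<^sup>+\<omega>. G \<omega> \<partial>P)"
  proof -
    have "(\<integral>\<^sup>+\<omega>. G \<omega> \<partial>distr P P (shift (int n))) = (\<integral>\<^sup>+\<omega>. G (shift (int n) \<omega>) \<partial>P)"
      by (rule nn_integral_distr[OF shift_P]) (use Gm in simp)
    then show ?thesis by (simp add: distr_shift)
  qed
  also have "\<dots> = (\<integral>\<^sup>+z. indicator A z \<partial>R)" unfolding G_def by (rule nn_integral_R[OF iA, symmetric])
  also have "\<dots> = emeasure R A" using A by (simp add: sets_R)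
  finally show "emeasure (distr R (P \<Otimes>\<^sub>M U) (skew n)) A = emeasure R A" .
qed (simp add: sets_R)

lemma skew_R: "skew n \<in> R \<rightarrow>\<^sub>M P \<Otimes>\<^sub>M U"
  using skew_measurable by (simp add: R_def)

lemma integral_skew:
  fixes f :: "_ \<Rightarrow> real"
  assumes "f \<in> borel_measurable (P \<Otimes>\<^sub>M U)"
  shows "(\<integral>z. f (skew n z) \<partial>R) = (\<integral>z. f z \<partial>R)" "integrable R (\<lambda>z. f (skew n z)) \<longleftrightarrow> integrable R f"
  using integral_distr[OF skew_R assms, of n] integrable_distr_eq[OF skew_R assms, of n] by (simp_all add: distr_skew)

lemma fibre_loss:
  assumes supp: "\<And>s. \<alpha>\<^sub>0 < s \<Longrightarrow> 0 < pr s"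
    and \<xi>: "\<xi> \<in> borel_measurable U" and bd: "\<And>x. 0 < x \<Longrightarrow> x \<le> 1 \<Longrightarrow> 0 \<le> \<xi> x \<and> \<xi> x \<le> 1"
    and H: "0 \<le> H" and ho: "\<And>x y. 0 < x \<Longrightarrow> x \<le> 1 \<Longrightarrow> 0 < y \<Longrightarrow> y \<le> 1 \<Longrightarrow> \<bar>\<xi> x - \<xi> y\<bar> \<le> H * \<bar>x - y\<bar>"
  shows "AE \<omega> in P. (\<lambda>n. \<integral>x. \<bar>Lit n \<omega> (\<lambda>x. \<xi> x * hinv \<omega> x) x - mass (\<lambda>x. \<xi> x * hinv \<omega> x) * hinv (shift (int n) \<omega>) x\<bar> \<partial>U) \<longlonglongrightarrow> 0"
proof -
  define \<delta> where "\<delta> = (1 / \<alpha>\<^sub>0 - 1) / 2"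
  define \<kappa> where "\<kappa> = 1 / \<alpha>\<^sub>0 - \<delta> - 1"
  have d: "0 < \<delta>" "0 < \<kappa>" using \<alpha> by (auto simp: \<delta>_def \<kappa>_def field_simps)
  obtain s v K c D where v: "0 < v" "v < 1" and K: "0 \<le> K" and c: "0 < c" and D: "0 \<le> D"
    and tail: "\<forall>k\<ge>1. measure P {\<omega> \<in> space P. \<not> (\<forall>n\<ge>k. allgood s v n \<omega>)} \<le> K * exp (- c * real k powr v)"
    and loss: "loss_rate 1 \<kappa> s v D"
    using quenched_loss[OF supp d(1) zero_less_one] unfolding \<kappa>_def by blast
  have lim0: "(\<lambda>n. (1 + H) * D * real n powr (- \<kappa>)) \<longlonglongrightarrow> 0"
  proof -
    have "(\<lambda>n. real n powr (- \<kappa>)) \<longlonglongrightarrow> 0" using d(2) by real_asymp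
    from tendsto_mult_left[OF this] show ?thesis by simp
  qed
  show ?thesis
    using AE_eventually_good[OF c v(1) tail] AE_space
  proof eventually_elim
    case (elim \<omega>)
    then obtain N where N: "1 \<le> N" "\<And>n. N \<le> n \<Longrightarrow> allgood s v n \<omega>" and w: "\<omega> \<in> space P" by auto
    let ?e = "\<lambda>n. \<integral>x. \<bar>Lit n \<omega> (\<lambda>x. \<xi> x * hinv \<omega> x) x - mass (\<lambda>x. \<xi> x * hinv \<omega> x) * hinv (shift (int n) \<omega>) x\<bar> \<partial>U"
    have ho': "\<bar>\<xi> x - \<xi> y\<bar> \<le> H * \<bar>x - y\<bar> powr 1" if "0 < x" "x \<le> 1" "0 < y" "y \<le> 1" for x y
      using ho[OF that] by simp
    have up: "?e n \<le> (1 + H) * D * real n powr (- \<kappa>)" if n: "N \<le> n" for n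
    proof -
      have n1: "1 \<le> n" using N(1) n by simp
      have g: "good s (pr s) (Tn v n) (shift (int i) \<omega>)" if "i \<le> n" for i
        using N(2)[OF n] that unfolding allgood_def by auto
      show ?thesis by (rule loss_rateD(2)[OF loss w n1 g \<xi> H bd ho']; assumption)
    qed
    show ?case
    proof (rule tendsto_sandwich[OF _ _ tendsto_const lim0])
      show "\<forall>\<^sub>F n in sequentially. 0 \<le> ?e n" by (rule always_eventually) (simp add: Bochner_Integration.integral_nonneg)
      show "\<forall>\<^sub>F n in sequentially. ?e n \<le> (1 + H) * D * real n powr (- \<kappa>)"
        using up by (auto simp: eventually_sequentially)
    qed
  qed
qed

lemma mixing_rectangle_Lipschitz:
  fixes \<phi> :: "(int \<Rightarrow> real) \<times> real \<Rightarrow> real"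
  assumes supp: "\<And>s. \<alpha>\<^sub>0 < s \<Longrightarrow> 0 < pr s"
    and \<phi>: "\<phi> \<in> borel_measurable (P \<Otimes>\<^sub>M U)" "\<And>z. \<bar>\<phi> z\<bar> \<le> b"
    and \<xi>: "\<xi> \<in> borel_measurable U" and bd: "\<And>x. 0 < x \<Longrightarrow> x \<le> 1 \<Longrightarrow> 0 \<le> \<xi> x \<and> \<xi> x \<le> 1"
    and H: "0 \<le> H" and ho: "\<And>x y. 0 < x \<Longrightarrow> x \<le> 1 \<Longrightarrow> 0 < y \<Longrightarrow> y \<le> 1 \<Longrightarrow> \<bar>\<xi> x - \<xi> y\<bar> \<le> H * \<bar>x - y\<bar>"
    and B: "B \<in> sets P"
  shows "(\<lambda>n. \<integral>z. indicator B (fst z) * \<xi> (snd z) * (\<phi> (skew n z) - (\<integral>z. \<phi> z \<partial>R)) \<partial>R) \<longlonglongrightarrow> 0"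
proof -
  define c where "c = (\<integral>z. \<phi> z \<partial>R)"
  define u where "u \<omega> x = \<xi> x * hinv \<omega> x" for \<omega> x
  define e where "e n \<omega> = (\<integral>x. \<bar>Lit n \<omega> (u \<omega>) x - mass (u \<omega>) * hinv (shift (int n) \<omega>) x\<bar> \<partial>U)" for n \<omega>
  define \<Phi> where "\<Phi> \<omega> = (\<integral>y. \<phi> (\<omega>, y) * hinv \<omega> y \<partial>U)" for \<omega>
  define G where "G \<omega> = indicator B \<omega> * mass (u \<omega>)" for \<omega>
  have b0: "0 \<le> b" using \<phi>(2)[of undefined] by (rule order_trans[OF abs_ge_zero])
  have \<xi>2: "(\<lambda>z. \<xi> (snd z)) \<in> borel_measurable (P \<Otimes>\<^sub>M U)" by (rule measurable_compose[OF measurable_snd \<xi>])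
  have um: "(\<lambda>z. u (fst z) (snd z)) \<in> borel_measurable (P \<Otimes>\<^sub>M U)"
    unfolding u_def using \<xi>2 hinv_joint by simp
  have iB: "(\<lambda>z. indicator B (fst z) :: real) \<in> borel_measurable (P \<Otimes>\<^sub>M U)"
    by (rule measurable_compose[OF measurable_fst borel_measurable_indicator[OF B]])
  have mum: "(\<lambda>\<omega>. mass (u \<omega>)) \<in> borel_measurable P"
  proof -
    have "(\<lambda>\<omega>. \<integral>x. u \<omega> x \<partial>U) \<in> borel_measurable P"
      by (rule U.borel_measurable_lebesgue_integral) (use um in \<open>simp add: case_prod_unfold\<close>)
    then show ?thesis by (simp add: mass_def)
  qed
  have hsm: "(\<lambda>z. hinv (shift m (fst z)) (snd z)) \<in> borel_measurable (P \<Otimes>\<^sub>M U)" for m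
    using measurable_compose[OF shift_fst_measurable hinv_joint] by simp
  have mum2: "(\<lambda>z. mass (u (fst z))) \<in> borel_measurable (P \<Otimes>\<^sub>M U)" by (rule measurable_compose[OF measurable_fst mum])
  have em: "e n \<in> borel_measurable P" for n
    unfolding e_def
  proof (rule U.borel_measurable_lebesgue_integral)
    have "(\<lambda>z. \<bar>Lit n (fst z) (u (fst z)) (snd z) - mass (u (fst z)) * hinv (shift (int n) (fst z)) (snd z)\<bar>) \<in> borel_measurable (P \<Otimes>\<^sub>M U)"
      using Lit_joint[OF um, of n] mum2 hsm[of "int n"] by simp
    then show "(\<lambda>(\<omega>, x). \<bar>Lit n \<omega> (u \<omega>) x - mass (u \<omega>) * hinv (shift (int n) \<omega>) x\<bar>) \<in> borel_measurable (P \<Otimes>\<^sub>M U)"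
      by (simp add: case_prod_unfold)
  qed
  have pw: "u \<omega> \<in> borel_measurable U" "\<And>x. 0 < x \<Longrightarrow> x \<le> 1 \<Longrightarrow> 0 \<le> u \<omega> x \<and> u \<omega> x \<le> hinv \<omega> x"
    "0 \<le> mass (u \<omega>)" "mass (u \<omega>) \<le> 1"
    "integrable U (Lit n \<omega> (u \<omega>))" "integrable U (\<lambda>x. mass (u \<omega>) * hinv (shift (int n) \<omega>) x)" "0 \<le> e n \<omega>" "e n \<omega> \<le> 2"
    if w: "\<omega> \<in> space P" for \<omega> n
  proof -
    note a = adm_P[OF w]
    note l = hinv_lcone[OF a] and ln = hinv_lcone[OF adm_shift[OF a, of "int n"]]
    show um1: "u \<omega> \<in> borel_measurable U" unfolding u_def using \<xi> lcone_measurable[OF l] by simp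
    show ub: "0 \<le> u \<omega> x \<and> u \<omega> x \<le> hinv \<omega> x" if "0 < x" "x \<le> 1" for x
      using bd[OF that] lcone_nonneg[OF l that] by (auto simp: u_def intro!: mult_nonneg_nonneg mult_left_le_one_le)
    have "norm (u \<omega> x) \<le> norm (hinv \<omega> x)" if "x \<in> space U" for x using ub[of x] that by simp
    then have ui: "integrable U (u \<omega>)"
      by (intro Bochner_Integration.integrable_bound[OF lcone_integrable[OF l] um1] AE_I2)
    show m0: "0 \<le> mass (u \<omega>)" unfolding mass_def by (rule Bochner_Integration.integral_nonneg) (use ub in auto)
    show m1: "mass (u \<omega>) \<le> 1" using mass_mono[OF ui lcone_integrable[OF l]] ub mass_hinv[OF a] by auto
    have Lb: "0 \<le> Lit n \<omega> (u \<omega>) x \<and> Lit n \<omega> (u \<omega>) x \<le> hinv (shift (int n) \<omega>) x" if x: "0 < x" "x \<le> 1" for x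
      using Lit_nonneg[OF a _ x, of "u \<omega>" n] Lit_mono[OF a _ x, of "u \<omega>" "hinv \<omega>" n] ub Lit_hinv[OF a x, of n] by auto
    show i2: "integrable U (\<lambda>x. mass (u \<omega>) * hinv (shift (int n) \<omega>) x)" using lcone_integrable[OF ln] by simp
    have E: "\<bar>Lit n \<omega> (u \<omega>) x - mass (u \<omega>) * hinv (shift (int n) \<omega>) x\<bar> \<le> 2 * hinv (shift (int n) \<omega>) x" if x: "0 < x" "x \<le> 1" for x
    proof -
      have "0 \<le> mass (u \<omega>) * hinv (shift (int n) \<omega>) x" "mass (u \<omega>) * hinv (shift (int n) \<omega>) x \<le> hinv (shift (int n) \<omega>) x"
        using m0 m1 lcone_nonneg[OF ln x] by (auto intro!: mult_nonneg_nonneg mult_left_le_one_le)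
      then show ?thesis using Lb[OF x] by (simp add: abs_le_iff)
    qed
    have E': "integrable U (\<lambda>x. 2 * hinv (shift (int n) \<omega>) x)" "mass (\<lambda>x. 2 * hinv (shift (int n) \<omega>) x) = 2"
      using lcone_integrable[OF ln] mass_hinv[OF adm_shift[OF a]] by (simp_all add: mass_scale)
    note md = mass_abs_diff[OF Lit_measurable[OF a um1, of n] i2 E'(1) E]
    show "integrable U (Lit n \<omega> (u \<omega>))" by (rule md(2))
    show "0 \<le> e n \<omega>" unfolding e_def by (simp add: Bochner_Integration.integral_nonneg)
    show "e n \<omega> \<le> 2" unfolding e_def using md(1) E'(2) by simp
  qed
  have e_lim: "(\<lambda>n. \<integral>\<omega>. e n \<omega> \<partial>P) \<longlonglongrightarrow> (\<integral>\<omega>. 0 \<partial>P)"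
  proof (rule integral_dominated_convergence[of _ _ _ "\<lambda>_. 2"])
    show "AE \<omega> in P. (\<lambda>n. e n \<omega>) \<longlonglongrightarrow> 0"
      unfolding e_def u_def by (rule fibre_loss[OF supp \<xi> bd H ho]; assumption)
    show "AE \<omega> in P. norm (e n \<omega>) \<le> 2" for n by (rule AE_I2) (use pw(7,8) in auto)
  qed (use em in auto)
  have \<phi>i: "integrable R \<phi>" by (rule R.integrable_const_bound[of _ b]) (use \<phi> in \<open>auto simp: measurable_R\<close>)
  have c_eq: "c = (\<integral>\<omega>. \<Phi> \<omega> \<partial>P)" unfolding c_def \<Phi>_def by (rule integral_R(1)[OF \<phi>i])
  have \<phi>s: "(\<lambda>y. \<phi> (\<omega>, y)) \<in> borel_measurable U" if "\<omega> \<in> space P" for \<omega>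
    by (rule measurable_compose[OF measurable_Pair1'[OF that] \<phi>(1)])
  have \<Phi>m: "\<Phi> \<in> borel_measurable P"
    unfolding \<Phi>_def by (rule U.borel_measurable_lebesgue_integral)
      (use \<phi>(1) hinv_joint in \<open>simp add: case_prod_unfold\<close>)
  have \<Phi>b: "\<bar>\<Phi> \<omega>\<bar> \<le> b" if w: "\<omega> \<in> space P" for \<omega>
  proof -
    note l = hinv_lcone[OF adm_P[OF w]]
    have "\<bar>\<Phi> \<omega>\<bar> \<le> b * (\<integral>x. \<bar>hinv \<omega> x\<bar> \<partial>U)"
      unfolding \<Phi>_def by (rule bounded_mult_integrable(2)[OF \<phi>s[OF w] lcone_integrable[OF l]]) (use \<phi>(2) in auto)
    also have "(\<integral>x. \<bar>hinv \<omega> x\<bar> \<partial>U) = mass (hinv \<omega>)"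
      unfolding mass_def by (intro Bochner_Integration.integral_cong) (use lcone_nonneg[OF l] in auto)
    finally show ?thesis using mass_hinv[OF adm_P[OF w]] by simp
  qed
  have \<Phi>i: "integrable P \<Phi>" by (rule P.integrable_const_bound[of _ b]) (use \<Phi>m \<Phi>b in auto)
  have Gm: "G \<in> borel_measurable P" unfolding G_def using B mum by simp
  have Gb: "\<bar>G \<omega>\<bar> \<le> 1" if "\<omega> \<in> space P" for \<omega>
    using pw(3,4)[OF that] by (auto simp: G_def indicator_def)
  have mix: "(\<lambda>n. \<integral>\<omega>. G \<omega> * \<Phi> (shift (int n) \<omega>) \<partial>P) \<longlonglongrightarrow> (\<integral>\<omega>. G \<omega> \<partial>P) * c"
    unfolding c_eq by (rule shift_mixing[OF Gm Gb \<Phi>i])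
  have \<xi>b: "\<bar>indicator B (fst z) * \<xi> (snd z)\<bar> \<le> 1" if "z \<in> space R" for z
    using bd[of "snd z"] that by (auto simp: space_R indicator_def)
  have \<phi>sk: "(\<lambda>z. \<phi> (skew n z)) \<in> borel_measurable (P \<Otimes>\<^sub>M U)" for n by (rule measurable_compose[OF skew_measurable \<phi>(1)])
  have i1: "integrable R (\<lambda>z. indicator B (fst z) * \<xi> (snd z))"
    by (rule R.integrable_const_bound[of _ 1]) (use \<xi>b iB \<xi>2 in \<open>auto simp: measurable_R\<close>)
  have i2: "integrable R (\<lambda>z. indicator B (fst z) * \<xi> (snd z) * \<phi> (skew n z))" for n
    using bounded_mult_integrable(1)[OF _ i1, of "\<lambda>z. \<phi> (skew n z)" b] \<phi>sk \<phi>(2) by (simp add: measurable_R mult.commute)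
  have I1: "(\<integral>z. indicator B (fst z) * \<xi> (snd z) \<partial>R) = (\<integral>\<omega>. G \<omega> \<partial>P)"
    unfolding integral_R(1)[OF i1] G_def mass_def u_def by (simp add: mult.assoc)
  define Q where "Q n = (\<integral>z. indicator B (fst z) * \<xi> (snd z) * \<phi> (skew n z) \<partial>R)" for n
  define V where "V n \<omega> = indicator B \<omega> * (\<integral>y. \<phi> (shift (int n) \<omega>, y) * Lit n \<omega> (u \<omega>) y \<partial>U)" for n \<omega>
  have QV: "Q n = (\<integral>\<omega>. V n \<omega> \<partial>P)" for n
    unfolding Q_def integral_R(1)[OF i2]
  proof (intro Bochner_Integration.integral_cong refl)
    fix \<omega> assume w: "\<omega> \<in> space P"
    have unn: "0 \<le> u \<omega> x" if "0 < x" "x \<le> 1" for x using pw(2)[OF w that] by auto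
    have "(\<integral>x. \<phi> (shift (int n) \<omega>, rlsv_iter n \<omega> x) * u \<omega> x \<partial>U) = (\<integral>y. \<phi> (shift (int n) \<omega>, y) * Lit n \<omega> (u \<omega>) y \<partial>U)"
      by (rule integral_Lit(1)[OF adm_P[OF w] pw(1)[OF w] unn \<phi>s[OF shift_space_P[OF w]]])
    then show "(\<integral>x. indicator B (fst (\<omega>, x)) * \<xi> (snd (\<omega>, x)) * \<phi> (skew n (\<omega>, x)) * hinv \<omega> x \<partial>U) = V n \<omega>"
      unfolding V_def by (cases "\<omega> \<in> B") (simp_all add: skew_def u_def mult_ac)
  qed
  have Vm: "V n \<in> borel_measurable P" for n
  proof -
    have "(\<lambda>z. \<phi> (shift (int n) (fst z), snd z) * Lit n (fst z) (u (fst z)) (snd z)) \<in> borel_measurable (P \<Otimes>\<^sub>M U)"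
      using Lit_joint[OF um, of n] measurable_compose[OF shift_fst_measurable \<phi>(1), of "int n"] by simp
    then have "(\<lambda>\<omega>. \<integral>y. \<phi> (shift (int n) \<omega>, y) * Lit n \<omega> (u \<omega>) y \<partial>U) \<in> borel_measurable P"
      by (intro U.borel_measurable_lebesgue_integral) (simp add: case_prod_unfold)
    then show ?thesis unfolding V_def using B by simp
  qed
  have VG: "\<bar>V n \<omega> - G \<omega> * \<Phi> (shift (int n) \<omega>)\<bar> \<le> b * e n \<omega>" if w: "\<omega> \<in> space P" for n \<omega>
  proof -
    have D: "integrable U (\<lambda>y. Lit n \<omega> (u \<omega>) y - mass (u \<omega>) * hinv (shift (int n) \<omega>) y)"
      using pw(5,6)[OF w, of n] by simp
    note ps = \<phi>s[OF shift_space_P[OF w, of "int n"]]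
    have pb: "AE y in U. \<bar>\<phi> (shift (int n) \<omega>, y)\<bar> \<le> b" using \<phi>(2) by simp
    have "(\<integral>y. \<phi> (shift (int n) \<omega>, y) * (Lit n \<omega> (u \<omega>) y - mass (u \<omega>) * hinv (shift (int n) \<omega>) y) \<partial>U)
      = (\<integral>y. \<phi> (shift (int n) \<omega>, y) * Lit n \<omega> (u \<omega>) y - \<phi> (shift (int n) \<omega>, y) * (mass (u \<omega>) * hinv (shift (int n) \<omega>) y) \<partial>U)"
      by (simp add: right_diff_distrib)
    also have "\<dots> = (\<integral>y. \<phi> (shift (int n) \<omega>, y) * Lit n \<omega> (u \<omega>) y \<partial>U) - (\<integral>y. \<phi> (shift (int n) \<omega>, y) * (mass (u \<omega>) * hinv (shift (int n) \<omega>) y) \<partial>U)"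
      by (intro Bochner_Integration.integral_diff bounded_mult_integrable(1)[OF ps _ pb] pw(5,6)[OF w])
    also have "(\<integral>y. \<phi> (shift (int n) \<omega>, y) * (mass (u \<omega>) * hinv (shift (int n) \<omega>) y) \<partial>U) = mass (u \<omega>) * \<Phi> (shift (int n) \<omega>)"
      unfolding \<Phi>_def by (subst integral_mult_right_zero[symmetric]) (simp add: mult_ac)
    finally have "V n \<omega> - G \<omega> * \<Phi> (shift (int n) \<omega>)
      = indicator B \<omega> * (\<integral>y. \<phi> (shift (int n) \<omega>, y) * (Lit n \<omega> (u \<omega>) y - mass (u \<omega>) * hinv (shift (int n) \<omega>) y) \<partial>U)"
      by (cases "\<omega> \<in> B") (simp_all add: V_def G_def)
    moreover have "\<bar>\<integral>y. \<phi> (shift (int n) \<omega>, y) * (Lit n \<omega> (u \<omega>) y - mass (u \<omega>) * hinv (shift (int n) \<omega>) y) \<partial>U\<bar> \<le> b * e n \<omega>"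
      unfolding e_def by (rule bounded_mult_integrable(2)[OF ps D pb])
    moreover have "0 \<le> b * e n \<omega>" using b0 pw(7)[OF w] by simp
    ultimately show ?thesis by (simp add: indicator_def)
  qed
  have Gi: "integrable P (\<lambda>\<omega>. G \<omega> * \<Phi> (shift (int n) \<omega>))" for n
  proof -
    have "integrable P (\<lambda>\<omega>. \<Phi> (shift (int n) \<omega>))"
      by (rule P.integrable_const_bound[of _ b]) (use \<Phi>b shift_space_P measurable_compose[OF shift_P \<Phi>m] in auto)
    then show ?thesis by (rule bounded_mult_integrable(1)[OF Gm, of _ 1]) (use Gb in auto)
  qed
  have ei: "integrable P (e n)" for n by (rule P.integrable_const_bound[of _ 2]) (use em pw(7,8) in auto)
  have QB: "\<bar>Q n - (\<integral>\<omega>. G \<omega> * \<Phi> (shift (int n) \<omega>) \<partial>P)\<bar> \<le> b * (\<integral>\<omega>. e n \<omega> \<partial>P)" for n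
  proof -
    have be: "integrable P (\<lambda>\<omega>. b * e n \<omega>)" using ei by simp
    have d: "integrable P (\<lambda>\<omega>. V n \<omega> - G \<omega> * \<Phi> (shift (int n) \<omega>))"
    proof (rule Bochner_Integration.integrable_bound[OF be])
      show "(\<lambda>\<omega>. V n \<omega> - G \<omega> * \<Phi> (shift (int n) \<omega>)) \<in> borel_measurable P"
        using Vm Gi[of n] by simp
      have "norm (V n \<omega> - G \<omega> * \<Phi> (shift (int n) \<omega>)) \<le> norm (b * e n \<omega>)" if "\<omega> \<in> space P" for \<omega>
        using VG[OF that, of n] by simp
      then show "AE \<omega> in P. norm (V n \<omega> - G \<omega> * \<Phi> (shift (int n) \<omega>)) \<le> norm (b * e n \<omega>)" by (rule AE_I2)
    qed
    have Vi: "integrable P (V n)" using Bochner_Integration.integrable_add[OF d Gi[of n]] by simp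
    have "Q n - (\<integral>\<omega>. G \<omega> * \<Phi> (shift (int n) \<omega>) \<partial>P) = (\<integral>\<omega>. V n \<omega> - G \<omega> * \<Phi> (shift (int n) \<omega>) \<partial>P)"
      unfolding QV by (rule Bochner_Integration.integral_diff[OF Vi Gi, symmetric])
    also have "\<bar>\<dots>\<bar> \<le> (\<integral>\<omega>. \<bar>V n \<omega> - G \<omega> * \<Phi> (shift (int n) \<omega>)\<bar> \<partial>P)" by (rule integral_abs_bound)
    also have "\<dots> \<le> (\<integral>\<omega>. b * e n \<omega> \<partial>P)" by (rule integral_mono) (use d be VG in auto)
    finally show ?thesis by simp
  qed
  have z: "(\<lambda>n. b * (\<integral>\<omega>. e n \<omega> \<partial>P)) \<longlonglongrightarrow> 0" using tendsto_mult_left[OF e_lim, of b] by simp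
  have "\<forall>\<^sub>F n in sequentially. norm (Q n - (\<integral>\<omega>. G \<omega> * \<Phi> (shift (int n) \<omega>) \<partial>P)) \<le> b * (\<integral>\<omega>. e n \<omega> \<partial>P)"
    using QB by (intro always_eventually allI) (simp only: real_norm_def)
  then have "(\<lambda>n. Q n - (\<integral>\<omega>. G \<omega> * \<Phi> (shift (int n) \<omega>) \<partial>P)) \<longlonglongrightarrow> 0"
    by (rule Lim_null_comparison[OF _ z])
  from tendsto_add[OF this mix] have "Q \<longlonglongrightarrow> (\<integral>\<omega>. G \<omega> \<partial>P) * c" by simp
  then have "(\<lambda>n. Q n - (\<integral>\<omega>. G \<omega> \<partial>P) * c) \<longlonglongrightarrow> 0" by (simp add: LIM_zero)
  moreover have "(\<integral>z. indicator B (fst z) * \<xi> (snd z) * (\<phi> (skew n z) - c) \<partial>R) = Q n - (\<integral>\<omega>. G \<omega> \<partial>P) * c" for n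
    unfolding right_diff_distrib Q_def I1[symmetric] using i1 i2[of n] by simp
  ultimately show ?thesis unfolding c_def by simp
qed

lemma mixing_bounded:
  fixes \<phi> \<psi> :: "(int \<Rightarrow> real) \<times> real \<Rightarrow> real"
  assumes supp: "\<And>s. \<alpha>\<^sub>0 < s \<Longrightarrow> 0 < pr s"
    and \<phi>: "\<phi> \<in> borel_measurable (P \<Otimes>\<^sub>M U)" "\<And>z. \<bar>\<phi> z\<bar> \<le> b" and \<psi>: "integrable R \<psi>"
  shows "(\<lambda>n. \<integral>z. \<psi> z * (\<phi> (skew n z) - (\<integral>z. \<phi> z \<partial>R)) \<partial>R) \<longlonglongrightarrow> 0"
proof -
  define c where "c = (\<integral>z. \<phi> z \<partial>R)"
  define k where "k n z = \<phi> (skew n z) - c" for n z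
  have b0: "0 \<le> b" using \<phi>(2)[of undefined] by (rule order_trans[OF abs_ge_zero])
  have cb: "\<bar>c\<bar> \<le> b"
  proof -
    have "\<bar>c\<bar> \<le> (\<integral>z. \<bar>\<phi> z\<bar> \<partial>R)" unfolding c_def by (rule integral_abs_bound)
    also have "\<dots> \<le> b" by (rule R.integral_le_const_nonneg) (use \<phi>(2) b0 in auto)
    finally show ?thesis .
  qed
  have km: "k n \<in> borel_measurable R" for n
    unfolding k_def measurable_R using measurable_compose[OF skew_measurable \<phi>(1)] by simp
  have kb: "\<bar>k n z\<bar> \<le> 2 * b" for n z
    using \<phi>(2)[of "skew n z"] cb unfolding k_def by (auto simp: abs_le_iff)
  note lip = mixing_rectangle_Lipschitz[OF supp \<phi>, folded c_def, folded k_def]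
  have iB: "(\<lambda>z. indicator B (fst z) :: real) \<in> borel_measurable R" if "B \<in> sets P" for B
    unfolding measurable_R by (rule measurable_compose[OF measurable_fst borel_measurable_indicator[OF that]])
  have s: "snd \<in> borel_measurable R" unfolding measurable_R by (rule measurable_compose[OF measurable_snd id_U])
  have full: "(\<lambda>n. \<integral>z. indicator B (fst z) * k n z \<partial>R) \<longlonglongrightarrow> 0" if B: "B \<in> sets P" for B
    using lip[of "\<lambda>_. 1" 0 B] B by simp
  have half: "(\<lambda>n. \<integral>z. indicator {..t} (snd z) * (indicator B (fst z) * k n z) \<partial>R) \<longlonglongrightarrow> 0" if B: "B \<in> sets P" for B and t :: real
  proof -
    have *: "(\<lambda>n. \<integral>z. (indicator B (fst z) * indicator {..t} (snd z)) * k n z \<partial>R) \<longlonglongrightarrow> 0"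
    proof (rule R.tendsto_integral_approx[OF km kb])
      have it: "(\<lambda>z. indicator {..t} (snd z) :: real) \<in> borel_measurable R"
        by (rule measurable_compose[OF s]) simp
      show i0: "integrable R (\<lambda>z. indicator B (fst z) * indicator {..t} (snd z) :: real)"
        by (rule R.integrable_const_bound[of _ 1]) (use iB[OF B] it in \<open>auto simp: indicator_def\<close>)
      fix e :: real assume e: "0 < e"
      define \<xi> where "\<xi> j x = max 0 (min 1 (1 - real j * (x - t)))" for j :: nat and x :: real
      have \<xi>m: "\<xi> j \<in> borel_measurable borel" for j unfolding \<xi>_def by measurable
      have \<xi>b: "0 \<le> \<xi> j x" "\<xi> j x \<le> 1" for j x by (auto simp: \<xi>_def)
      have \<xi>l: "\<bar>\<xi> j x - \<xi> j y\<bar> \<le> real j * \<bar>x - y\<bar>" for j x y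
      proof -
        have "\<bar>\<xi> j x - \<xi> j y\<bar> \<le> \<bar>real j * (x - t) - real j * (y - t)\<bar>" unfolding \<xi>_def by linarith
        also have "\<dots> = \<bar>real j * (x - y)\<bar>" by (simp add: algebra_simps)
        finally show ?thesis by (simp add: abs_mult)
      qed
      have \<xi>lim: "(\<lambda>j. \<xi> j x) \<longlonglongrightarrow> indicator {..t} x" for x
      proof (cases "x \<le> t")
        case True
        then have "1 \<le> 1 - real j * (x - t)" for j by (simp add: mult_nonneg_nonpos)
        then have "\<xi> j x = 1" for j unfolding \<xi>_def by (simp add: min_absorb1)
        then show ?thesis using True by simp
      next
        case False
        obtain N :: nat where N: "1 / (x - t) \<le> real N" using real_arch_simple by blast
        have "\<xi> j x = 0" if "N \<le> j" for j
        proof -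
          have "1 / (x - t) \<le> real j" using N that by linarith
          then have "1 \<le> real j * (x - t)" using False by (simp add: field_simps)
          then show ?thesis by (simp add: \<xi>_def)
        qed
        then have "(\<lambda>j. \<xi> j x) \<longlonglongrightarrow> 0" by (intro tendsto_eventually) (auto simp: eventually_sequentially)
        then show ?thesis using False by simp
      qed
      have \<xi>s: "(\<lambda>z. \<xi> j (snd z)) \<in> borel_measurable R" for j by (rule measurable_compose[OF s \<xi>m])
      have "(\<lambda>j. \<integral>z. \<bar>indicator B (fst z) * indicator {..t} (snd z) - indicator B (fst z) * \<xi> j (snd z)\<bar> \<partial>R) \<longlonglongrightarrow> (\<integral>z. 0 \<partial>R)"
      proof (rule integral_dominated_convergence[of _ _ _ "\<lambda>_. 1"])
        show "AE z in R. (\<lambda>j. \<bar>indicator B (fst z) * indicator {..t} (snd z) - indicator B (fst z) * \<xi> j (snd z)\<bar>) \<longlonglongrightarrow> 0"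
        proof (rule AE_I2)
          fix z :: "(int \<Rightarrow> real) \<times> real"
          have "(\<lambda>j. \<bar>indicator B (fst z) * indicator {..t} (snd z) - indicator B (fst z) * \<xi> j (snd z)\<bar>)
             \<longlonglongrightarrow> \<bar>indicator B (fst z) * indicator {..t} (snd z) - indicator B (fst z) * indicator {..t} (snd z)\<bar>"
            by (intro tendsto_intros \<xi>lim)
          then show "(\<lambda>j. \<bar>indicator B (fst z) * indicator {..t} (snd z) - indicator B (fst z) * \<xi> j (snd z)\<bar>) \<longlonglongrightarrow> 0" by simp
        qed
        show "AE z in R. norm \<bar>indicator B (fst z) * indicator {..t} (snd z) - indicator B (fst z) * \<xi> j (snd z)\<bar> \<le> 1" for j
        proof (rule AE_I2)
          fix z :: "(int \<Rightarrow> real) \<times> real"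
          show "norm \<bar>indicator B (fst z) * indicator {..t} (snd z) - indicator B (fst z) * \<xi> j (snd z)\<bar> \<le> 1"
            using \<xi>b[of j "snd z"] by (auto simp: indicator_def abs_le_iff)
        qed
        show "(\<lambda>z. \<bar>indicator B (fst z) * indicator {..t} (snd z) - indicator B (fst z) * \<xi> j (snd z)\<bar>) \<in> borel_measurable R" for j
          using iB[OF B] it \<xi>s[of j] by simp
      qed auto
      then have "(\<lambda>j. \<integral>z. \<bar>indicator B (fst z) * indicator {..t} (snd z) - indicator B (fst z) * \<xi> j (snd z)\<bar> \<partial>R) \<longlonglongrightarrow> 0" by simp
      from order_tendstoD(2)[OF this e] obtain j where
        j: "(\<integral>z. \<bar>indicator B (fst z) * indicator {..t} (snd z) - indicator B (fst z) * \<xi> j (snd z)\<bar> \<partial>R) < e"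
        by (auto simp: eventually_sequentially)
      have i1: "integrable R (\<lambda>z. indicator B (fst z) * \<xi> j (snd z))"
        by (rule R.integrable_const_bound[of _ 1]) (use iB[OF B] \<xi>s \<xi>b in \<open>auto simp: indicator_def\<close>)
      have "(\<lambda>n. \<integral>z. indicator B (fst z) * \<xi> j (snd z) * k n z \<partial>R) \<longlonglongrightarrow> 0"
        by (rule lip[of "\<xi> j" "real j" B]) (use measurable_U1[OF \<xi>m] \<xi>b \<xi>l B in auto)
      then show "\<exists>g. integrable R g \<and> (\<integral>z. \<bar>indicator B (fst z) * indicator {..t} (snd z) - g z\<bar> \<partial>R) \<le> e \<and> (\<lambda>n. \<integral>z. g z * k n z \<partial>R) \<longlonglongrightarrow> 0"
        using i1 j by (intro exI[of _ "\<lambda>z. indicator B (fst z) * \<xi> j (snd z)"]) auto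
    qed
    then show ?thesis by (simp add: mult_ac)
  qed
  have rect: "(\<lambda>n. \<integral>z. indicator A (snd z) * (indicator B (fst z) * k n z) \<partial>R) \<longlonglongrightarrow> 0"
    if B: "B \<in> sets P" and A: "A \<in> sets borel" for B and A :: "real set"
  proof (rule R.tendsto_integral_generator[where G="range atMost" and N=borel and B="2 * b"])
    show "(\<lambda>z. indicator B (fst z) * k n z) \<in> borel_measurable R" for n using iB[OF B] km by simp
    show "\<bar>indicator B (fst z) * k n z\<bar> \<le> 2 * b" for n z using kb[of n z] b0 by (auto simp: indicator_def)
    show "Int_stable (range (atMost :: real \<Rightarrow> _))"
      by (auto simp: Int_stable_def)
    have "sets (borel :: real measure) = sets (sigma UNIV (range atMost))" using borel_eq_atMost by (rule arg_cong)
    also have "\<dots> = sigma_sets (space borel) (range (atMost :: real \<Rightarrow> _))" by (subst sets_measure_of) auto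
    finally show "sets (borel :: real measure) = sigma_sets (space borel) (range atMost)" .
  qed (use s half full A B in auto)
  have sets: "(\<lambda>n. \<integral>z. indicator S z * k n z \<partial>R) \<longlonglongrightarrow> 0" if S: "S \<in> sets R" for S
  proof (rule R.tendsto_integral_generator[OF km kb, where N="P \<Otimes>\<^sub>M U" and X="\<lambda>z. z"])
    show "(\<lambda>z. z) \<in> R \<rightarrow>\<^sub>M P \<Otimes>\<^sub>M U" by (rule measurable_ident_sets[OF sets_R])
    show "Int_stable {a \<times> b | a b. a \<in> sets P \<and> b \<in> sets U}" by (rule Int_stable_pair_measure_generator)
    show "{a \<times> b | a b. a \<in> sets P \<and> b \<in> sets U} \<subseteq> Pow (space (P \<Otimes>\<^sub>M U))"
      unfolding space_pair_measure by (rule pair_measure_closed)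
    show "sets (P \<Otimes>\<^sub>M U) = sigma_sets (space (P \<Otimes>\<^sub>M U)) {a \<times> b | a b. a \<in> sets P \<and> b \<in> sets U}"
      unfolding space_pair_measure by (rule sets_pair_measure)
    show "(\<lambda>n. \<integral>z. indicator A z * k n z \<partial>R) \<longlonglongrightarrow> 0" if "A \<in> {a \<times> b | a b. a \<in> sets P \<and> b \<in> sets U}" for A
    proof -
      from that obtain a b where A: "A = a \<times> b" "a \<in> sets P" "b \<in> sets U" by auto
      have "b \<in> sets borel" using A(3) unfolding sets_U by (auto simp: sets_restrict_space)
      have "indicator A z = (indicator b (snd z) * indicator a (fst z) :: real)" for z
        by (cases z) (auto simp: A(1) indicator_def)
      then show ?thesis using rect[OF A(2) \<open>b \<in> sets borel\<close>] by (simp add: mult.assoc)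
    qed
    show "(\<lambda>n. \<integral>z. k n z \<partial>R) \<longlonglongrightarrow> 0"
    proof -
      have "(\<integral>z. indicator (space P) (fst z) * k n z \<partial>R) = (\<integral>z. k n z \<partial>R)" for n
        by (intro Bochner_Integration.integral_cong) (auto simp: space_R)
      then show ?thesis using full[OF sets.top] by simp
    qed
    show "S \<in> sets (P \<Otimes>\<^sub>M U)" using S by (simp add: sets_R)
  qed
  show ?thesis
    using R.tendsto_integral_sets_imp_integrable[OF km kb sets \<psi>] unfolding k_def c_def .
qed

lemma square_integrable_mult:
  fixes f g :: "_ \<Rightarrow> real"
  assumes "f \<in> borel_measurable M" "g \<in> borel_measurable M" "integrable M (\<lambda>x. (f x)\<^sup>2)" "integrable M (\<lambda>x. (g x)\<^sup>2)" "0 < t"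
  shows "integrable M (\<lambda>x. f x * g x)"
    and "\<bar>\<integral>x. f x * g x \<partial>M\<bar> \<le> (1 / t * (\<integral>x. (f x)\<^sup>2 \<partial>M) + t * (\<integral>x. (g x)\<^sup>2 \<partial>M)) / 2"
proof -
  have le: "\<bar>f x * g x\<bar> \<le> (1 / t * (f x)\<^sup>2 + t * (g x)\<^sup>2) / 2" for x
  proof -
    have "0 \<le> (\<bar>f x\<bar> - t * \<bar>g x\<bar>)\<^sup>2 / t" using assms(5) by simp
    also have "\<dots> = 1 / t * (f x)\<^sup>2 + t * (g x)\<^sup>2 - 2 * \<bar>f x * g x\<bar>"
      using assms(5) by (simp add: power2_diff abs_mult power_mult_distrib power2_eq_square field_simps)
    finally show ?thesis by simp
  qed
  have i: "integrable M (\<lambda>x. (1 / t * (f x)\<^sup>2 + t * (g x)\<^sup>2) / 2)" using assms(3,4) by simp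
  have "norm (f x * g x) \<le> norm ((1 / t * (f x)\<^sup>2 + t * (g x)\<^sup>2) / 2)" for x
    using le[of x] unfolding real_norm_def by linarith
  then show ifg: "integrable M (\<lambda>x. f x * g x)"
    by (intro Bochner_Integration.integrable_bound[OF i] AE_I2) (use assms in auto)
  have "\<bar>\<integral>x. f x * g x \<partial>M\<bar> \<le> (\<integral>x. \<bar>f x * g x\<bar> \<partial>M)" by (rule integral_abs_bound)
  also have "\<dots> \<le> (\<integral>x. (1 / t * (f x)\<^sup>2 + t * (g x)\<^sup>2) / 2 \<partial>M)" by (rule integral_mono) (use ifg i le in auto)
  also have "\<dots> = (1 / t * (\<integral>x. (f x)\<^sup>2 \<partial>M) + t * (\<integral>x. (g x)\<^sup>2 \<partial>M)) / 2" using assms(3,4) by simp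
  finally show "\<bar>\<integral>x. f x * g x \<partial>M\<bar> \<le> (1 / t * (\<integral>x. (f x)\<^sup>2 \<partial>M) + t * (\<integral>x. (g x)\<^sup>2 \<partial>M)) / 2" .
qed

lemma mixing_L2:
  fixes \<phi> \<psi> :: "(int \<Rightarrow> real) \<times> real \<Rightarrow> real"
  assumes supp: "\<And>s. \<alpha>\<^sub>0 < s \<Longrightarrow> 0 < pr s"
    and \<phi>: "\<phi> \<in> borel_measurable (P \<Otimes>\<^sub>M U)" "integrable R (\<lambda>z. (\<phi> z)\<^sup>2)"
    and \<psi>: "\<psi> \<in> borel_measurable (P \<Otimes>\<^sub>M U)" "integrable R (\<lambda>z. (\<psi> z)\<^sup>2)"
  shows "(\<lambda>n. (\<integral>z. \<phi> (skew n z) * \<psi> z \<partial>R) - (\<integral>z. \<phi> z \<partial>R) * (\<integral>z. \<psi> z \<partial>R)) \<longlonglongrightarrow> 0"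
proof (rule LIMSEQ_I)
  fix e :: real assume e: "0 < e"
  have \<phi>R: "\<phi> \<in> borel_measurable R" and \<psi>R: "\<psi> \<in> borel_measurable R" using \<phi> \<psi> by (auto simp: measurable_R)
  have L1: "integrable R f" "\<bar>\<integral>z. f z \<partial>R\<bar> \<le> (1 / t * (\<integral>z. (f z)\<^sup>2 \<partial>R) + t) / 2"
    if "f \<in> borel_measurable R" "integrable R (\<lambda>z. (f z)\<^sup>2)" "0 < t" for f :: "_ \<Rightarrow> real" and t
    using square_integrable_mult[OF that(1) _ that(2) _ that(3), of "\<lambda>_. 1"] by (simp_all add: R.prob_space)
  define S where "S = (\<integral>z. (\<psi> z)\<^sup>2 \<partial>R)"
  have S: "0 \<le> S" unfolding S_def by (simp add: Bochner_Integration.integral_nonneg)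
  define I\<psi> where "I\<psi> = (\<integral>z. \<psi> z \<partial>R)"
  define t where "t = e / (2 * (1 + S + 2 * \<bar>I\<psi>\<bar>))"
  have den: "0 < 1 + S + 2 * \<bar>I\<psi>\<bar>" using S by simp
  have t: "0 < t" unfolding t_def using e den by simp
  define tr where "tr N z = max (- real N) (min (real N) (\<phi> z))" for N :: nat and z
  have trm: "tr N \<in> borel_measurable (P \<Otimes>\<^sub>M U)" for N unfolding tr_def using \<phi>(1) by simp
  have "(\<lambda>N. \<integral>z. (\<phi> z - tr N z)\<^sup>2 \<partial>R) \<longlonglongrightarrow> (\<integral>z. 0 \<partial>R)"
  proof (rule integral_dominated_convergence[of _ _ _ "\<lambda>z. (\<phi> z)\<^sup>2"])
    show "AE z in R. (\<lambda>N. (\<phi> z - tr N z)\<^sup>2) \<longlonglongrightarrow> 0"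
    proof (rule AE_I2)
      fix z
      obtain N0 :: nat where N0: "\<bar>\<phi> z\<bar> \<le> real N0" using real_arch_simple by blast
      have "(\<phi> z - tr N z)\<^sup>2 = 0" if "N0 \<le> N" for N
      proof -
        have "\<bar>\<phi> z\<bar> \<le> real N" using N0 that by linarith
        then have "tr N z = \<phi> z" unfolding tr_def by linarith
        then show ?thesis by simp
      qed
      then show "(\<lambda>N. (\<phi> z - tr N z)\<^sup>2) \<longlonglongrightarrow> 0" by (intro tendsto_eventually) (auto simp: eventually_sequentially)
    qed
    show "AE z in R. norm ((\<phi> z - tr N z)\<^sup>2) \<le> (\<phi> z)\<^sup>2" for N
    proof (rule AE_I2)
      fix z
      have "\<bar>\<phi> z - tr N z\<bar> \<le> \<bar>\<phi> z\<bar>" unfolding tr_def by linarith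
      then show "norm ((\<phi> z - tr N z)\<^sup>2) \<le> (\<phi> z)\<^sup>2" by (simp add: abs_le_square_iff)
    qed
    show "(\<lambda>z. (\<phi> z - tr N z)\<^sup>2) \<in> borel_measurable R" for N using \<phi>R trm[of N] by (simp add: measurable_R)
  qed (use \<phi>(2) in auto)
  then have lim: "(\<lambda>N. \<integral>z. (\<phi> z - tr N z)\<^sup>2 \<partial>R) \<longlonglongrightarrow> 0" by simp
  have "0 < t\<^sup>2" using t by simp
  from order_tendstoD(2)[OF lim this] obtain N where N: "(\<integral>z. (\<phi> z - tr N z)\<^sup>2 \<partial>R) < t\<^sup>2"
    by (auto simp: eventually_sequentially)
  define r where "r z = \<phi> z - tr N z" for z
  have rm: "r \<in> borel_measurable (P \<Otimes>\<^sub>M U)" unfolding r_def using \<phi>(1) trm by simp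
  have rR: "r \<in> borel_measurable R" using rm by (simp add: measurable_R)
  have r2: "integrable R (\<lambda>z. (r z)\<^sup>2)"
  proof (rule Bochner_Integration.integrable_bound[OF \<phi>(2)])
    show "(\<lambda>z. (r z)\<^sup>2) \<in> borel_measurable R" using rR by simp
    have "norm ((r z)\<^sup>2) \<le> norm ((\<phi> z)\<^sup>2)" for z
    proof -
      have "\<bar>r z\<bar> \<le> \<bar>\<phi> z\<bar>" unfolding r_def tr_def by linarith
      then show ?thesis by (simp add: abs_le_square_iff)
    qed
    then show "AE z in R. norm ((r z)\<^sup>2) \<le> norm ((\<phi> z)\<^sup>2)" by simp
  qed
  have r2t: "1 / t * (\<integral>z. (r z)\<^sup>2 \<partial>R) \<le> t"
    using N t unfolding r_def by (simp add: power2_eq_square field_simps)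
  have trb: "\<bar>tr N z\<bar> \<le> real N" for z unfolding tr_def by linarith
  have tri: "integrable R (tr N)" by (rule R.integrable_const_bound[of _ "real N"]) (use trm trb in \<open>auto simp: measurable_R\<close>)
  have \<psi>i: "integrable R \<psi>" by (rule L1(1)[OF \<psi>R \<psi>(2) zero_less_one])
  have ri: "integrable R r" by (rule L1(1)[OF rR r2 zero_less_one])
  have lb: "(\<lambda>n. \<integral>z. \<psi> z * (tr N (skew n z) - (\<integral>z. tr N z \<partial>R)) \<partial>R) \<longlonglongrightarrow> 0"
    by (rule mixing_bounded[OF supp trm trb \<psi>i]; assumption)
  have "0 < e / 2" using e by simp
  from LIMSEQ_D[OF lb this] obtain n0 where n0:
    "\<And>n. n0 \<le> n \<Longrightarrow> \<bar>\<integral>z. \<psi> z * (tr N (skew n z) - (\<integral>z. tr N z \<partial>R)) \<partial>R\<bar> < e / 2" by auto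
  show "\<exists>n0. \<forall>n\<ge>n0. norm ((\<integral>z. \<phi> (skew n z) * \<psi> z \<partial>R) - (\<integral>z. \<phi> z \<partial>R) * (\<integral>z. \<psi> z \<partial>R) - 0) < e"
  proof (intro exI[of _ n0] allI impI)
    fix n assume n: "n0 \<le> n"
    have rs: "(\<lambda>z. r (skew n z)) \<in> borel_measurable R"
      unfolding measurable_R by (rule measurable_compose[OF skew_measurable rm])
    have r2m: "(\<lambda>z. (r z)\<^sup>2) \<in> borel_measurable (P \<Otimes>\<^sub>M U)" using rm by simp
    have rs2: "integrable R (\<lambda>z. (r (skew n z))\<^sup>2)" "(\<integral>z. (r (skew n z))\<^sup>2 \<partial>R) = (\<integral>z. (r z)\<^sup>2 \<partial>R)"
      using integral_skew[OF r2m, of n] r2 by auto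
    note sq = square_integrable_mult[OF rs \<psi>R rs2(1) \<psi>(2) t]
    have b1: "\<bar>\<integral>z. r (skew n z) * \<psi> z \<partial>R\<bar> \<le> (t + t * S) / 2"
      using sq(2) r2t unfolding rs2(2) S_def by simp
    have b2: "\<bar>\<integral>z. r z \<partial>R\<bar> \<le> t" using L1(2)[OF rR r2 t] r2t by simp
    have its: "integrable R (\<lambda>z. \<psi> z * tr N (skew n z))"
      using bounded_mult_integrable(1)[OF _ \<psi>i, of "\<lambda>z. tr N (skew n z)" "real N"] trb measurable_compose[OF skew_measurable trm]
      by (simp add: measurable_R mult.commute)
    have "(\<integral>z. \<phi> z \<partial>R) = (\<integral>z. tr N z + r z \<partial>R)" by (simp add: r_def)
    also note Bochner_Integration.integral_add[OF tri ri]
    finally have i\<phi>: "(\<integral>z. \<phi> z \<partial>R) = (\<integral>z. tr N z \<partial>R) + (\<integral>z. r z \<partial>R)" .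
    have "(\<integral>z. \<phi> (skew n z) * \<psi> z \<partial>R) = (\<integral>z. \<psi> z * tr N (skew n z) + r (skew n z) * \<psi> z \<partial>R)"
      by (intro Bochner_Integration.integral_cong) (auto simp: r_def algebra_simps)
    also have "\<dots> = (\<integral>z. \<psi> z * tr N (skew n z) \<partial>R) + (\<integral>z. r (skew n z) * \<psi> z \<partial>R)"
      by (rule Bochner_Integration.integral_add[OF its sq(1)])
    finally have 1: "(\<integral>z. \<phi> (skew n z) * \<psi> z \<partial>R) = (\<integral>z. \<psi> z * tr N (skew n z) \<partial>R) + (\<integral>z. r (skew n z) * \<psi> z \<partial>R)" .
    have 2: "(\<integral>z. \<psi> z * (tr N (skew n z) - (\<integral>z. tr N z \<partial>R)) \<partial>R) = (\<integral>z. \<psi> z * tr N (skew n z) \<partial>R) - (\<integral>z. tr N z \<partial>R) * I\<psi>"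
      unfolding right_diff_distrib I\<psi>_def using its \<psi>i by simp
    have 3: "\<bar>(\<integral>z. r z \<partial>R) * I\<psi>\<bar> \<le> t * \<bar>I\<psi>\<bar>" unfolding abs_mult by (rule mult_right_mono[OF b2]) simp
    have "(\<integral>z. \<phi> (skew n z) * \<psi> z \<partial>R) - (\<integral>z. \<phi> z \<partial>R) * I\<psi>
       = (\<integral>z. \<psi> z * (tr N (skew n z) - (\<integral>z. tr N z \<partial>R)) \<partial>R) + (\<integral>z. r (skew n z) * \<psi> z \<partial>R) - (\<integral>z. r z \<partial>R) * I\<psi>"
      unfolding 1 2 i\<phi> by (simp add: algebra_simps)
    also have "\<bar>\<dots>\<bar> < e / 2 + (t + t * S) / 2 + t * \<bar>I\<psi>\<bar>"
      using n0[OF n] b1 3 by linarith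
    also have "\<dots> = e / 2 + t * (1 + S + 2 * \<bar>I\<psi>\<bar>) / 2" by (simp add: algebra_simps)
    also have "t * (1 + S + 2 * \<bar>I\<psi>\<bar>) = e / 2" unfolding t_def using den by (simp add: field_simps)
    also have "e / 2 + e / 2 / 2 \<le> e" using e by simp
    finally show "norm ((\<integral>z. \<phi> (skew n z) * \<psi> z \<partial>R) - (\<integral>z. \<phi> z \<partial>R) * (\<integral>z. \<psi> z \<partial>R) - 0) < e"
      by (simp add: I\<psi>_def)
  qed
qed

lemma mu_measurable: "mu \<in> P \<rightarrow>\<^sub>M prob_algebra unit_borel"
proof (rule measurable_prob_algebraI)
  show ps: "prob_space (mu \<omega>)" if "\<omega> \<in> space P" for \<omega> by (rule prob_space_mu[OF adm_P[OF that]])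
  show "mu \<in> P \<rightarrow>\<^sub>M subprob_algebra unit_borel"
  proof (rule measurable_subprob_algebra)
    show "subprob_space (mu \<omega>)" if "\<omega> \<in> space P" for \<omega>
      using ps[OF that] by (rule prob_space_imp_subprob_space)
    show "sets (mu \<omega>) = sets unit_borel" for \<omega> by (rule sets_mu)
    fix A assume A: "A \<in> sets unit_borel"
    have A0: "(indicator A :: real \<Rightarrow> ennreal) \<in> borel_measurable unit_lebesgue"
      using A by (intro borel_measurable_indicator) (simp add: sets_restrict_space)
    have iA: "(\<lambda>z. indicator A (snd z) :: ennreal) \<in> borel_measurable (P \<Otimes>\<^sub>M U)"
    proof -
      have "(\<lambda>x. x) \<in> U \<rightarrow>\<^sub>M unit_borel"
        by (rule measurable_restrict_space2) (use id_U in auto)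
      from measurable_compose[OF measurable_compose[OF measurable_snd this] borel_measurable_indicator[OF A]]
      show ?thesis .
    qed
    have "(\<lambda>\<omega>. \<integral>\<^sup>+x. ennreal (hinv \<omega> x) * indicator A x \<partial>U) \<in> borel_measurable P"
      using U.borel_measurable_nn_integral_fst[of "\<lambda>z. ennreal (hinv (fst z) (snd z)) * indicator A (snd z)" P] hinv_joint iA by simp
    moreover have "emeasure (mu \<omega>) A = (\<integral>\<^sup>+x. ennreal (hinv \<omega> x) * indicator A x \<partial>U)" if w: "\<omega> \<in> space P" for \<omega>
      using nn_integral_mu[OF adm_P[OF w] A0] A by (simp add: sets_mu)
    ultimately show "(\<lambda>\<omega>. emeasure (mu \<omega>) A) \<in> borel_measurable P" by (simp cong: measurable_cong)
  qed
qed

lemma swap_measurable: "(\<lambda>z. (snd z, fst z)) \<in> P \<Otimes>\<^sub>M U \<rightarrow>\<^sub>M unit_borel \<Otimes>\<^sub>M P"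
proof (rule measurable_Pair)
  have "(\<lambda>x. x) \<in> U \<rightarrow>\<^sub>M unit_borel" by (rule measurable_restrict_space2) (use id_U in auto)
  then show "snd \<in> P \<Otimes>\<^sub>M U \<rightarrow>\<^sub>M unit_borel" by (rule measurable_compose[OF measurable_snd])
qed simp

lemma fibre_measure_eq: "fibre_measure P mu = distr R (unit_borel \<Otimes>\<^sub>M P) (\<lambda>z. (snd z, fst z))"
proof -
  let ?N = "\<lambda>\<omega>. distr (mu \<omega>) (unit_borel \<Otimes>\<^sub>M P) (\<lambda>x. (x, \<omega>))"
  have N: "?N \<in> P \<rightarrow>\<^sub>M subprob_algebra (unit_borel \<Otimes>\<^sub>M P)"
    by (rule measurable_distr2[where M=unit_borel, OF _ measurable_prob_algebraD[OF mu_measurable]]) simp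
  have sf: "sets (fibre_measure P mu) = sets (unit_borel \<Otimes>\<^sub>M P)"
    unfolding fibre_measure_def by (rule sets_bind) (simp_all add: P.not_empty)
  have sw: "(\<lambda>z. (snd z, fst z)) \<in> R \<rightarrow>\<^sub>M unit_borel \<Otimes>\<^sub>M P" using swap_measurable by (simp add: R_def)
  show ?thesis
  proof (rule measure_eqI)
    fix A assume "A \<in> sets (fibre_measure P mu)"
    then have A: "A \<in> sets (unit_borel \<Otimes>\<^sub>M P)" by (simp add: sf)
    have iA: "(indicator A :: _ \<Rightarrow> ennreal) \<in> borel_measurable (unit_borel \<Otimes>\<^sub>M P)" using A by simp
    have "emeasure (fibre_measure P mu) A = (\<integral>\<^sup>+\<omega>. emeasure (?N \<omega>) A \<partial>P)"
      unfolding fibre_measure_def by (rule emeasure_bind[OF P.not_empty N A])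
    also have "\<dots> = (\<integral>\<^sup>+\<omega>. \<integral>\<^sup>+x. ennreal (hinv \<omega> x) * indicator A (x, \<omega>) \<partial>U \<partial>P)"
    proof (intro nn_integral_cong)
      fix \<omega> assume w: "\<omega> \<in> space P"
      have pm: "(\<lambda>x. (x, \<omega>)) \<in> unit_borel \<rightarrow>\<^sub>M unit_borel \<Otimes>\<^sub>M P" using w by simp
      have pm': "(\<lambda>x. (x, \<omega>)) \<in> mu \<omega> \<rightarrow>\<^sub>M unit_borel \<Otimes>\<^sub>M P"
        using pm by (simp add: measurable_cong_sets[OF sets_mu refl])
      have im: "(\<lambda>x. indicator A (x, \<omega>) :: ennreal) \<in> borel_measurable unit_lebesgue"
        using measurable_compose[OF pm iA] by (subst measurable_cong_sets[of _ unit_borel _ borel]) (auto simp: sets_restrict_space)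
      have "emeasure (?N \<omega>) A = (\<integral>\<^sup>+z. indicator A z \<partial>?N \<omega>)" using A by simp
      also have "\<dots> = (\<integral>\<^sup>+x. indicator A (x, \<omega>) \<partial>mu \<omega>)"
        by (rule nn_integral_distr[OF pm']) (use iA in simp)
      also have "\<dots> = (\<integral>\<^sup>+x. ennreal (hinv \<omega> x) * indicator A (x, \<omega>) \<partial>U)" by (rule nn_integral_mu[OF adm_P[OF w] im])
      finally show "emeasure (?N \<omega>) A = (\<integral>\<^sup>+x. ennreal (hinv \<omega> x) * indicator A (x, \<omega>) \<partial>U)" .
    qed
    also have "\<dots> = (\<integral>\<^sup>+z. indicator A (snd z, fst z) \<partial>R)"
      using nn_integral_R[OF measurable_compose[OF swap_measurable iA]] by simp
    also have "\<dots> = (\<integral>\<^sup>+z. indicator A z \<partial>distr R (unit_borel \<Otimes>\<^sub>M P) (\<lambda>z. (snd z, fst z)))"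
      by (rule nn_integral_distr[OF sw, symmetric]) (use iA in simp)
    also have "\<dots> = emeasure (distr R (unit_borel \<Otimes>\<^sub>M P) (\<lambda>z. (snd z, fst z))) A" using A by simp
    finally show "emeasure (fibre_measure P mu) A = emeasure (distr R (unit_borel \<Otimes>\<^sub>M P) (\<lambda>z. (snd z, fst z))) A" .
  qed (simp add: sf)
qed

lemma L2_fibre:
  assumes "\<phi> \<in> L2_fun (fibre_measure P mu)"
  shows "(\<lambda>z. \<phi> (snd z, fst z)) \<in> borel_measurable (P \<Otimes>\<^sub>M U)" "integrable R (\<lambda>z. (\<phi> (snd z, fst z))\<^sup>2)"
proof -
  have sw: "(\<lambda>z. (snd z, fst z)) \<in> R \<rightarrow>\<^sub>M unit_borel \<Otimes>\<^sub>M P" using swap_measurable by (simp add: R_def)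
  have m: "\<phi> \<in> borel_measurable (unit_borel \<Otimes>\<^sub>M P)" and i: "integrable (distr R (unit_borel \<Otimes>\<^sub>M P) (\<lambda>z. (snd z, fst z))) (\<lambda>x. (\<phi> x)\<^sup>2)"
    using assms unfolding L2_fun_def fibre_measure_eq by auto
  show "(\<lambda>z. \<phi> (snd z, fst z)) \<in> borel_measurable (P \<Otimes>\<^sub>M U)" by (rule measurable_compose[OF swap_measurable m])
  have m2: "(\<lambda>x. (\<phi> x)\<^sup>2) \<in> borel_measurable (unit_borel \<Otimes>\<^sub>M P)" using m by simp
  show "integrable R (\<lambda>z. (\<phi> (snd z, fst z))\<^sup>2)" using i unfolding integrable_distr_eq[OF sw m2] .
qed

lemma mixing:
  assumes supp: "\<And>s. \<alpha>\<^sub>0 < s \<Longrightarrow> 0 < pr s"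
    and \<phi>: "\<phi> \<in> L2_fun (fibre_measure P mu)" and \<psi>: "\<psi> \<in> L2_fun (fibre_measure P mu)"
  shows "(\<lambda>n. \<bar>(\<integral>\<omega>. (\<integral>x. \<phi> (rlsv_iter n \<omega> x, shift (int n) \<omega>) * \<psi> (x, \<omega>) \<partial>mu \<omega>) \<partial>P)
             - (\<integral>\<omega>. (\<integral>x. \<phi> (x, \<omega>) \<partial>mu \<omega>) \<partial>P) * (\<integral>\<omega>. (\<integral>x. \<psi> (x, \<omega>) \<partial>mu \<omega>) \<partial>P)\<bar>)
         \<longlonglongrightarrow> 0"
proof -
  let ?f = "\<lambda>z. \<phi> (snd z, fst z)" and ?g = "\<lambda>z. \<psi> (snd z, fst z)"
  note f = L2_fibre[OF \<phi>] and g = L2_fibre[OF \<psi>]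
  have fR: "?f \<in> borel_measurable R" and gR: "?g \<in> borel_measurable R" using f(1) g(1) by (auto simp: measurable_R)
  have i: "integrable R h" if "h \<in> borel_measurable R" "integrable R (\<lambda>z. (h z)\<^sup>2)" for h :: "_ \<Rightarrow> real"
    using square_integrable_mult(1)[OF that(1) _ that(2), of "\<lambda>_. 1" 1] by simp
  have fs: "(\<lambda>z. ?f (skew n z)) \<in> borel_measurable R" for n
    unfolding measurable_R by (rule measurable_compose[OF skew_measurable f(1)])
  have f2m: "(\<lambda>z. (?f z)\<^sup>2) \<in> borel_measurable (P \<Otimes>\<^sub>M U)" using f(1) by simp
  have fs2: "integrable R (\<lambda>z. (?f (skew n z))\<^sup>2)" for n using integral_skew(2)[OF f2m, of n] f(2) by simp
  have p: "integrable R (\<lambda>z. ?f (skew n z) * ?g z)" for n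
    by (rule square_integrable_mult(1)[OF fs gR fs2 g(2) zero_less_one])
  have e1: "(\<integral>z. ?f (skew n z) * ?g z \<partial>R) = (\<integral>\<omega>. (\<integral>x. \<phi> (rlsv_iter n \<omega> x, shift (int n) \<omega>) * \<psi> (x, \<omega>) \<partial>mu \<omega>) \<partial>P)" for n
    using integral_R(2)[OF p[of n]] by (simp add: skew_def)
  have e2: "(\<integral>z. ?f z \<partial>R) = (\<integral>\<omega>. (\<integral>x. \<phi> (x, \<omega>) \<partial>mu \<omega>) \<partial>P)" "(\<integral>z. ?g z \<partial>R) = (\<integral>\<omega>. (\<integral>x. \<psi> (x, \<omega>) \<partial>mu \<omega>) \<partial>P)"
    using integral_R(2)[OF i[OF fR f(2)]] integral_R(2)[OF i[OF gR g(2)]] by simp_all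
  have "(\<lambda>n. (\<integral>z. ?f (skew n z) * ?g z \<partial>R) - (\<integral>z. ?f z \<partial>R) * (\<integral>z. ?g z \<partial>R)) \<longlonglongrightarrow> 0"
    by (rule mixing_L2[OF supp f g]; assumption)
  then show ?thesis unfolding e1 e2 by (rule tendsto_rabs_zero)
qed

end

theorem theorem5p1:
  fixes \<alpha>\<^sub>0 \<alpha>\<^sub>1 q c :: real and \<nu> :: "real measure" and P :: "(int \<Rightarrow> real) measure"
  assumes "0 < \<alpha>\<^sub>0" and "\<alpha>\<^sub>0 < \<alpha>\<^sub>1" and "\<alpha>\<^sub>1 < 1"
    and "prob_space \<nu>" and "sets \<nu> = sets (restrict_space borel {\<alpha>\<^sub>0..\<alpha>\<^sub>1})"
    and P_def: "P = (\<Pi>\<^sub>M i\<in>(UNIV :: int set). \<nu>)"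
    and "q \<ge> 0" and "c > 0"
    and "(\<lambda>l. ln (real l) powr q / real l * (\<Sum>k=1..l. \<integral>\<omega>. lsv_A \<alpha>\<^sub>0 \<alpha>\<^sub>1 l k \<omega> \<partial>P))
           \<longlonglongrightarrow> c"
  shows "\<exists>\<mu> \<in> P \<rightarrow>\<^sub>M prob_algebra unit_borel.
    (AE \<omega> in P. absolutely_continuous unit_lebesgue (\<mu> \<omega>) \<and>
                distr (\<mu> \<omega>) unit_borel (rlsv \<omega>) = \<mu> (shift 1 \<omega>)) \<and>
    (\<forall>\<phi> \<in> L2_fun (fibre_measure P \<mu>). \<forall>\<psi> \<in> L2_fun (fibre_measure P \<mu>).
       (\<lambda>n. \<bar>(\<integral>\<omega>. (\<integral>x. \<phi> (rlsv_iter n \<omega> x, shift (int n) \<omega>) * \<psi> (x, \<omega>) \<partial>\<mu> \<omega>) \<partial>P)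
             - (\<integral>\<omega>. (\<integral>x. \<phi> (x, \<omega>) \<partial>\<mu> \<omega>) \<partial>P) * (\<integral>\<omega>. (\<integral>x. \<psi> (x, \<omega>) \<partial>\<mu> \<omega>) \<partial>P)\<bar>)
         \<longlonglongrightarrow> 0) \<and>
    (\<forall>\<eta> \<in> {0<..1}. \<forall>\<delta> > 0.
       \<exists>\<Omega>\<^sub>0 \<in> sets P. measure P \<Omega>\<^sub>0 = 1 \<and>
       (\<exists>C \<in> borel_measurable P.
          (\<forall>\<omega>\<in>\<Omega>\<^sub>0. 0 \<le> C \<omega>) \<and>
          (\<forall>\<phi> \<in> Linf_fun unit_lebesgue. \<forall>\<psi>. holder_on \<eta> {0..1} \<psi> \<longrightarrow>
             (\<exists>D :: real. \<forall>\<omega>\<in>\<Omega>\<^sub>0. \<forall>n::nat. n \<ge> 1 \<longrightarrow>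
                \<bar>(\<integral>x. \<phi> (rlsv_iter n \<omega> x) * \<psi> x \<partial>\<mu> \<omega>)
                   - (\<integral>x. \<phi> x \<partial>\<mu> (shift (int n) \<omega>)) * (\<integral>x. \<psi> x \<partial>\<mu> \<omega>)\<bar>
                  \<le> C \<omega> * D * (1 / real n powr (1 / \<alpha>\<^sub>0 - \<delta> - 1)) \<and>
                \<bar>(\<integral>x. \<phi> (rlsv_iter n (shift (- int n) \<omega>) x) * \<psi> x \<partial>\<mu> (shift (- int n) \<omega>))
                   - (\<integral>x. \<phi> x \<partial>\<mu> \<omega>) * (\<integral>x. \<psi> x \<partial>\<mu> (shift (- int n) \<omega>))\<bar>
                  \<le> C \<omega> * D * (1 / real n powr (1 / \<alpha>\<^sub>0 - \<delta> - 1)))) \<and>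
          (\<exists>K u' v' :: real. K > 0 \<and> u' > 0 \<and> 0 < v' \<and> v' < 1 \<and>
             (\<forall>n::nat. measure P {\<omega> \<in> space P. C \<omega> > real n} \<le> K * exp (- u' * real n powr v'))) \<and>
          integrable P C))"
proof -
  interpret lsv_random \<alpha>\<^sub>0 \<alpha>\<^sub>1 \<nu> P by (rule lsv_random.intro) (fact assms)+
  have supp: "0 < pr s" if "\<alpha>\<^sub>0 < s" for s by (rule support[OF assms(8,9) that])
  show ?thesis
  proof (rule bexI[OF _ mu_measurable], intro conjI ballI allI impI)
    show "AE \<omega> in P. absolutely_continuous unit_lebesgue (mu \<omega>) \<and> distr (mu \<omega>) unit_borel (rlsv \<omega>) = mu (shift 1 \<omega>)"
      by (rule AE_I2) (intro conjI absolutely_continuous_mu[OF adm_P] distr_mu[OF adm_P])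
  next
    fix \<phi> \<psi> assume "\<phi> \<in> L2_fun (fibre_measure P mu)" "\<psi> \<in> L2_fun (fibre_measure P mu)"
    then show "(\<lambda>n. \<bar>(\<integral>\<omega>. (\<integral>x. \<phi> (rlsv_iter n \<omega> x, shift (int n) \<omega>) * \<psi> (x, \<omega>) \<partial>mu \<omega>) \<partial>P)
             - (\<integral>\<omega>. (\<integral>x. \<phi> (x, \<omega>) \<partial>mu \<omega>) \<partial>P) * (\<integral>\<omega>. (\<integral>x. \<psi> (x, \<omega>) \<partial>mu \<omega>) \<partial>P)\<bar>) \<longlonglongrightarrow> 0"
      by (intro mixing supp)
  next
    fix \<eta> \<delta> :: real assume "\<eta> \<in> {0<..1}" "0 < \<delta>"
    from correlations[OF supp this]
    show "\<exists>\<Omega>\<^sub>0 \<in> sets P. measure P \<Omega>\<^sub>0 = 1 \<and>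
       (\<exists>C \<in> borel_measurable P.
          (\<forall>\<omega>\<in>\<Omega>\<^sub>0. 0 \<le> C \<omega>) \<and>
          (\<forall>\<phi> \<in> Linf_fun unit_lebesgue. \<forall>\<psi>. holder_on \<eta> {0..1} \<psi> \<longrightarrow>
             (\<exists>D :: real. \<forall>\<omega>\<in>\<Omega>\<^sub>0. \<forall>n::nat. n \<ge> 1 \<longrightarrow>
                \<bar>(\<integral>x. \<phi> (rlsv_iter n \<omega> x) * \<psi> x \<partial>mu \<omega>)
                   - (\<integral>x. \<phi> x \<partial>mu (shift (int n) \<omega>)) * (\<integral>x. \<psi> x \<partial>mu \<omega>)\<bar>
                  \<le> C \<omega> * D * (1 / real n powr (1 / \<alpha>\<^sub>0 - \<delta> - 1)) \<and>
                \<bar>(\<integral>x. \<phi> (rlsv_iter n (shift (- int n) \<omega>) x) * \<psi> x \<partial>mu (shift (- int n) \<omega>))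
                   - (\<integral>x. \<phi> x \<partial>mu \<omega>) * (\<integral>x. \<psi> x \<partial>mu (shift (- int n) \<omega>))\<bar>
                  \<le> C \<omega> * D * (1 / real n powr (1 / \<alpha>\<^sub>0 - \<delta> - 1)))) \<and>
          (\<exists>K u' v' :: real. K > 0 \<and> u' > 0 \<and> 0 < v' \<and> v' < 1 \<and>
             (\<forall>n::nat. measure P {\<omega> \<in> space P. C \<omega> > real n} \<le> K * exp (- u' * real n powr v'))) \<and>
          integrable P C)" by simp
  qed
qed

end
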